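(* Let $W$ be a right-angled Coxeter group. For $0<t<\rho_W$ we have $b^0_t=\chi_t=\dfrac{1}{W(t)}$ and $b^i_t=0$ for all $i>0$.
   Context: A Coxeter group is right-angled if any two generators related in the standard presentation commute. $W(x)=\sum_{w\in W}x^{d(w)}$ is the growth series, with radius of convergence $\rho_W$, and $\chi_t=\sum_i(-1)^ib^i_t$. $b^i_t$ is the weighted $L^2$-Betti number of the Davis complex of $W$, defined as follows. Let $d$ be the word length. ${\bf C}_t[W]$ has basis $\{\delta_w\}$, inner product $\langle\delta_w,\delta_v\rangle_t=t^{d(w)}$ if $w=v$ and $0$ otherwise, and Hecke multiplication $\delta_w\delta_s=\delta_{ws}$ if $d(ws)>d(w)$, $t\delta_{ws}+(t-1)\delta_w$ otherwise. $L^2_t$ is its completion, and $V_t$ is the von Neumann algebra of right multiplications. The trace of right multiplication by $b$ is the $\delta_1$-coefficient of $b$, summed over diagonal entries. In the Davis complex $\Sigma=W\times D/\sim$ (with $D$ the Davis chamber and faces $D_T$), each simplex $\sigma$ has $d(\sigma)=\min\{d(w):\sigma\subseteq wD\}$. $L^2_tC^i(\Sigma)$ consists of cochains square-summable for weight $t^{d(\sigma)}$, with coboundary $\delta$ and adjoint $\partial^tf(\eta)=\sum_{\sigma\supset\eta}[\eta:\sigma]t^{d(\sigma)-d(\eta)}f(\sigma)$. Then $b^i_t$ is the trace of the projection onto the harmonic cochains $\ker\delta\cap\ker\partial^t$, embedded in $\bigoplus_{\sigma\in D^{(i)}}L^2_t$ via $f\mapsto W_{T(\sigma)}(t)^{-1/2}\sum_wf(w\sigma)\delta_w$.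 Here $T(\sigma)$ is the largest $T$ with $\sigma\subseteq D_T$, and $W_T(x)=\sum_{u\in W_T}x^{d(u)}$. *)

theory Defs
  imports "HOL-Analysis.Analysis"
begin

text \<open>Right-angled Coxeter group on a finite generating set S; E s u means m(s,u) = 2
  (s and u commute); non-adjacent distinct generators have m = infinity.
  Group elements are equivalence classes of words over S.\<close>

inductive_set cox_step :: "'a set \<Rightarrow> ('a \<Rightarrow> 'a \<Rightarrow> bool) \<Rightarrow> ('a list \<times> 'a list) set"
  for S E where
  del: "xs \<in> lists S \<Longrightarrow> ys \<in> lists S \<Longrightarrow> s \<in> S \<Longrightarrow> (xs @ [s, s] @ ys, xs @ ys) \<in> cox_step S E"
| swap: "xs \<in> lists S \<Longrightarrow> ys \<in> lists S \<Longrightarrow> s \<in> S \<Longrightarrow> u \<in> S \<Longrightarrow> E s u \<Longrightarrow>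
      (xs @ [s, u] @ ys, xs @ [u, s] @ ys) \<in> cox_step S E"

definition cox_eq :: "'a set \<Rightarrow> ('a \<Rightarrow> 'a \<Rightarrow> bool) \<Rightarrow> ('a list \<times> 'a list) set" where
  "cox_eq S E = (cox_step S E \<union> (cox_step S E)\<inverse>)\<^sup>*"

definition cox_cls :: "'a set \<Rightarrow> ('a \<Rightarrow> 'a \<Rightarrow> bool) \<Rightarrow> 'a list \<Rightarrow> 'a list set" where
  "cox_cls S E xs = {ys. (xs, ys) \<in> cox_eq S E}"

definition cox_grp :: "'a set \<Rightarrow> ('a \<Rightarrow> 'a \<Rightarrow> bool) \<Rightarrow> 'a list set set" where
  "cox_grp S E = cox_cls S E ` lists S"

definition cox_one :: "'a set \<Rightarrow> ('a \<Rightarrow> 'a \<Rightarrow> bool) \<Rightarrow> 'a list set" where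
  "cox_one S E = cox_cls S E []"

definition cox_mult :: "'a set \<Rightarrow> ('a \<Rightarrow> 'a \<Rightarrow> bool) \<Rightarrow> 'a list set \<Rightarrow> 'a list set \<Rightarrow> 'a list set" where
  "cox_mult S E w v = {zs. \<exists>xs\<in>w. \<exists>ys\<in>v. (xs @ ys, zs) \<in> cox_eq S E}"

definition cox_len :: "'a list set \<Rightarrow> nat" where
  "cox_len w = (LEAST n. \<exists>xs\<in>w. length xs = n)"

definition special :: "'a set \<Rightarrow> ('a \<Rightarrow> 'a \<Rightarrow> bool) \<Rightarrow> 'a set \<Rightarrow> 'a list set set" where
  "special S E T = cox_cls S E ` lists T"

definition spherical :: "'a set \<Rightarrow> ('a \<Rightarrow> 'a \<Rightarrow> bool) \<Rightarrow> 'a set \<Rightarrow> bool" where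
  "spherical S E T \<longleftrightarrow> T \<subseteq> S \<and> finite (special S E T)"

text \<open>W_T(x) for spherical T (a finite sum).\<close>
definition poincare :: "'a set \<Rightarrow> ('a \<Rightarrow> 'a \<Rightarrow> bool) \<Rightarrow> 'a set \<Rightarrow> real \<Rightarrow> real" where
  "poincare S E T x = (\<Sum>u\<in>special S E T. x ^ cox_len u)"

definition growth :: "'a set \<Rightarrow> ('a \<Rightarrow> 'a \<Rightarrow> bool) \<Rightarrow> real \<Rightarrow> real" where
  "growth S E x = infsum (\<lambda>w. x ^ cox_len w) (cox_grp S E)"

definition growth_radius :: "'a set \<Rightarrow> ('a \<Rightarrow> 'a \<Rightarrow> bool) \<Rightarrow> ereal" where
  "growth_radius S E = conv_radius (\<lambda>n. real (card {w \<in> cox_grp S E. cox_len w = n}))"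

text \<open>Simplices of the Davis chamber D = |S^f|: chains T_0 < ... < T_i of spherical subsets.\<close>
definition dchains :: "'a set \<Rightarrow> ('a \<Rightarrow> 'a \<Rightarrow> bool) \<Rightarrow> nat \<Rightarrow> 'a set list set" where
  "dchains S E i = {c. length c = Suc i \<and> sorted_wrt (\<lambda>A B. A \<subset> B) c \<and> (\<forall>T\<in>set c. spherical S E T)}"

definition coset :: "'a set \<Rightarrow> ('a \<Rightarrow> 'a \<Rightarrow> bool) \<Rightarrow> 'a list set \<Rightarrow> 'a set \<Rightarrow> 'a list set set" where
  "coset S E w T = cox_mult S E w ` special S E T"

text \<open>i-simplices of the Davis complex: w(chain) = (w W_{T_0}, chain).\<close>
type_synonym 'a dsimplex = "'a list set set \<times> 'a set list"

definition ssimp :: "'a set \<Rightarrow> ('a \<Rightarrow> 'a \<Rightarrow> bool) \<Rightarrow> nat \<Rightarrow> 'a dsimplex set" where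
  "ssimp S E i = {(C, c). c \<in> dchains S E i \<and> (\<exists>w\<in>cox_grp S E. C = coset S E w (hd c))}"

definition sdeg :: "'a dsimplex \<Rightarrow> nat" where
  "sdeg \<sigma> = (LEAST n. \<exists>w\<in>fst \<sigma>. cox_len w = n)"

definition sface :: "'a set \<Rightarrow> ('a \<Rightarrow> 'a \<Rightarrow> bool) \<Rightarrow> nat \<Rightarrow> 'a dsimplex \<Rightarrow> 'a dsimplex" where
  "sface S E j \<sigma> = (if j = 0
     then (coset S E (SOME w. w \<in> fst \<sigma>) (snd \<sigma> ! 1), tl (snd \<sigma>))
     else (fst \<sigma>, take j (snd \<sigma>) @ drop (Suc j) (snd \<sigma>)))"

definition cobd :: "'a set \<Rightarrow> ('a \<Rightarrow> 'a \<Rightarrow> bool) \<Rightarrow> nat \<Rightarrow> ('a dsimplex \<Rightarrow> complex) \<Rightarrow> 'a dsimplex \<Rightarrow> complex" where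
  "cobd S E i f \<sigma> = (\<Sum>j\<le>Suc i. (-1) ^ j * f (sface S E j \<sigma>))"

text \<open>Weighted adjoint of the coboundary: applied to an (i+1)-cochain, evaluated on an i-simplex.\<close>
definition bdt :: "'a set \<Rightarrow> ('a \<Rightarrow> 'a \<Rightarrow> bool) \<Rightarrow> real \<Rightarrow> nat \<Rightarrow> ('a dsimplex \<Rightarrow> complex) \<Rightarrow> 'a dsimplex \<Rightarrow> complex" where
  "bdt S E t i f \<eta> =
     (\<Sum>(\<sigma>, j)\<in>{(\<sigma>, j). \<sigma> \<in> ssimp S E (Suc i) \<and> j \<le> Suc i \<and> sface S E j \<sigma> = \<eta>}.
        (-1) ^ j * complex_of_real (t ^ sdeg \<sigma> / t ^ sdeg \<eta>) * f \<sigma>)"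

definition l2coch :: "'a set \<Rightarrow> ('a \<Rightarrow> 'a \<Rightarrow> bool) \<Rightarrow> real \<Rightarrow> nat \<Rightarrow> ('a dsimplex \<Rightarrow> complex) set" where
  "l2coch S E t i = {f. (\<forall>\<sigma>. \<sigma> \<notin> ssimp S E i \<longrightarrow> f \<sigma> = 0) \<and>
       (\<lambda>\<sigma>. (cmod (f \<sigma>))\<^sup>2 * t ^ sdeg \<sigma>) summable_on ssimp S E i}"

definition harmonic :: "'a set \<Rightarrow> ('a \<Rightarrow> 'a \<Rightarrow> bool) \<Rightarrow> real \<Rightarrow> nat \<Rightarrow> ('a dsimplex \<Rightarrow> complex) set" where
  "harmonic S E t i = {f \<in> l2coch S E t i.
      (\<forall>\<sigma>\<in>ssimp S E (Suc i). cobd S E i f \<sigma> = 0) \<and>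
      (0 < i \<longrightarrow> (\<forall>\<eta>\<in>ssimp S E (i - 1). bdt S E t (i - 1) f \<eta> = 0))}"

definition l2sum :: "'a set \<Rightarrow> ('a \<Rightarrow> 'a \<Rightarrow> bool) \<Rightarrow> real \<Rightarrow> nat \<Rightarrow> ('a set list \<times> 'a list set \<Rightarrow> complex) set" where
  "l2sum S E t i = {g. (\<forall>p. p \<notin> dchains S E i \<times> cox_grp S E \<longrightarrow> g p = 0) \<and>
       (\<lambda>(c, w). (cmod (g (c, w)))\<^sup>2 * t ^ cox_len w) summable_on (dchains S E i \<times> cox_grp S E)}"

definition inner_t :: "'a set \<Rightarrow> ('a \<Rightarrow> 'a \<Rightarrow> bool) \<Rightarrow> real \<Rightarrow> nat \<Rightarrow>
    ('a set list \<times> 'a list set \<Rightarrow> complex) \<Rightarrow> ('a set list \<times> 'a list set \<Rightarrow> complex) \<Rightarrow> complex" where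
  "inner_t S E t i g h = infsum (\<lambda>(c, w). g (c, w) * cnj (h (c, w)) * complex_of_real (t ^ cox_len w))
       (dchains S E i \<times> cox_grp S E)"

definition embed :: "'a set \<Rightarrow> ('a \<Rightarrow> 'a \<Rightarrow> bool) \<Rightarrow> real \<Rightarrow> nat \<Rightarrow> ('a dsimplex \<Rightarrow> complex) \<Rightarrow>
    ('a set list \<times> 'a list set \<Rightarrow> complex)" where
  "embed S E t i f = (\<lambda>(c, w). if c \<in> dchains S E i \<and> w \<in> cox_grp S E
      then complex_of_real (1 / sqrt (poincare S E (hd c) t)) * f (coset S E w (hd c), c) else 0)"

definition orth_proj :: "'a set \<Rightarrow> ('a \<Rightarrow> 'a \<Rightarrow> bool) \<Rightarrow> real \<Rightarrow> nat \<Rightarrow>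
    ('a set list \<times> 'a list set \<Rightarrow> complex) set \<Rightarrow> ('a set list \<times> 'a list set \<Rightarrow> complex) \<Rightarrow>
    ('a set list \<times> 'a list set \<Rightarrow> complex)" where
  "orth_proj S E t i V x = (THE y. y \<in> V \<and> (\<forall>v\<in>V. inner_t S E t i (x - y) v = 0))"

text \<open>Weighted L^2-Betti number: trace of the projection onto the embedded harmonic cochains,
  i.e. the sum over diagonal entries of the delta_1-coefficient.\<close>
definition wbetti :: "'a set \<Rightarrow> ('a \<Rightarrow> 'a \<Rightarrow> bool) \<Rightarrow> real \<Rightarrow> nat \<Rightarrow> complex" where
  "wbetti S E t i = (\<Sum>c\<in>dchains S E i.
      orth_proj S E t i (embed S E t i ` harmonic S E t i)
        (\<lambda>(c', w). if c' = c \<and> w = cox_one S E then 1 else 0) (c, cox_one S E))"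

text \<open>chi_t = alternating sum; D has no simplices of dimension > card S.\<close>
definition wchi :: "'a set \<Rightarrow> ('a \<Rightarrow> 'a \<Rightarrow> bool) \<Rightarrow> real \<Rightarrow> complex" where
  "wchi S E t = (\<Sum>i\<le>card S. (-1) ^ i * wbetti S E t i)"

end

theory Submission
  imports Defs
begin

text \<open>
  Let In(w) be the set of letters in which a reduced word of w can end; it is a clique of
  commuting generators. Deleting all of them from w induces a monotone map P on the poset of
  spherical cosets. P is chain homotopic to the identity: a coset and its image lie in a union of
  spherical cosets through a common vertex, which is conically contractible, and acyclic carriers
  give a homotopy of bounded size that only involves nearby simplices. It is therefore bounded on
  the weighted square-summable cochains, and pulling a cocycle back along P changes it by the
  coboundary of a square-summable cochain. Hence a harmonic f of positive degree satisfies
  \<open>\<langle>f, f\<rangle> = \<langle>(P\<^sup>n)\<^sup>* f, f\<rangle>\<close> for all n. An element w with P^n w = u that has not collapsed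
  is u v with the length of v equal to the difference of lengths and at least n, and so
  the squared norm of the pullback is at most a constant times the tail of the growth series times
  that of f. The tail tends to 0, so f = 0. In degree 0 the harmonic cochains are the
  constants, and the trace is computed directly.
\<close>

subsection \<open>Ordered chains in a poset\<close>

text \<open>The map P may identify vertices of a simplex. Chains are therefore weakly increasing,
  and cochains are extended by zero to chains with a repetition, as in a normalized complex. Chain
  maps and homotopies are given by their effect on cochains, so formal sums never occur and bounding
  an operator means bounding values.

  A coset and its image need not lie in one common spherical coset, because the last letters of its
  shortest element need not commute with its type. This is why the carrier is a union of cosets and
  needs a cone point.

  The estimate for P^n is confined to positive degree: every w of length at most n is sent to the
  identity, so a fibre over a vertex there is large. A simplex of positive dimension has a second
  vertex, and if the first one reaches the identity before step n, the two vertices become equal and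
  the image degenerates. What survives has lost at least n letters. So constants persist in degree 0
  and nothing persists above. Only the convergence of the tail to 0 is used, without a rate of
  decay.\<close>

primrec cobound :: "('x list \<Rightarrow> complex) \<Rightarrow> 'x list \<Rightarrow> complex" where
  "cobound F [] = 0"
| "cobound F (x # l) = F l - cobound (\<lambda>m. F (x # m)) l"

primrec faces :: "'x list \<Rightarrow> 'x list set" where
  "faces [] = {}"
| "faces (x # l) = insert l ((#) x ` faces l)"

primrec prism :: "('x \<Rightarrow> 'x) \<Rightarrow> ('x list \<Rightarrow> complex) \<Rightarrow> 'x list \<Rightarrow> complex" where
  "prism J F [] = 0"
| "prism J F (x # l) = F (x # J x # map J l) - prism J (\<lambda>m. F (x # m)) l"

primrec prisms :: "('x \<Rightarrow> 'x) \<Rightarrow> 'x list \<Rightarrow> 'x list set" where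
  "prisms J [] = {}"
| "prisms J (x # l) = insert (x # J x # map J l) ((#) x ` prisms J l)"

lemma cobound_diff: "cobound (\<lambda>m. F m - G m) l = cobound F l - cobound G l"
  by (induction l arbitrary: F G) auto

lemma cobound_cong: "(\<And>m. m \<in> faces l \<Longrightarrow> F m = G m) \<Longrightarrow> cobound F l = cobound G l"
proof (induction l arbitrary: F G)
  case (Cons x l)
  have "cobound (\<lambda>m. F (x # m)) l = cobound (\<lambda>m. G (x # m)) l"
    by (rule Cons.IH) (use Cons.prems in auto)
  then show ?case using Cons.prems by auto
qed simp

lemma cobound_zero [simp]: "cobound (\<lambda>m. 0) l = 0"
  by (induction l) auto

lemma Suc_length_faces: "m \<in> faces l \<Longrightarrow> Suc (length m) = length l"
proof (induction l arbitrary: m)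
  case (Cons x l)
  then consider "m = l" | k where "k \<in> faces l" "m = x # k" by auto
  then show ?case using Cons.IH by cases simp_all
qed simp

lemma length_faces: "m \<in> faces l \<Longrightarrow> length m = length l - 1"
  using Suc_length_faces by fastforce

lemma cobound_dl: "cobound (cobound F) l = 0"
  by (induction l arbitrary: F) (simp_all add: cobound_diff)

lemma cobound_map: "cobound (\<lambda>m. G (map J m)) l = cobound G (map J l)"
proof (induction l arbitrary: G)
  case (Cons x l)
  show ?case using Cons.IH[of "\<lambda>m. G (J x # m)"] by simp
qed simp

lemma prism_diff: "prism J (\<lambda>m. F m - G m) l = prism J F l - prism J G l"
  by (induction l arbitrary: F G) auto

lemma prism_dl: "prism J (cobound F) l = F (map J l) - F l - cobound (prism J F) l"
proof (induction l arbitrary: F)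
  case (Cons x l)
  have "cobound (\<lambda>m. F (x # J x # map J m)) l = cobound (\<lambda>m. F (x # J x # m)) (map J l)"
    by (rule cobound_map)
  then show ?case using Cons.IH[of "\<lambda>m. F (x # m)"]
    by (simp add: prism_diff cobound_diff)
qed simp

text \<open>
  Chain operators are given by their action on cochains. \<open>prism J\<close> is dual to the homotopy
  between the identity and J, and \<open>econe a J\<close> to the contraction to a of a poset in which
  \<open>x \<le> J x \<ge> a\<close>.
\<close>

definition econe :: "'x \<Rightarrow> ('x \<Rightarrow> 'x) \<Rightarrow> ('x list \<Rightarrow> complex) \<Rightarrow> 'x list \<Rightarrow> complex" where
  "econe a J F l = F (a # map J l) - prism J F l"

lemma econe_diff: "econe a J (\<lambda>m. F m - G m) l = econe a J F l - econe a J G l"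
  by (simp add: econe_def prism_diff)

text \<open>The boundary of the cone \<open>a # map J l\<close> supplies \<open>map J l\<close>,
  which the prism trades for l. The complex is augmented, with \<open>cobound F [x] = F []\<close>,
  so the identity holds for chains of every length, the empty one included.\<close>

lemma econe_dl: "econe a J (cobound F) = (\<lambda>l. F l - cobound (econe a J F) l)"
proof
  fix l
  have "cobound (\<lambda>m. F (a # map J m)) l = cobound (\<lambda>m. F (a # m)) (map J l)"
    by (rule cobound_map)
  then show "econe a J (cobound F) l = F l - cobound (econe a J F) l"
    by (simp add: econe_def[abs_def] prism_dl cobound_diff)
qed

text \<open>
  The acyclic carrier construction: with c the contraction of the carrier of l, the homotopy
  between the identity and P is H l = c (l - P l - H (boundary of l)).
\<close>

primrec htpy :: "('x \<Rightarrow> 'x) \<Rightarrow> ('x \<Rightarrow> 'x) \<Rightarrow> ('x \<Rightarrow> 'x \<Rightarrow> 'x) \<Rightarrow> nat \<Rightarrow> 'x list \<Rightarrow> ('x list \<Rightarrow> complex) \<Rightarrow> complex" where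
  "htpy P a J 0 l F = 0"
| "htpy P a J (Suc n) l F =
     (let G = econe (a (last l)) (J (last l)) F
      in G l - G (map P l) - cobound (\<lambda>m. htpy P a J n m G) l)"

lemma htpy_diff: "htpy P a J n l (\<lambda>m. F m - G m) = htpy P a J n l F - htpy P a J n l G"
proof (induction n arbitrary: l F G)
  case (Suc n)
  show ?case
    by (simp add: econe_diff[abs_def] Suc.IH cobound_diff Let_def)
qed simp

text \<open>A formal identity, free of any order or carrier condition. If G is the cone of F, then
  the cone of \<open>cobound F\<close> is F minus \<open>cobound G\<close>; the terms in G cancel by
  the induction hypothesis, \<open>cobound_map\<close> and \<open>cobound_dl\<close>.\<close>

lemma htpy_dl:
  "length l = n \<Longrightarrow> htpy P a J n l (cobound F) = F l - F (map P l) - cobound (\<lambda>m. htpy P a J (n - 1) m F) l"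
proof (induction n arbitrary: l F)
  case (Suc n)
  let ?G = "econe (a (last l)) (J (last l)) F"
  have 1: "cobound (\<lambda>m. htpy P a J n m (cobound ?G)) l
      = cobound (\<lambda>m. ?G m - ?G (map P m) - cobound (\<lambda>k. htpy P a J (n - 1) k ?G) m) l"
    using Suc.prems by (intro cobound_cong Suc.IH) (simp add: length_faces)
  have "\<dots> = cobound ?G l - cobound ?G (map P l)"
    by (simp add: cobound_diff cobound_dl cobound_map[of ?G P])
  with 1 show ?case
    by (simp add: econe_dl htpy_diff cobound_diff Let_def)
qed simp

lemma cobound_bound:
  assumes "\<And>m. m \<in> faces l \<Longrightarrow> cmod (F m) \<le> B"
  shows "cmod (cobound F l) \<le> real (length l) * B"
  using assms
proof (induction l arbitrary: F)
  case (Cons x l)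
  have "cmod (cobound F (x # l)) \<le> cmod (F l) + cmod (cobound (\<lambda>m. F (x # m)) l)"
    by (simp add: norm_triangle_ineq4)
  also have "\<dots> \<le> B + real (length l) * B"
    by (intro add_mono Cons.IH) (use Cons.prems in auto)
  finally show ?case by (simp add: algebra_simps)
qed simp

lemma prism_bound:
  assumes "\<And>m. m \<in> prisms J l \<Longrightarrow> cmod (F m) \<le> B"
  shows "cmod (prism J F l) \<le> real (length l) * B"
  using assms
proof (induction l arbitrary: F)
  case (Cons x l)
  have "cmod (prism J F (x # l)) \<le> cmod (F (x # J x # map J l)) + cmod (prism J (\<lambda>m. F (x # m)) l)"
    by (simp add: norm_triangle_ineq4)
  also have "\<dots> \<le> B + real (length l) * B"
    by (intro add_mono Cons.IH) (use Cons.prems in auto)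
  finally show ?case by (simp add: algebra_simps)
qed simp

text \<open>Weak inequalities, since the maps applied to chains may identify members. The index
  counts vertices and is the dimension plus one.\<close>

definition wchains :: "nat \<Rightarrow> 'x::order set \<Rightarrow> 'x list set" where
  "wchains n Y = {l. length l = n \<and> sorted_wrt (\<le>) l \<and> set l \<subseteq> Y}"

lemma wchains_Cons:
  "x # l \<in> wchains n Y \<longleftrightarrow> (\<exists>n'. n = Suc n' \<and> l \<in> wchains n' Y) \<and> x \<in> Y \<and> (\<forall>y\<in>set l. x \<le> y)"
  by (auto simp: wchains_def)

lemma set_faces: "m \<in> faces l \<Longrightarrow> set m \<subseteq> set l"
  by (induction l arbitrary: m) fastforce+

lemma faces_wchains:
  "l \<in> wchains (Suc n) Y \<Longrightarrow> m \<in> faces l \<Longrightarrow> m \<in> wchains n Y"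
proof (induction l arbitrary: m n)
  case (Cons x l)
  from Cons.prems(2) consider "m = l" | k where "k \<in> faces l" "m = x # k" by auto
  then show ?case
  proof cases
    case 1
    then show ?thesis using Cons.prems(1) by (simp add: wchains_Cons)
  next
    case 2
    have l: "l \<in> wchains n Y" "x \<in> Y" "\<forall>y\<in>set l. x \<le> y"
      using Cons.prems(1) by (simp_all add: wchains_Cons)
    then have "length l = n" by (simp add: wchains_def)
    then obtain n' where n: "n = Suc n'" using 2 by (cases l) auto
    have "k \<in> wchains n' Y" using Cons.IH l(1) n 2 by blast
    then show ?thesis using 2 n l set_faces[OF 2(1)] by (auto simp: wchains_Cons)
  qed
qed simp

lemma last_faces:
  assumes "l \<in> wchains (Suc n) Y" "m \<in> faces l" "m \<noteq> []"
  shows "last m \<le> last l"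
proof -
  have "last m \<in> set l" using set_faces[OF assms(2)] assms(3) by auto
  moreover have "l \<noteq> []" using assms by auto
  moreover have "x \<le> last l" if "sorted_wrt (\<le>) l" "x \<in> set l" for x and l :: "'a list"
    using that by (induction l) auto
  ultimately show ?thesis using assms by (auto simp: wchains_def)
qed

text \<open>An acyclic carrier in order-theoretic form. From \<open>D \<le> J C D\<close> and
  \<open>apex C \<le> J C D\<close> one gets a conical contraction of \<open>car C\<close> to
  \<open>apex C\<close>; since C and \<open>P C\<close> both lie in \<open>car C\<close>, they can
  be joined inside it.\<close>

locale carried =
  fixes X :: "'x::order set" and P :: "'x \<Rightarrow> 'x" and apex :: "'x \<Rightarrow> 'x"
    and J :: "'x \<Rightarrow> 'x \<Rightarrow> 'x" and car :: "'x \<Rightarrow> 'x set"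
  assumes car_mono: "C \<in> X \<Longrightarrow> D \<in> X \<Longrightarrow> C \<le> D \<Longrightarrow> car C \<subseteq> car D"
    and car_self: "C \<in> X \<Longrightarrow> C \<in> car C"
    and car_P: "C \<in> X \<Longrightarrow> P C \<in> car C"
    and P_mono: "C \<in> X \<Longrightarrow> D \<in> X \<Longrightarrow> C \<le> D \<Longrightarrow> P C \<le> P D"
    and apex_car: "C \<in> X \<Longrightarrow> apex C \<in> car C"
    and J_car: "C \<in> X \<Longrightarrow> D \<in> car C \<Longrightarrow> J C D \<in> car C"
    and J_ge: "C \<in> X \<Longrightarrow> D \<in> car C \<Longrightarrow> D \<le> J C D"
    and apex_le_J: "C \<in> X \<Longrightarrow> D \<in> car C \<Longrightarrow> apex C \<le> J C D"
    and J_mono: "C \<in> X \<Longrightarrow> D \<in> car C \<Longrightarrow> D' \<in> car C \<Longrightarrow> D \<le> D' \<Longrightarrow> J C D \<le> J C D'"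
begin

lemma map_J_wchains:
  assumes "C \<in> X" "l \<in> wchains n (car C)"
  shows "map (J C) l \<in> wchains n (car C)"
  using assms
proof (induction l arbitrary: n)
  case (Cons x l)
  have "map (J C) l \<in> wchains (length l) (car C)"
    by (rule Cons.IH) (use Cons.prems in \<open>auto simp: wchains_def\<close>)
  then show ?case using Cons.prems
    by (auto simp: wchains_def J_car intro!: J_mono)
qed (auto simp: wchains_def)

text \<open>The lower bound \<open>hd l\<close> is there for the induction: it allows a smaller
  element to be put in front of a prism.\<close>

lemma prisms_wchains:
  assumes "C \<in> X" "l \<in> wchains n (car C)" "m \<in> prisms (J C) l"
  shows "m \<in> wchains (Suc n) (car C) \<and> (\<forall>y\<in>set m. hd l \<le> y)"
  using assms
proof (induction l arbitrary: n m)
  case (Cons x l)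
  have n: "n = Suc (length l)" using Cons.prems by (auto simp: wchains_def)
  have l: "l \<in> wchains (length l) (car C)" using Cons.prems by (auto simp: wchains_def)
  show ?case
  proof (cases "m = x # J C x # map (J C) l")
    case True
    have m: "map (J C) (x # l) \<in> wchains n (car C)"
      using Cons.prems by (intro map_J_wchains)
    have x: "x \<in> car C" using Cons.prems by (auto simp: wchains_def)
    have "x \<le> J C x" using J_ge[OF Cons.prems(1) x] .
    moreover have "\<forall>y\<in>set l. x \<le> J C y"
    proof
      fix y assume y: "y \<in> set l"
      then have "y \<in> car C" "x \<le> y" using Cons.prems by (auto simp: wchains_def)
      then show "x \<le> J C y" using J_ge[OF Cons.prems(1)] order_trans by blast
    qed
    ultimately show ?thesis using True m n x by (auto simp: wchains_def)
  next
    case False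
    then obtain k where k: "k \<in> prisms (J C) l" "m = x # k" using Cons.prems by auto
    have ih: "k \<in> wchains (Suc (length l)) (car C) \<and> (\<forall>y\<in>set k. hd l \<le> y)"
      using Cons.prems by (intro Cons.IH l k)
    have ne: "l \<noteq> []" using k by auto
    then have "x \<le> hd l" using Cons.prems by (auto simp: wchains_def)
    then have "\<forall>y\<in>set k. x \<le> y" using ih order_trans by blast
    then show ?thesis using ih k n Cons.prems by (auto simp: wchains_def)
  qed
qed simp

lemma econe_bound:
  assumes "C \<in> X" "l \<in> wchains n (car C)"
    and "\<And>m. m \<in> wchains (Suc n) (car C) \<Longrightarrow> cmod (F m) \<le> B"
  shows "cmod (econe (apex C) (J C) F l) \<le> real (n + 1) * B"
proof -
  have "apex C # map (J C) l \<in> wchains (Suc n) (car C)"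
    using map_J_wchains[OF assms(1,2)] assms apex_car apex_le_J
    by (auto simp: wchains_def)
  then have 1: "cmod (F (apex C # map (J C) l)) \<le> B" by (rule assms)
  have 2: "cmod (prism (J C) F l) \<le> real (length l) * B"
    using prisms_wchains[OF assms(1,2)] assms(3) by (intro prism_bound) blast
  have "length l = n" using assms by (auto simp: wchains_def)
  moreover have "cmod (econe (apex C) (J C) F l) \<le> cmod (F (apex C # map (J C) l)) + cmod (prism (J C) F l)"
    by (simp add: econe_def norm_triangle_ineq4)
  ultimately show ?thesis using 1 2 by (simp add: algebra_simps)
qed

lemma map_P_wchains:
  assumes "l \<in> wchains n X" "P ` X \<subseteq> X"
  shows "map P l \<in> wchains n X"
  using assms
proof (induction l arbitrary: n)
  case (Cons x l)
  have "map P l \<in> wchains (length l) X"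
    by (rule Cons.IH) (use Cons.prems in \<open>auto simp: wchains_def\<close>)
  then show ?case using Cons.prems
    by (auto simp: wchains_def intro!: P_mono)
qed (auto simp: wchains_def)

lemma map_P_wchains_car:
  assumes "l \<in> wchains n X" "l \<noteq> []"
  shows "map P l \<in> wchains n (car (last l))" "l \<in> wchains n (car (last l))"
proof -
  have le: "x \<le> last l" if "sorted_wrt (\<le>) l" "x \<in> set l" for x and l :: "'x list"
    using that by (induction l) auto
  have X: "last l \<in> X" using assms by (auto simp: wchains_def)
  have c: "car x \<subseteq> car (last l)" if "x \<in> set l" for x
    using that assms X by (intro car_mono le) (auto simp: wchains_def)
  have "sorted_wrt (\<le>) (map P l)"
    using assms(1) unfolding sorted_wrt_map wchains_def
    by (auto elim!: sorted_wrt_mono_rel[rotated] intro!: P_mono)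
  then show "map P l \<in> wchains n (car (last l))"
    using c car_P assms by (auto simp: wchains_def)
  show "l \<in> wchains n (car (last l))"
    using c car_self assms by (auto simp: wchains_def)
qed

text \<open>K depends on n alone, and F is tested only inside the carrier of the last, largest
  vertex. This uniformity and locality later make the homotopy a bounded operator. The guard
  \<open>0 < n\<close> excludes the meaningless \<open>last []\<close>.\<close>

lemma htpy_bound:
  "\<exists>K\<ge>0. \<forall>l F B. l \<in> wchains n X \<longrightarrow> (0 < n \<longrightarrow> (\<forall>m\<in>wchains (Suc n) (car (last l)). cmod (F m) \<le> B))
     \<longrightarrow> 0 \<le> B \<longrightarrow> cmod (htpy P apex J n l F) \<le> K * B"
proof (induction n)
  case 0
  show ?case by (intro exI[of _ 0]) auto
next
  case (Suc n)
  then obtain K where K0: "K \<ge> 0" and K: "\<And>l F B. l \<in> wchains n X \<Longrightarrow>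
      (0 < n \<longrightarrow> (\<forall>m\<in>wchains (Suc n) (car (last l)). cmod (F m) \<le> B))
     \<Longrightarrow> 0 \<le> B \<Longrightarrow> cmod (htpy P apex J n l F) \<le> K * B"
    by blast
  \<comment> \<open>The summands belong to \<open>G l\<close>, to \<open>G (map P l)\<close> and to
    the \<open>Suc n\<close> faces of l; each use of G costs the factor from
    \<open>econe_bound\<close>.\<close>
  let ?K = "real (Suc n + 1) + real (Suc n + 1) + real (Suc n) * (K * real (Suc n + 1))"
  show ?case
  proof (intro exI[of _ ?K] conjI allI impI)
    show "0 \<le> ?K" using K0 by auto
    fix l F and B :: real
    assume l: "l \<in> wchains (Suc n) X"
      and F': "0 < Suc n \<longrightarrow> (\<forall>m\<in>wchains (Suc (Suc n)) (car (last l)). cmod (F m) \<le> B)"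
      and B: "0 \<le> B"
    then have F: "\<And>m. m\<in>wchains (Suc (Suc n)) (car (last l)) \<Longrightarrow> cmod (F m) \<le> B" by auto
    define C where "C = last l"
    have ne: "l \<noteq> []" and len: "length l = Suc n" using l by (auto simp: wchains_def)
    have C: "C \<in> X" using l ne by (auto simp: wchains_def C_def)
    define G where "G = econe (apex C) (J C) F"
    have G: "cmod (G m) \<le> real (Suc n + 1) * B" if "m \<in> wchains (Suc n) (car C)" for m
      unfolding G_def using that F C_def by (intro econe_bound[OF C]) auto
    have "cmod (G l) \<le> real (Suc n + 1) * B" "cmod (G (map P l)) \<le> real (Suc n + 1) * B"
      using map_P_wchains_car[OF l ne] G C_def by auto
    moreover have "cmod (cobound (\<lambda>m. htpy P apex J n m G) l) \<le> real (length l) * (K * (real (Suc n + 1) * B))"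
    proof (rule cobound_bound)
      fix m assume m: "m \<in> faces l"
      have mX: "m \<in> wchains n X" by (rule faces_wchains[OF l m])
      show "cmod (htpy P apex J n m G) \<le> K * (real (Suc n + 1) * B)"
      proof (rule K[OF mX])
        show "0 < n \<longrightarrow> (\<forall>m\<in>wchains (Suc n) (car (last m)). cmod (G m) \<le> real (Suc n + 1) * B)"
        proof (intro impI ballI)
          fix k assume "0 < n" and k: "k \<in> wchains (Suc n) (car (last m))"
          then have mne: "m \<noteq> []" using mX by (auto simp: wchains_def)
          \<comment> \<open>A face may use its own, smaller cone: its carrier lies inside the
            carrier of l, where G is already controlled.\<close>
          have "last m \<le> C" unfolding C_def by (rule last_faces[OF l m mne])
          moreover have "last m \<in> X" using mX mne by (auto simp: wchains_def)
          ultimately have "car (last m) \<subseteq> car C" using C by (intro car_mono)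
          then show "cmod (G k) \<le> real (Suc n + 1) * B"
            using k by (intro G) (auto simp: wchains_def)
        qed
      qed (use B in auto)
    qed
    moreover have "cmod (htpy P apex J (Suc n) l F) \<le> cmod (G l) + cmod (G (map P l))
        + cmod (cobound (\<lambda>m. htpy P apex J n m G) l)"
      unfolding htpy.simps Let_def C_def[symmetric] G_def[symmetric]
      by (meson norm_triangle_ineq4 order_trans add_mono order_refl)
    ultimately have "cmod (htpy P apex J (Suc n) l F) \<le> real (Suc n + 1) * B + real (Suc n + 1) * B + real (length l) * (K * (real (Suc n + 1) * B))"
      by linarith
    then show "cmod (htpy P apex J (Suc n) l F) \<le> ?K * B"
      by (simp only: len algebra_simps)
  qed
qed

end

section \<open>Degenerate chains\<close>

lemma cobound_sum: "cobound F l = (\<Sum>j<length l. (-1) ^ j * F (take j l @ drop (Suc j) l))"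
proof (induction l arbitrary: F)
  case (Cons x l)
  show ?case by (simp add: Cons.IH sum.lessThan_Suc_shift sum_negf del: sum.lessThan_Suc)
qed simp

text \<open>Deleting either of two equal neighbours gives the same list with opposite signs, and all
  other faces keep the repetition. Normalized cochains are thus closed under the coboundary.\<close>

lemma cobound_repetition:
  assumes "\<And>a x b. F (a @ [x, x] @ b) = 0"
  shows "cobound F (a @ [x, x] @ b) = 0"
  using assms
proof (induction a arbitrary: F)
  case Nil
  have "(\<lambda>m. F (x # x # m)) = (\<lambda>m. 0)" using Nil[of "[]"] by auto
  then show ?case by simp
next
  case (Cons y a)
  have "cobound (\<lambda>m. F (y # m)) (a @ [x, x] @ b) = 0"
  proof (rule Cons.IH)
    fix a' x' b' show "F (y # a' @ [x', x'] @ b') = 0" using Cons.prems[of "y # a'"] by simp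
  qed
  then show ?case using Cons.prems[of a] by simp
qed

lemma sorted_repetition:
  fixes l :: "'x::order list"
  assumes "sorted_wrt (\<le>) l"
  shows "sorted_wrt (<) l \<or> (\<exists>a x b. l = a @ [x, x] @ b)"
  using assms
proof (induction l)
  case (Cons y l)
  then consider "sorted_wrt (<) l" | a x b where "l = a @ [x, x] @ b" by auto
  then show ?case
  proof cases
    case 1
    show ?thesis
    proof (cases l)
      case (Cons z l')
      show ?thesis
      proof (cases "y = z")
        case True
        then have "y # l = [] @ [z, z] @ l'" using Cons by simp
        then show ?thesis by blast
      next
        case False
        then have "y < z" using Cons.prems Cons by (simp add: order_less_le)
        then have "\<forall>v\<in>set l. y < v" using 1 Cons by auto
        then show ?thesis using 1 by simp
      qed
    qed simp
  next
    case 2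
    then have "y # l = (y # a) @ [x, x] @ b" by simp
    then show ?thesis by blast
  qed
qed simp

subsection \<open>Summation\<close>

text \<open>The parameter t may lie on either side of 1, hence the maximum.\<close>

lemma power_le_power_ratio:
  fixes t :: real
  assumes "0 < t" "a \<le> b + k" "b \<le> a + k"
  shows "t ^ a \<le> max t (1 / t) ^ k * t ^ b"
proof -
  let ?r = "max t (1 / t)"
  have r1: "1 \<le> ?r" using assms(1) by (cases "1 \<le> t") (auto simp: le_max_iff_disj)
  show ?thesis
  proof (cases "b \<le> a")
    case True
    have "t ^ (a - b) \<le> ?r ^ (a - b)" using assms by (intro power_mono) auto
    also have "\<dots> \<le> ?r ^ k" using assms r1 by (intro power_increasing) auto
    finally have "t ^ (a - b) * t ^ b \<le> ?r ^ k * t ^ b" using assms by (intro mult_right_mono) auto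
    then show ?thesis using True by (simp flip: power_add)
  next
    case False
    have "(1 / t) ^ (b - a) \<le> ?r ^ (b - a)" using assms by (intro power_mono) auto
    also have "\<dots> \<le> ?r ^ k" using assms r1 by (intro power_increasing) auto
    finally have "(1 / t) ^ (b - a) * t ^ b \<le> ?r ^ k * t ^ b" using assms by (intro mult_right_mono) auto
    moreover have "t ^ b = t ^ (b - a) * t ^ a" using False by (simp flip: power_add)
    then have "(1 / t) ^ (b - a) * t ^ b = t ^ a" using assms by (simp add: power_one_over)
    ultimately show ?thesis by simp
  qed
qed

text \<open>A Schur test with the squares already taken: h and \<open>\<phi>\<close> play the role
  of squared absolute values, so only the weights summed over a column have to be bounded. It serves
  the pullback, the homotopy, the incidences and the constant cochains.\<close>

lemma schur_bound:
  fixes h a :: "'i \<Rightarrow> real" and \<phi> b :: "'j \<Rightarrow> real"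
  assumes h: "\<And>i. i \<in> A \<Longrightarrow> 0 \<le> h i \<and> h i \<le> (\<Sum>j\<in>{j\<in>B. R i j}. \<phi> j)"
    and a: "\<And>i. i \<in> A \<Longrightarrow> 0 \<le> a i" and \<phi>: "\<And>j. j \<in> B \<Longrightarrow> 0 \<le> \<phi> j"
    and b: "\<And>j. j \<in> B \<Longrightarrow> 0 \<le> b j"
    and fin: "\<And>i. i \<in> A \<Longrightarrow> finite {j\<in>B. R i j}"
    and K: "\<And>j F. j \<in> B \<Longrightarrow> finite F \<Longrightarrow> F \<subseteq> {i\<in>A. R i j} \<Longrightarrow> sum a F \<le> K * b j"
    and K0: "0 \<le> K"
    and s: "(\<lambda>j. \<phi> j * b j) summable_on B"
  shows "(\<lambda>i. h i * a i) summable_on A \<and> (\<Sum>\<^sub>\<infinity>i\<in>A. h i * a i) \<le> K * (\<Sum>\<^sub>\<infinity>j\<in>B. \<phi> j * b j)"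
proof -
  let ?I = "\<Sum>\<^sub>\<infinity>j\<in>B. \<phi> j * b j"
  have bd: "(\<Sum>i\<in>F. h i * a i) \<le> K * ?I" if F: "finite F" "F \<subseteq> A" for F
  proof -
    define T where "T = (\<Union>i\<in>F. {j\<in>B. R i j})"
    have T: "finite T" "T \<subseteq> B" using F fin by (auto simp: T_def)
    have "(\<Sum>i\<in>F. h i * a i) \<le> (\<Sum>i\<in>F. (\<Sum>j\<in>{j\<in>B. R i j}. \<phi> j) * a i)"
      using F h a by (intro sum_mono mult_right_mono) auto
    also have "\<dots> = (\<Sum>i\<in>F. \<Sum>j\<in>{j\<in>T. R i j}. \<phi> j * a i)"
      unfolding sum_distrib_right using F by (intro sum.cong) (auto simp: T_def)
    also have "\<dots> = (\<Sum>j\<in>T. \<Sum>i\<in>{i\<in>F. R i j}. \<phi> j * a i)"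
      using F T by (intro sum.swap_restrict)
    also have "\<dots> = (\<Sum>j\<in>T. \<phi> j * sum a {i\<in>F. R i j})"
      by (simp add: sum_distrib_left)
    also have "\<dots> \<le> (\<Sum>j\<in>T. \<phi> j * (K * b j))"
      using F T \<phi> by (intro sum_mono mult_left_mono K) auto
    also have "\<dots> = K * (\<Sum>j\<in>T. \<phi> j * b j)" by (simp add: sum_distrib_left mult_ac)
    also have "\<dots> \<le> K * ?I"
      using T s K0 \<phi> b by (intro mult_left_mono finite_sum_le_infsum) auto
    finally show ?thesis .
  qed
  have sm: "(\<lambda>i. h i * a i) summable_on A"
    using bd h a by (intro nonneg_bdd_above_summable_on bdd_aboveI[of _ "K * ?I"]) auto
  moreover have "(\<Sum>\<^sub>\<infinity>i\<in>A. h i * a i) \<le> K * ?I"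
    by (rule infsum_le_finite_sums[OF sm bd])
  ultimately show ?thesis ..
qed

lemma has_sum_finite_times:
  fixes a :: "'c \<Rightarrow> complex" and b :: "'d \<Rightarrow> complex"
  assumes "finite C" "(b has_sum s) B"
  shows "((\<lambda>(c, w). a c * b w) has_sum (sum a C * s)) (C \<times> B)"
  using assms(1)
proof (induction C rule: finite_induct)
  case (insert c C)
  have "((\<lambda>w. a c * b w) has_sum (a c * s)) B" by (rule has_sum_cmult_right[OF assms(2)])
  then have "((\<lambda>(c, w). a c * b w) has_sum (a c * s)) (Pair c ` B)"
    by (subst has_sum_reindex) (auto simp: o_def inj_on_def)
  moreover have "Pair c ` B \<inter> C \<times> B = {}" using insert by auto
  ultimately have "((\<lambda>(c, w). a c * b w) has_sum (a c * s + sum a C * s)) (Pair c ` B \<union> C \<times> B)"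
    using insert.IH by (intro has_sum_Un_disjoint)
  moreover have "Pair c ` B \<union> C \<times> B = insert c C \<times> B" by auto
  ultimately show ?case using insert by (simp add: distrib_right)
qed simp

subsection \<open>The word problem\<close>

locale racg =
  fixes S :: "'a set" and E :: "'a \<Rightarrow> 'a \<Rightarrow> bool"
  assumes finS: "finite S"
    and ES: "E s u \<Longrightarrow> s \<in> S \<and> u \<in> S"
    and E_sym: "E s u \<Longrightarrow> E u s"
    and E_irr: "\<not> E s s"
begin

text \<open>Words are read here as stacks: the head of the list is the last letter.\<close>

primrec available :: "'a \<Rightarrow> 'a list \<Rightarrow> bool" where
  "available s [] = False"
| "available s (x # xs) = (x = s \<or> (E s x \<and> available s xs))"

primrec reduced :: "'a list \<Rightarrow> bool" where
  "reduced [] = True"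
| "reduced (x # xs) = (\<not> available x xs \<and> reduced xs)"

inductive swap1 :: "'a list \<Rightarrow> 'a list \<Rightarrow> bool" where
  swap1_swap: "E s u \<Longrightarrow> swap1 (s # u # xs) (u # s # xs)"
| swap1_cons: "swap1 xs ys \<Longrightarrow> swap1 (x # xs) (x # ys)"

text \<open>Right multiplication by a letter: s cancels if it can be commuted to the top of the
  stack. Modulo \<open>swap1\<close> this is an action of the group on reduced stacks, which solves
  the word problem in the manner of Tits.\<close>

definition push :: "'a \<Rightarrow> 'a list \<Rightarrow> 'a list" where
  "push s xs = (if available s xs then remove1 s xs else s # xs)"

lemma swap1_sym: "swap1 xs ys \<Longrightarrow> swap1 ys xs"
  by (induction rule: swap1.induct) (auto intro: swap1.intros E_sym)

lemma sws_sym: "swap1\<^sup>*\<^sup>* xs ys \<Longrightarrow> swap1\<^sup>*\<^sup>* ys xs"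
  by (induction rule: rtranclp_induct) (auto intro: swap1_sym converse_rtranclp_into_rtranclp)

lemma sws_cons: "swap1\<^sup>*\<^sup>* xs ys \<Longrightarrow> swap1\<^sup>*\<^sup>* (x # xs) (x # ys)"
  by (induction rule: rtranclp_induct) (auto intro: swap1_cons rtranclp.rtrancl_into_rtrancl)

lemma available_sw: "swap1 xs ys \<Longrightarrow> available s xs = available s ys"
  by (induction rule: swap1.induct) (auto dest: E_sym)

lemma remove1_sw: "swap1 xs ys \<Longrightarrow> available s xs \<Longrightarrow> swap1\<^sup>*\<^sup>* (remove1 s xs) (remove1 s ys)"
proof (induction rule: swap1.induct)
  case (swap1_swap a b xs)
  then show ?case using E_irr by (auto intro!: r_into_rtranclp swap1.swap1_swap)
next
  case (swap1_cons xs ys x)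
  then show ?case by (auto intro: sws_cons r_into_rtranclp)
qed

lemma length_sw: "swap1 xs ys \<Longrightarrow> length xs = length ys"
  by (induction rule: swap1.induct) auto

lemma length_sws: "swap1\<^sup>*\<^sup>* xs ys \<Longrightarrow> length xs = length ys"
  by (induction rule: rtranclp_induct) (auto dest: length_sw)

lemma push_sw: "swap1 xs ys \<Longrightarrow> swap1\<^sup>*\<^sup>* (push s xs) (push s ys)"
  by (auto simp: push_def available_sw intro: sws_cons r_into_rtranclp remove1_sw)

lemma push_sws: "swap1\<^sup>*\<^sup>* xs ys \<Longrightarrow> swap1\<^sup>*\<^sup>* (push s xs) (push s ys)"
  by (induction rule: rtranclp_induct) (auto dest: push_sw intro: rtranclp_trans)

lemma fold_push_sws: "swap1\<^sup>*\<^sup>* xs ys \<Longrightarrow> swap1\<^sup>*\<^sup>* (fold push zs xs) (fold push zs ys)"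
  by (induction zs arbitrary: xs ys) (auto intro: push_sws)

lemma available_remove1: "E s x \<Longrightarrow> available s xs \<Longrightarrow> available x (remove1 s xs) = available x xs"
  by (induction xs) (auto dest: E_sym simp: E_irr)

lemma reduced_remove1: "reduced xs \<Longrightarrow> available s xs \<Longrightarrow> reduced (remove1 s xs) \<and> \<not> available s (remove1 s xs)"
  by (induction xs) (auto simp: available_remove1)

lemma cons_remove1: "available s xs \<Longrightarrow> swap1\<^sup>*\<^sup>* (s # remove1 s xs) xs"
proof (induction xs)
  case (Cons x xs)
  show ?case
  proof (cases "x = s")
    case False
    then have "E s x" "available s xs" using Cons.prems by auto
    then have "swap1\<^sup>*\<^sup>* (s # x # remove1 s xs) (x # s # remove1 s xs)"
      by (auto intro: swap1_swap)
    then show ?thesis using False Cons.IH[OF \<open>available s xs\<close>]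
      by (auto intro: rtranclp_trans sws_cons)
  qed simp
qed simp

lemma reduced_push: "reduced xs \<Longrightarrow> reduced (push s xs)"
  by (auto simp: push_def reduced_remove1)

lemma reduced_fold_push: "reduced xs \<Longrightarrow> reduced (fold push zs xs)"
  by (induction zs arbitrary: xs) (auto intro: reduced_push)

text \<open>Reducedness matters: on the stack \<open>[s, s]\<close> both pushes would cancel. Stacks
  built up from the empty one are always reduced. Together with \<open>push_commute\<close> this
  covers the defining relations.\<close>

lemma push_push: "reduced xs \<Longrightarrow> swap1\<^sup>*\<^sup>* (push s (push s xs)) xs"
  by (auto simp: push_def reduced_remove1 intro: cons_remove1)

lemma push_commute:
  assumes "E s u"
  shows "swap1\<^sup>*\<^sup>* (push s (push u xs)) (push u (push s xs))"
proof -
  have su: "s \<noteq> u" "E u s" using assms E_irr E_sym by auto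
  have "remove1 s (remove1 u xs) = remove1 u (remove1 s xs)"
    by (rule remove1_commute)
  then show ?thesis using su assms
    by (auto simp: push_def available_remove1 intro: swap1_swap)
qed

lemma available_push: "u \<noteq> s \<Longrightarrow> \<not> available s xs \<Longrightarrow> available u (push s xs) \<longleftrightarrow> E u s \<and> available u xs"
  by (auto simp: push_def)

lemma cox_step_nf:
  assumes "(xs, ys) \<in> cox_step S E"
  shows "swap1\<^sup>*\<^sup>* (fold push xs []) (fold push ys [])"
  using assms
proof (cases rule: cox_step.cases)
  case (del xs ys s)
  then show ?thesis by (auto intro!: fold_push_sws push_push reduced_fold_push)
next
  case (swap xs ys s u)
  then show ?thesis by (auto intro!: fold_push_sws push_commute E_sym)
qed

lemma cox_eq_nf:
  assumes "(xs, ys) \<in> cox_eq S E"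
  shows "swap1\<^sup>*\<^sup>* (fold push xs []) (fold push ys [])"
  using assms unfolding cox_eq_def
proof (induction rule: rtrancl_induct)
  case (step y z)
  then have "swap1\<^sup>*\<^sup>* (fold push y []) (fold push z [])"
    using cox_step_nf sws_sym by blast
  with step show ?case by (blast intro: rtranclp_trans)
qed simp

lemma cox_eq_sym: "(xs, ys) \<in> cox_eq S E \<Longrightarrow> (ys, xs) \<in> cox_eq S E"
  unfolding cox_eq_def by (meson converseD sym_Un_converse sym_rtrancl symD)

lemma cox_eq_trans: "(xs, ys) \<in> cox_eq S E \<Longrightarrow> (ys, zs) \<in> cox_eq S E \<Longrightarrow> (xs, zs) \<in> cox_eq S E"
  unfolding cox_eq_def by (rule rtrancl_trans)

lemma cox_eq_refl [simp]: "(xs, xs) \<in> cox_eq S E"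
  unfolding cox_eq_def by simp

lemma cox_step_eq: "(xs, ys) \<in> cox_step S E \<Longrightarrow> (xs, ys) \<in> cox_eq S E"
  unfolding cox_eq_def by (rule r_into_rtrancl) simp

lemma cox_step_lists: "(xs, ys) \<in> cox_step S E \<Longrightarrow> xs \<in> lists S \<and> ys \<in> lists S"
  by (auto elim!: cox_step.cases)

lemma cox_eq_lists: "(xs, ys) \<in> cox_eq S E \<Longrightarrow> xs \<in> lists S \<longleftrightarrow> ys \<in> lists S"
  unfolding cox_eq_def by (induction rule: rtrancl_induct) (auto dest: cox_step_lists)

lemma cox_step_ctxt:
  assumes "(xs, ys) \<in> cox_step S E" "as \<in> lists S" "bs \<in> lists S"
  shows "(as @ xs @ bs, as @ ys @ bs) \<in> cox_step S E"
  using assms(1)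
proof (cases rule: cox_step.cases)
  case (del xs ys s)
  have "((as @ xs) @ [s, s] @ (ys @ bs), (as @ xs) @ ys @ bs) \<in> cox_step S E"
    using del assms by (intro cox_step.del) auto
  then show ?thesis using del by simp
next
  case (swap xs ys s u)
  have "((as @ xs) @ [s, u] @ (ys @ bs), (as @ xs) @ [u, s] @ ys @ bs) \<in> cox_step S E"
    using swap assms by (intro cox_step.swap) auto
  then show ?thesis using swap by simp
qed

lemma cox_eq_ctxt:
  assumes "(xs, ys) \<in> cox_eq S E" "as \<in> lists S" "bs \<in> lists S"
  shows "(as @ xs @ bs, as @ ys @ bs) \<in> cox_eq S E"
  using assms(1) unfolding cox_eq_def
proof (induction rule: rtrancl_induct)
  case (step y z)
  from step(2) have "(as @ y @ bs, as @ z @ bs) \<in> cox_step S E \<union> (cox_step S E)\<inverse>"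
    using assms cox_step_ctxt by auto
  with step(3) show ?case by (rule rtrancl_into_rtrancl)
qed simp

lemma cox_eq_append:
  assumes "(xs, ys) \<in> cox_eq S E" "(us, vs) \<in> cox_eq S E" "us \<in> lists S" "ys \<in> lists S"
  shows "(xs @ us, ys @ vs) \<in> cox_eq S E"
proof -
  have "([] @ xs @ us, [] @ ys @ us) \<in> cox_eq S E" "(ys @ us @ [], ys @ vs @ []) \<in> cox_eq S E"
    using assms by (intro cox_eq_ctxt; simp)+
  then show ?thesis by (auto intro: cox_eq_trans)
qed

lemma cox_eq_swap: "E s u \<Longrightarrow> ([s, u], [u, s]) \<in> cox_eq S E"
  using cox_step_eq[OF cox_step.swap[of "[]" S "[]" s u E]] ES by simp

lemma cox_eq_del: "s \<in> S \<Longrightarrow> ([s, s], []) \<in> cox_eq S E"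
  using cox_step_eq[OF cox_step.del[of "[]" S "[]" s E]] by simp

lemma swap1_cox_eq: "swap1 xs ys \<Longrightarrow> xs \<in> lists S \<Longrightarrow> (rev xs, rev ys) \<in> cox_eq S E"
proof (induction rule: swap1.induct)
  case (swap1_swap s u xs)
  have "(rev xs @ [u, s] @ [], rev xs @ [s, u] @ []) \<in> cox_eq S E"
    using swap1_swap E_sym[OF swap1_swap(1)] by (intro cox_eq_ctxt cox_eq_swap) auto
  then show ?case by simp
next
  case (swap1_cons xs ys x)
  then have "([] @ rev xs @ [x], [] @ rev ys @ [x]) \<in> cox_eq S E"
    by (intro cox_eq_ctxt) auto
  then show ?case by simp
qed

lemma swap1_lists: "swap1 xs ys \<Longrightarrow> xs \<in> lists S \<longleftrightarrow> ys \<in> lists S"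
  by (induction rule: swap1.induct) auto

lemma sws_cox_eq: "swap1\<^sup>*\<^sup>* xs ys \<Longrightarrow> xs \<in> lists S \<Longrightarrow> (rev xs, rev ys) \<in> cox_eq S E \<and> ys \<in> lists S"
proof (induction rule: rtranclp_induct)
  case (step y z)
  then have "(rev xs, rev y) \<in> cox_eq S E" "y \<in> lists S" by blast+
  moreover have "(rev y, rev z) \<in> cox_eq S E" "z \<in> lists S"
    using swap1_cox_eq[OF step(2)] swap1_lists[OF step(2)] \<open>y \<in> lists S\<close> by blast+
  ultimately show ?case using cox_eq_trans by blast
qed simp

lemma push_lists: "xs \<in> lists S \<Longrightarrow> s \<in> S \<Longrightarrow> push s xs \<in> lists S"
  using set_remove1_subset[of s xs] by (auto simp: push_def split: if_splits)

lemma fold_push_lists: "xs \<in> lists S \<Longrightarrow> zs \<in> lists S \<Longrightarrow> fold push zs xs \<in> lists S"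
proof (induction zs arbitrary: xs)
  case (Cons z zs)
  then have "push z xs \<in> lists S" by (intro push_lists) auto
  then show ?case using Cons by simp
qed simp

lemma push_cox_eq:
  assumes "xs \<in> lists S" "s \<in> S"
  shows "(rev xs @ [s], rev (push s xs)) \<in> cox_eq S E"
proof (cases "available s xs")
  case True
  have r: "remove1 s xs \<in> lists S" using push_lists[OF assms] True by (simp add: push_def)
  have 1: "(rev xs, rev (s # remove1 s xs)) \<in> cox_eq S E"
    using sws_cox_eq[OF sws_sym[OF cons_remove1[OF True]] assms(1)] by simp
  have "([] @ rev xs @ [s], [] @ rev (s # remove1 s xs) @ [s]) \<in> cox_eq S E"
    using assms by (intro cox_eq_ctxt 1) auto
  moreover have "(rev (remove1 s xs) @ [s, s] @ [], rev (remove1 s xs) @ [] @ []) \<in> cox_eq S E"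
    using assms r by (intro cox_eq_ctxt cox_eq_del) auto
  ultimately show ?thesis using True by (auto simp: push_def intro: cox_eq_trans)
qed (simp add: push_def)

lemma nf_cox_eq:
  assumes "xs \<in> lists S"
  shows "(xs, rev (fold push xs [])) \<in> cox_eq S E"
  using assms
proof (induction xs rule: rev_induct)
  case (snoc s xs)
  have l: "fold push xs [] \<in> lists S" using snoc.prems by (intro fold_push_lists) auto
  have "([] @ xs @ [s], [] @ rev (fold push xs []) @ [s]) \<in> cox_eq S E"
    using snoc by (intro cox_eq_ctxt snoc.IH) auto
  moreover have "(rev (fold push xs []) @ [s], rev (push s (fold push xs []))) \<in> cox_eq S E"
    using snoc.prems by (intro push_cox_eq l) auto
  ultimately show ?case by (auto intro: cox_eq_trans)
qed simp

lemma available_set: "available s xs \<Longrightarrow> s \<in> set xs"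
  by (induction xs) auto

lemma length_push: "length (push s xs) = (if available s xs then length xs - 1 else Suc (length xs))"
  by (simp add: push_def available_set length_remove1)

lemma available_length_pos: "available s xs \<Longrightarrow> 0 < length xs"
  by (cases xs) auto

lemma length_fold_push: "length (fold push xs ys) \<le> length xs + length ys"
proof (induction xs arbitrary: ys)
  case (Cons x xs)
  have "length (fold push xs (push x ys)) \<le> length xs + length (push x ys)" by (rule Cons.IH)
  then show ?case using length_push[of x ys] by (auto split: if_splits)
qed simp

section \<open>Right multiplication and length in the group\<close>

abbreviation "G \<equiv> cox_grp S E"
abbreviation "cls \<equiv> cox_cls S E"

lemma cls_eq_iff: "cls xs = cls ys \<longleftrightarrow> (xs, ys) \<in> cox_eq S E"
  unfolding cox_cls_def using cox_eq_sym cox_eq_trans cox_eq_refl by blast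

text \<open>Normal forms of equivalent words differ by swaps and so have equal length, and pushing a
  word never yields a stack longer than that word.\<close>

lemma cox_len_cls:
  assumes "xs \<in> lists S"
  shows "cox_len (cls xs) = length (fold push xs [])"
  unfolding cox_len_def
proof (rule Least_equality)
  show "\<exists>ys\<in>cls xs. length ys = length (fold push xs [])"
    using nf_cox_eq[OF assms] by (intro bexI[of _ "rev (fold push xs [])"]) (auto simp: cox_cls_def)
next
  fix n assume "\<exists>ys\<in>cls xs. length ys = n"
  then obtain ys where ys: "(xs, ys) \<in> cox_eq S E" "length ys = n" by (auto simp: cox_cls_def)
  then have "length (fold push xs []) = length (fold push ys [])"
    using length_sws[OF cox_eq_nf] by blast
  also have "\<dots> \<le> n" using length_fold_push[of ys "[]"] ys by simp
  finally show "length (fold push xs []) \<le> n" .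
qed

lemma cox_mult_cls:
  assumes "xs \<in> lists S" "ys \<in> lists S"
  shows "cox_mult S E (cls xs) (cls ys) = cls (xs @ ys)"
proof (intro set_eqI iffI)
  fix zs assume "zs \<in> cox_mult S E (cls xs) (cls ys)"
  then obtain us vs where *: "(xs, us) \<in> cox_eq S E" "(ys, vs) \<in> cox_eq S E" "(us @ vs, zs) \<in> cox_eq S E"
    by (auto simp: cox_mult_def cox_cls_def)
  have "(xs @ ys, us @ vs) \<in> cox_eq S E"
    using * assms cox_eq_lists by (intro cox_eq_append) blast+
  then show "zs \<in> cls (xs @ ys)" using *(3) cox_eq_trans by (simp add: cox_cls_def)
next
  fix zs assume "zs \<in> cls (xs @ ys)"
  then show "zs \<in> cox_mult S E (cls xs) (cls ys)"
    unfolding cox_mult_def cox_cls_def using cox_eq_refl by blast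
qed

text \<open>Outside the group, or for a letter outside S, it does nothing; cancellation and
  commutation then hold without side conditions, which the fold in \<open>mulset\<close>
  wants.\<close>

definition rmul :: "'a list set \<Rightarrow> 'a \<Rightarrow> 'a list set" where
  "rmul w s = (if w \<in> G \<and> s \<in> S then cox_mult S E w (cls [s]) else w)"

abbreviation "one \<equiv> cox_one S E"

lemma cls_in_G: "xs \<in> lists S \<Longrightarrow> cls xs \<in> G"
  by (simp add: cox_grp_def)

lemma G_cases:
  assumes "w \<in> G" obtains xs where "xs \<in> lists S" "w = cls xs"
  using assms by (auto simp: cox_grp_def)

lemma rmul_cls: "xs \<in> lists S \<Longrightarrow> s \<in> S \<Longrightarrow> rmul (cls xs) s = cls (xs @ [s])"
  by (simp add: rmul_def cls_in_G cox_mult_cls)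

lemma rmul_G [simp]: "w \<in> G \<Longrightarrow> rmul w s \<in> G"
proof (cases "s \<in> S")
  case True
  assume "w \<in> G"
  then obtain xs where "xs \<in> lists S" "w = cls xs" by (rule G_cases)
  then show ?thesis using True rmul_cls[of xs s] cls_in_G[of "xs @ [s]"] by simp
qed (simp add: rmul_def)

lemma one_G [simp]: "one \<in> G"
  by (simp add: cox_one_def cls_in_G)

lemma rmul_rm [simp]: "rmul (rmul w s) s = w"
proof (cases "w \<in> G \<and> s \<in> S")
  case True
  then obtain xs where xs: "xs \<in> lists S" "w = cls xs" by (blast elim: G_cases)
  have "(xs @ [s, s] @ [], xs @ [] @ []) \<in> cox_eq S E"
    using xs True by (intro cox_eq_ctxt cox_eq_del) auto
  then show ?thesis using xs True by (simp add: rmul_cls cls_eq_iff)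
qed (auto simp: rmul_def)

lemma rmul_commute: "E s u \<Longrightarrow> rmul (rmul w s) u = rmul (rmul w u) s"
proof (cases "w \<in> G")
  case True
  assume su: "E s u"
  then have S: "s \<in> S" "u \<in> S" using ES by auto
  obtain xs where xs: "xs \<in> lists S" "w = cls xs" using True by (rule G_cases)
  have "(xs @ [s, u] @ [], xs @ [u, s] @ []) \<in> cox_eq S E"
    using xs su by (intro cox_eq_ctxt cox_eq_swap) auto
  then show ?thesis using xs S by (simp add: rmul_cls cls_eq_iff)
qed (auto simp: rmul_def)

lemma cox_len_rm:
  assumes "xs \<in> lists S" "s \<in> S"
  shows "cox_len (rmul (cls xs) s) = (if available s (fold push xs []) then cox_len (cls xs) - 1 else Suc (cox_len (cls xs)))"
  using assms by (simp add: rmul_cls cox_len_cls length_push)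

lemma len_rm_less_iff:
  assumes "xs \<in> lists S" "s \<in> S"
  shows "cox_len (rmul (cls xs) s) < cox_len (cls xs) \<longleftrightarrow> available s (fold push xs [])"
  using cox_len_rm[OF assms] assms available_length_pos by (auto simp: cox_len_cls)

lemma len_rm:
  assumes "w \<in> G" "s \<in> S"
  shows "cox_len (rmul w s) = Suc (cox_len w) \<or> cox_len w = Suc (cox_len (rmul w s))"
proof -
  obtain xs where xs: "xs \<in> lists S" "w = cls xs" using assms by (blast elim: G_cases)
  show ?thesis using cox_len_rm[of xs s] len_rm_less_iff[of xs s] xs assms
    by (auto split: if_splits)
qed

lemma len_one [simp]: "cox_len one = 0"
  by (simp add: cox_one_def cox_len_cls)

text \<open>The exchange condition in its right-angled form, from \<open>available_push\<close>: a
  letter other than s can move behind a new last letter s only by commuting with it. What is proved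
  later about \<open>In\<close> rests on this.\<close>

lemma len_exchange:
  assumes "w \<in> G" "s \<in> S" "u \<in> S" "u \<noteq> s" "cox_len w < cox_len (rmul w s)"
  shows "cox_len (rmul (rmul w s) u) < cox_len (rmul w s) \<longleftrightarrow> E u s \<and> cox_len (rmul w u) < cox_len w"
proof -
  obtain xs where xs: "xs \<in> lists S" "w = cls xs" using assms by (blast elim: G_cases)
  have 1: "\<not> available s (fold push xs [])" using len_rm_less_iff[of xs s] xs assms by simp
  have "cox_len (rmul (rmul w s) u) < cox_len (rmul w s) \<longleftrightarrow> available u (fold push (xs @ [s]) [])"
    using xs assms len_rm_less_iff[of "xs @ [s]" u] by (simp add: rmul_cls)
  also have "\<dots> \<longleftrightarrow> E u s \<and> available u (fold push xs [])" using 1 assms by (simp add: available_push)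
  finally show ?thesis using xs assms len_rm_less_iff[of xs u] by simp
qed

lemma foldl_rm_cls: "xs \<in> lists S \<Longrightarrow> ys \<in> lists S \<Longrightarrow> foldl rmul (cls xs) ys = cls (xs @ ys)"
proof (induction ys arbitrary: xs)
  case (Cons y ys)
  then show ?case using Cons.IH[of "xs @ [y]"] by (simp add: rmul_cls)
qed simp

lemma G_reduced_word:
  assumes "w \<in> G"
  obtains ys where "ys \<in> lists S" "length ys = cox_len w" "w = foldl rmul one ys" "w = cls ys"
proof -
  obtain xs where xs: "xs \<in> lists S" "w = cls xs" using assms by (rule G_cases)
  let ?ys = "rev (fold push xs [])"
  have l: "?ys \<in> lists S" using fold_push_lists[of "[]" xs] xs by auto
  have "cls ?ys = w" using xs nf_cox_eq[OF xs(1)] cox_eq_sym by (simp add: cls_eq_iff)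
  then show ?thesis using xs that[of ?ys] l foldl_rm_cls[of "[]" ?ys]
    by (simp add: cox_len_cls cox_one_def)
qed

lemma len_eq_0: "w \<in> G \<Longrightarrow> cox_len w = 0 \<longleftrightarrow> w = one"
  by (metis G_reduced_word foldl_Nil length_0_conv len_one)

lemma ex_descent:
  assumes "w \<in> G" "w \<noteq> one"
  shows "\<exists>s\<in>S. cox_len (rmul w s) < cox_len w"
proof -
  obtain xs where xs: "xs \<in> lists S" "w = cls xs" using assms by (blast elim: G_cases)
  have l: "fold push xs [] \<in> lists S" using fold_push_lists[of "[]" xs] xs by simp
  have "fold push xs [] \<noteq> []" using len_eq_0[OF assms(1)] assms(2) xs by (simp add: cox_len_cls)
  then have "available (hd (fold push xs [])) (fold push xs [])" "hd (fold push xs []) \<in> S"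
    using l by (cases "fold push xs []"; simp)+
  then show ?thesis using len_rm_less_iff[of xs] xs by blast
qed

lemma len_foldl_rm: "w \<in> G \<Longrightarrow> ys \<in> lists S \<Longrightarrow> foldl rmul w ys \<in> G \<and> cox_len (foldl rmul w ys) \<le> cox_len w + length ys"
proof (induction ys arbitrary: w)
  case (Cons y ys)
  then show ?case using Cons.IH[of "rmul w y"] len_rm[of w y] by fastforce
qed simp

lemma cox_eq_rev: "xs \<in> lists S \<Longrightarrow> (rev xs @ xs, []) \<in> cox_eq S E"
proof (induction xs)
  case (Cons x xs)
  have "(rev xs @ [x, x] @ xs, rev xs @ [] @ xs) \<in> cox_eq S E"
    using Cons.prems by (intro cox_eq_ctxt cox_eq_del) auto
  then show ?case using Cons cox_eq_trans by simp
qed simp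

lemma foldl_rm_G: "w \<in> G \<Longrightarrow> foldl rmul w ys \<in> G"
  by (induction ys arbitrary: w) auto

text \<open>Left multiplication by the inverse of u, reduced to the properties needed later. The
  last one is the triangle inequality for w as the product of u and \<open>\<phi> w\<close>.\<close>

lemma translate:
  assumes "u \<in> G"
  obtains \<phi> where "\<phi> ` G \<subseteq> G" "inj_on \<phi> G" "\<phi> u = one"
    "\<And>w s. w \<in> G \<Longrightarrow> \<phi> (rmul w s) = rmul (\<phi> w) s"
    "\<And>w. w \<in> G \<Longrightarrow> cox_len w \<le> cox_len u + cox_len (\<phi> w)"
proof -
  obtain xs where xs: "xs \<in> lists S" "u = cls xs" using assms by (rule G_cases)
  define \<phi> where "\<phi> = (\<lambda>w. cox_mult S E (cls (rev xs)) w)"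
  define \<psi> where "\<psi> = (\<lambda>w. cox_mult S E (cls xs) w)"
  have rx: "rev xs \<in> lists S" using xs by auto
  have phi: "\<phi> (cls ys) = cls (rev xs @ ys)" if "ys \<in> lists S" for ys
    unfolding \<phi>_def using rx that by (rule cox_mult_cls)
  have psi: "\<psi> (cls ys) = cls (xs @ ys)" if "ys \<in> lists S" for ys
    unfolding \<psi>_def using xs(1) that by (rule cox_mult_cls)
  have G: "\<phi> w \<in> G" if w: "w \<in> G" for w
  proof -
    obtain ys where ys: "ys \<in> lists S" "w = cls ys" using w by (rule G_cases)
    show ?thesis using ys rx by (simp add: phi cls_in_G)
  qed
  have inv: "\<psi> (\<phi> w) = w" if w: "w \<in> G" for w
  proof -
    obtain ys where ys: "ys \<in> lists S" "w = cls ys" using w by (rule G_cases)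
    have "([] @ (rev (rev xs) @ rev xs) @ ys, [] @ [] @ ys) \<in> cox_eq S E"
      using ys rx by (intro cox_eq_ctxt cox_eq_rev) auto
    then show ?thesis using ys rx by (simp add: phi psi cls_eq_iff)
  qed
  have u: "\<phi> u = one"
    using xs cox_eq_rev[OF xs(1)] by (simp add: phi cox_one_def cls_eq_iff)
  have r: "\<phi> (rmul w s) = rmul (\<phi> w) s" if w: "w \<in> G" for w s
  proof (cases "s \<in> S")
    case True
    obtain ys where ys: "ys \<in> lists S" "w = cls ys" using w by (rule G_cases)
    show ?thesis using ys rx True rmul_cls[of "rev xs @ ys" s] phi[of "ys @ [s]"] by (simp add: phi rmul_cls)
  qed (simp add: rmul_def)
  have i: "inj_on \<phi> G" using inv by (metis inj_onI)
  have l: "cox_len w \<le> cox_len u + cox_len (\<phi> w)" if w: "w \<in> G" for w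
  proof -
    obtain ys where ys: "ys \<in> lists S" "length ys = cox_len (\<phi> w)" "\<phi> w = foldl rmul one ys"
      using G[OF w] by (rule G_reduced_word)
    have "\<phi> (foldl rmul v zs) = foldl rmul (\<phi> v) zs" if "v \<in> G" for v zs
      using that by (induction zs arbitrary: v) (auto simp: r)
    then have "\<phi> (foldl rmul u ys) = \<phi> w" using ys assms u by simp
    then have "w = foldl rmul u ys" using i w assms by (simp add: inj_on_eq_iff foldl_rm_G)
    then show ?thesis using len_foldl_rm[OF assms ys(1)] ys(2) by simp
  qed
  show ?thesis using that[of \<phi>] G i u r l by blast
qed

subsection \<open>Cliques and spherical cosets\<close>

definition clique :: "'a set \<Rightarrow> bool" where
  "clique U \<longleftrightarrow> U \<subseteq> S \<and> (\<forall>s\<in>U. \<forall>u\<in>U. s \<noteq> u \<longrightarrow> E s u)"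

text \<open>A clique generates an elementary abelian 2-group, whose elements correspond to subsets
  and multiply by symmetric difference (\<open>mulset_mul\<close>). Subsets therefore replace group
  elements in all computations inside a spherical coset.\<close>

definition mulset :: "'a list set \<Rightarrow> 'a set \<Rightarrow> 'a list set" where
  "mulset w U = Finite_Set.fold (\<lambda>s v. rmul v s) w U"

definition In :: "'a list set \<Rightarrow> 'a set" where
  "In w = {s \<in> S. cox_len (rmul w s) < cox_len w}"

lemma clique_finite: "clique U \<Longrightarrow> finite U"
  by (auto simp: clique_def intro: finite_subset[OF _ finS])

lemma clique_subset: "clique U \<Longrightarrow> V \<subseteq> U \<Longrightarrow> clique V"
  by (auto simp: clique_def subset_iff)

lemma clique_empty [simp]: "clique {}"
  by (simp add: clique_def)

lemma clique_comm: "clique U \<Longrightarrow> comp_fun_commute_on U (\<lambda>s v. rmul v s)"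
proof
  fix x y assume "clique U" "x \<in> U" "y \<in> U"
  then show "(\<lambda>v. rmul v y) \<circ> (\<lambda>v. rmul v x) = (\<lambda>v. rmul v x) \<circ> (\<lambda>v. rmul v y)"
    using rmul_commute[of x y] by (cases "x = y") (auto simp: clique_def fun_eq_iff)
qed

lemma mulset_empty [simp]: "mulset w {} = w"
  by (simp add: mulset_def)

lemma mulset_insert:
  assumes "clique (insert s U)" "s \<notin> U"
  shows "mulset w (insert s U) = rmul (mulset w U) s"
  unfolding mulset_def
  by (rule comp_fun_commute_on.fold_insert[OF clique_comm[OF assms(1)] order_refl])
    (use assms clique_finite[OF assms(1)] in auto)

lemma mulset_singleton [simp]: "s \<in> S \<Longrightarrow> mulset w {s} = rmul w s"
  using mulset_insert[of s "{}" w] by (simp add: clique_def)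

lemma mulset_remove:
  assumes "clique U" "s \<in> U"
  shows "rmul (mulset w U) s = mulset w (U - {s})"
proof -
  have "mulset w (insert s (U - {s})) = rmul (mulset w (U - {s})) s"
    using assms by (intro mulset_insert) (auto simp: insert_absorb)
  then show ?thesis using assms by (simp add: insert_absorb)
qed

lemma mulset_G [simp]: "w \<in> G \<Longrightarrow> clique U \<Longrightarrow> mulset w U \<in> G"
proof -
  assume w: "w \<in> G" and U: "clique U"
  from clique_finite[OF U] U show ?thesis
  proof (induction U rule: finite_induct)
    case (insert s U)
    then show ?case by (metis clique_subset mulset_insert rmul_G subset_insertI)
  qed (simp add: w)
qed

lemma mulset_mul:
  assumes "clique (U \<union> V)"
  shows "mulset (mulset w U) V = mulset w (U - V \<union> (V - U))"
proof -
  have "finite V" using clique_finite assms by blast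
  then show ?thesis using assms
  proof (induction V rule: finite_induct)
    case (insert v V)
    let ?D = "U - V \<union> (V - U)"
    have cl: "clique (insert v V)" "clique (U \<union> V)" using insert.prems by (auto elim: clique_subset)
    have D: "clique ?D" "clique (insert v ?D)" using insert.prems by (auto elim: clique_subset)
    have "mulset (mulset w U) (insert v V) = rmul (mulset w ?D) v"
      using mulset_insert[OF cl(1) insert.hyps(2), of "mulset w U"] insert.IH[OF cl(2)] by simp
    also have "\<dots> = mulset w (U - insert v V \<union> (insert v V - U))"
    proof (cases "v \<in> U")
      case True
      then have "U - insert v V \<union> (insert v V - U) = ?D - {v}" using insert.hyps by auto
      then show ?thesis using mulset_remove[OF D(1), of v w] True insert.hyps by simp
    next
      case False
      then have "U - insert v V \<union> (insert v V - U) = insert v ?D" using insert.hyps by auto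
      then show ?thesis using mulset_insert[OF D(2), of w] False insert.hyps by simp
    qed
    finally show ?case .
  qed simp
qed

lemma mulset_mul_sub:
  assumes "clique U" "V \<subseteq> U"
  shows "mulset (mulset w U) V = mulset w (U - V)"
proof -
  have "U \<union> V = U" "U - V \<union> (V - U) = U - V" using assms(2) by auto
  then show ?thesis using mulset_mul[of U V w] assms(1) by simp
qed

lemma mulset_mul_self [simp]: "clique U \<Longrightarrow> mulset (mulset w U) U = w"
  using mulset_mul_sub[of U U w] by simp

lemma In_subset: "In w \<subseteq> S"
  by (auto simp: In_def)

text \<open>For two last letters s and u, go down from w to \<open>rmul w u\<close> and up again: by
  \<open>len_exchange\<close>, s can be a last letter at the top only if it commutes with u.\<close>

lemma In_clq: "w \<in> G \<Longrightarrow> clique (In w)"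
  unfolding clique_def
proof (intro conjI ballI impI In_subset)
  fix s u assume w: "w \<in> G" and s: "s \<in> In w" and u: "u \<in> In w" and ne: "s \<noteq> u"
  have "cox_len (rmul (rmul (rmul w u) u) s) < cox_len (rmul (rmul w u) u) \<longleftrightarrow> E s u \<and> cox_len (rmul (rmul w u) s) < cox_len (rmul w u)"
    using s u w ne by (intro len_exchange) (auto simp: In_def)
  then show "E s u" using s by (simp add: In_def)
qed

lemma In_rm:
  assumes "w \<in> G" "s \<in> S" "s \<notin> In w"
  shows "In (rmul w s) = insert s {a \<in> In w. E a s}" "cox_len (rmul w s) = Suc (cox_len w)"
proof -
  show l: "cox_len (rmul w s) = Suc (cox_len w)"
    using len_rm[OF assms(1,2)] assms by (auto simp: In_def)
  show "In (rmul w s) = insert s {a \<in> In w. E a s}"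
  proof (intro set_eqI)
    fix u show "u \<in> In (rmul w s) \<longleftrightarrow> u \<in> insert s {a \<in> In w. E a s}"
    proof (cases "u = s")
      case True then show ?thesis using assms l by (auto simp: In_def)
    next
      case False
      then show ?thesis using len_exchange[OF assms(1,2) _ False] l by (auto simp: In_def)
    qed
  qed
qed

text \<open>The letters are appended one at a time. Each is new, because \<open>In_rm\<close> lets
  only letters already appended join \<open>In\<close>.\<close>

lemma mulset_up:
  assumes "w \<in> G" "clique U" "U \<inter> In w = {}"
  shows "cox_len (mulset w U) = cox_len w + card U \<and> In (mulset w U) = U \<union> {a \<in> In w. \<forall>u\<in>U. E a u}"
proof -
  from clique_finite[OF assms(2)] assms(2,3) show ?thesis
  proof (induction U rule: finite_induct)
    case (insert s U)
    have U: "clique U" using insert.prems by (auto elim: clique_subset)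
    have s: "s \<in> S" using insert.prems by (simp add: clique_def)
    have ih: "cox_len (mulset w U) = cox_len w + card U" "In (mulset w U) = U \<union> {a \<in> In w. \<forall>u\<in>U. E a u}"
      using insert U by auto
    have nin: "s \<notin> In (mulset w U)" using insert ih by auto
    have "mulset w (insert s U) = rmul (mulset w U) s" using insert by (intro mulset_insert)
    moreover have "\<forall>u\<in>U. E u s" using insert by (auto simp: clique_def)
    ultimately show ?case using In_rm[OF mulset_G[OF assms(1) U] s nin] ih insert.hyps
      by auto
  qed simp
qed

lemma In_one [simp]: "In one = {}"
  by (simp add: In_def)

text \<open>U minimizes the length among subsets of T; a last letter lying in T could be toggled to
  do better.\<close>

lemma min_rep:
  assumes "w \<in> G" "clique T"
  obtains U where "U \<subseteq> T" "In (mulset w U) \<inter> T = {}"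
proof -
  obtain U where U: "U \<subseteq> T" "\<And>V. V \<subseteq> T \<Longrightarrow> cox_len (mulset w U) \<le> cox_len (mulset w V)"
    using ex_has_least_nat[of "\<lambda>U. U \<subseteq> T" T "\<lambda>U. cox_len (mulset w U)"] by auto
  have "s \<notin> In (mulset w U)" if "s \<in> T" for s
  proof
    assume s: "s \<in> In (mulset w U)"
    have "mulset (mulset w U) {s} = mulset w (U - {s} \<union> ({s} - U))"
      using that U assms by (intro mulset_mul clique_subset[OF assms(2)]) auto
    moreover have "cox_len (mulset w U) \<le> cox_len (mulset w (U - {s} \<union> ({s} - U)))"
      using that U by (intro U(2)) auto
    ultimately show False using s by (simp add: In_def)
  qed
  then show ?thesis using that[of U] U by blast
qed

definition peel :: "'a list set \<Rightarrow> 'a list set" where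
  "peel w = mulset w (In w)"

text \<open>All last letters can be removed at once. If U leads from w down to the shortest element
  of its coset of type \<open>In w\<close>, then \<open>mulset_up\<close> on the way back shows that
  the last letters of w in this type are exactly U, so U is all of \<open>In w\<close>.\<close>

lemma peel:
  assumes "w \<in> G"
  shows "peel w \<in> G" "mulset (peel w) (In w) = w" "In (peel w) \<inter> In w = {}" "cox_len w = cox_len (peel w) + card (In w)"
proof -
  note cl = In_clq[OF assms]
  obtain U where U: "U \<subseteq> In w" "In (mulset w U) \<inter> In w = {}"
    using min_rep[OF assms cl] .
  have clU: "clique U" using cl U clique_subset by blast
  have w: "mulset (mulset w U) U = w" using clU by simp
  have u: "cox_len w = cox_len (mulset w U) + card U" "In w = U \<union> {a \<in> In (mulset w U). \<forall>u\<in>U. E a u}"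
    using mulset_up[of "mulset w U" U] w U clU assms by auto
  then have eq: "U = In w" using U by blast
  then show "In (peel w) \<inter> In w = {}" "cox_len w = cox_len (peel w) + card (In w)"
    using U u by (simp_all add: peel_def)
  show "peel w \<in> G" using assms cl by (simp add: peel_def)
  show "mulset (peel w) (In w) = w" using cl by (simp add: peel_def)
qed

lemma peel_one [simp]: "peel one = one"
  by (simp add: peel_def)

lemma In_nonempty: "w \<in> G \<Longrightarrow> w \<noteq> one \<Longrightarrow> In w \<noteq> {}"
  using ex_descent by (auto simp: In_def)

text \<open>Once w is translated to the identity, \<open>In\<close> reads off the subset.\<close>

lemma mulset_inj:
  assumes "w \<in> G" "clique U" "clique V" "mulset w U = mulset w V"
  shows "U = V"
proof -
  obtain \<phi> where \<phi>: "\<phi> w = one" "\<And>v s. v \<in> G \<Longrightarrow> \<phi> (rmul v s) = rmul (\<phi> v) s"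
    using translate[OF assms(1)] by metis
  have "\<phi> (mulset w U) = mulset one U" if "clique U" for U
    using clique_finite[OF that] that
  proof (induction U rule: finite_induct)
    case (insert s U)
    moreover have "clique U" using insert.prems by (auto elim: clique_subset)
    ultimately show ?case using assms by (simp add: mulset_insert \<phi>)
  qed (simp add: \<phi>)
  then have "mulset one U = mulset one V" using assms by metis
  moreover have "In (mulset one U) = U" "In (mulset one V) = V" using mulset_up[of one] assms by auto
  ultimately show ?thesis by metis
qed

section \<open>Spherical cosets and their shortest elements\<close>

abbreviation "cst \<equiv> coset S E"

lemma cox_mult_foldl:
  assumes "w \<in> G" "ys \<in> lists S"
  shows "cox_mult S E w (cls ys) = foldl rmul w ys"
proof -
  obtain xs where "xs \<in> lists S" "w = cls xs" using assms by (blast elim: G_cases)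
  then show ?thesis using assms by (simp add: cox_mult_cls foldl_rm_cls)
qed

lemma cst_words:
  assumes "w \<in> G" "T \<subseteq> S"
  shows "cst w T = foldl rmul w ` lists T"
proof -
  have "lists T \<subseteq> lists S" using assms by auto
  then show ?thesis unfolding coset_def special_def image_image
    using assms cox_mult_foldl by (intro image_cong) blast+
qed

lemma cst_eq:
  assumes w: "w \<in> G" and T: "clique T"
  shows "cst w T = mulset w ` Pow T"
proof (intro equalityI subsetI)
  have TS: "T \<subseteq> S" using T by (simp add: clique_def)
  {
    fix v assume "v \<in> cst w T"
    then obtain ys where ys: "ys \<in> lists T" "v = foldl rmul w ys" using cst_words[OF w TS] by auto
    have "\<exists>V\<subseteq>T. foldl rmul (mulset w U) ys = mulset w V" if "U \<subseteq> T" for U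
      using ys(1) that
    proof (induction ys arbitrary: U)
      case (Cons y ys)
      then have y: "y \<in> T" by simp
      have "mulset (mulset w U) {y} = mulset w (U - {y} \<union> ({y} - U))"
        using y Cons.prems by (intro mulset_mul clique_subset[OF T]) auto
      then have "rmul (mulset w U) y = mulset w (U - {y} \<union> ({y} - U))" using y TS by auto
      moreover have "U - {y} \<union> ({y} - U) \<subseteq> T" using y Cons.prems by auto
      ultimately show ?case using Cons.IH[of "U - {y} \<union> ({y} - U)"] Cons.prems by simp
    qed auto
    from this[of "{}"] show "v \<in> mulset w ` Pow T" using ys by auto
  next
    fix v assume "v \<in> mulset w ` Pow T"
    then obtain U where U: "U \<subseteq> T" "v = mulset w U" by auto
    have "finite U" using U T clique_finite finite_subset by blast
    then have "\<exists>ys\<in>lists T. mulset w U = foldl rmul w ys" using U(1)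
    proof (induction U rule: finite_induct)
      case empty
      show ?case by (intro bexI[of _ "[]"]) auto
    next
      case (insert s U)
      then obtain ys where ys: "ys \<in> lists T" "mulset w U = foldl rmul w ys" by auto
      have "mulset w (insert s U) = rmul (mulset w U) s" using insert T by (intro mulset_insert clique_subset[OF T]) auto
      then show ?case using ys insert by (intro bexI[of _ "ys @ [s]"]) auto
    qed
    then show "v \<in> cst w T" using U cst_words[OF w TS] by auto
  }
qed

lemma special_eq: "T \<subseteq> S \<Longrightarrow> special S E T = cst one T"
proof -
  assume T: "T \<subseteq> S"
  have "lists T \<subseteq> lists S" using T by auto
  then have "cls ys = foldl rmul one ys" if "ys \<in> lists T" for ys
    using foldl_rm_cls[of "[]" ys] that by (auto simp: cox_one_def)
  then show ?thesis using T unfolding special_def by (subst cst_words) auto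
qed

lemma spherical_iff: "spherical S E T \<longleftrightarrow> clique T"
proof
  assume "clique T"
  then show "spherical S E T"
    using clique_finite[of T] by (auto simp: spherical_def special_eq cst_eq clique_def)
next
  assume sp: "spherical S E T"
  then have T: "T \<subseteq> S" "finite (cst one T)" by (auto simp: spherical_def special_eq)
  show "clique T"
  proof (rule ccontr)
    assume "\<not> clique T"
    then obtain s u where su: "s \<in> T" "u \<in> T" "s \<noteq> u" "\<not> E s u"
      using T by (auto simp: clique_def)
    moreover have "\<not> E u s" using su E_sym by blast
    ultimately have su: "s \<in> T" "u \<in> T" "s \<noteq> u" "\<not> E s u" "\<not> E u s" by auto
    \<comment> \<open>The alternating word in two letters that do not commute. Each prefix can end
      only in its own final letter, which blocks the next one from cancelling, so the lengths grow
      forever.\<close>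
    define x where "x = (\<lambda>n::nat. if even n then s else u)"
    have x: "x n \<in> T" "x n \<in> S" "x n \<noteq> x (Suc n)" "\<not> E (x n) (x (Suc n))" for n
      using su T by (auto simp: x_def)
    define v where "v = (\<lambda>n. foldl rmul one (map x [0..<n]))"
    have v: "v 0 = one" "v (Suc n) = rmul (v n) (x n)" "v n \<in> G" for n
      by (auto simp: v_def intro: foldl_rm_G)
    have "cox_len (v n) = n \<and> In (v n) \<subseteq> (if n = 0 then {} else {x (n - 1)})" for n
    proof (induction n)
      case (Suc n)
      have "x n \<notin> In (v n)" using Suc x(3)[of "n - 1"] by (cases n) auto
      then have "In (rmul (v n) (x n)) = insert (x n) {a \<in> In (v n). E a (x n)}"
         "cox_len (rmul (v n) (x n)) = Suc (cox_len (v n))"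
        using In_rm[OF v(3)[of n] x(2)[of n]] by auto
      moreover have "\<not> E a (x n)" if "a \<in> In (v n)" for a
        using that Suc x(4)[of "n - 1"] by (cases n) auto
      ultimately show ?case using Suc by (auto simp: v)
    qed (simp add: v)
    then have "inj v" by (metis injI)
    moreover have "range v \<subseteq> cst one T"
      unfolding cst_words[OF one_G T(1)] using x(1) by (auto simp: v_def intro!: imageI)
    ultimately show False using T(2) by (meson finite_subset finite_imageD infinite_UNIV_nat)
  qed
qed

lemma cst_G: "w \<in> G \<Longrightarrow> clique T \<Longrightarrow> cst w T \<subseteq> G"
  by (auto simp: cst_eq intro: mulset_G clique_subset)

lemma mulset_in_cst: "w \<in> G \<Longrightarrow> clique T \<Longrightarrow> U \<subseteq> T \<Longrightarrow> mulset w U \<in> cst w T"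
  by (auto simp: cst_eq)

lemma self_in_cst: "w \<in> G \<Longrightarrow> clique T \<Longrightarrow> w \<in> cst w T"
  using mulset_in_cst[of w T "{}"] by simp

lemma cst_mono: "w \<in> G \<Longrightarrow> clique T \<Longrightarrow> U \<subseteq> T \<Longrightarrow> cst w U \<subseteq> cst w T"
  by (auto simp: cst_eq clique_subset)

lemma cst_mul:
  assumes "w \<in> G" "clique T" "U \<subseteq> T"
  shows "cst (mulset w U) T = cst w T"
proof -
  have cU: "clique U" using assms clique_subset by blast
  have sub: "cst (mulset v U) T \<subseteq> cst v T" if v: "v \<in> G" for v
  proof
    fix z assume "z \<in> cst (mulset v U) T"
    then obtain V where V: "V \<subseteq> T" "z = mulset (mulset v U) V" using v assms cU by (auto simp: cst_eq)
    have "z = mulset v (U - V \<union> (V - U))"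
      using V assms by (auto intro!: mulset_mul clique_subset[OF assms(2)])
    then show "z \<in> cst v T" using V assms v by (auto intro!: mulset_in_cst)
  qed
  have "cst (mulset (mulset w U) U) T \<subseteq> cst (mulset w U) T" using assms cU by (intro sub) auto
  then show ?thesis using sub[OF assms(1)] cU by auto
qed

lemma cst_cong: "w \<in> G \<Longrightarrow> clique T \<Longrightarrow> v \<in> cst w T \<Longrightarrow> cst v T = cst w T"
  by (auto simp: cst_eq[of w] cst_mul[simplified cst_eq[of w]] dest: cst_mul)

lemma cst_subset_iff:
  assumes "w \<in> G" "clique T" "clique T'"
  shows "cst w T \<subseteq> cst w T' \<longleftrightarrow> T \<subseteq> T'"
proof
  assume sub: "cst w T \<subseteq> cst w T'"
  have "mulset w T \<in> cst w T'" using sub mulset_in_cst[of w T T] assms by auto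
  then obtain V where V: "V \<subseteq> T'" "mulset w T = mulset w V" using assms by (auto simp: cst_eq)
  then have "T = V" using assms clique_subset by (intro mulset_inj[OF assms(1)]) auto
  then show "T \<subseteq> T'" using V by simp
qed (use assms cst_mono in auto)

definition cosets :: "'a list set set set" where
  "cosets = {cst w T |w T. w \<in> G \<and> clique T}"

definition ctype :: "'a list set set \<Rightarrow> 'a set" where
  "ctype C = (THE T. clique T \<and> (\<exists>w\<in>G. C = cst w T))"

text \<open>The shortest element, singled out by having no last letter in the type. This form is
  directly usable in \<open>mulset_up\<close>; \<open>minrep_unique\<close> and
  \<open>len_mn\<close> show that it determines the element and that it is shortest.\<close>

definition minrep :: "'a list set set \<Rightarrow> 'a list set" where
  "minrep C = (SOME w. w \<in> C \<and> In w \<inter> ctype C = {})"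

lemma ctype_cst [simp]:
  assumes "w \<in> G" "clique T"
  shows "ctype (cst w T) = T"
  unfolding ctype_def
proof (rule the_equality)
  fix T' assume T': "clique T' \<and> (\<exists>v\<in>G. cst w T = cst v T')"
  then obtain v where v: "v \<in> G" "cst w T = cst v T'" by auto
  then have "cst w T = cst w T'" using T' self_in_cst[OF assms] cst_cong[of v T' w] by simp
  then show "T' = T" using cst_subset_iff[of w] assms T' by blast
qed (use assms in auto)

lemma cosetsE:
  assumes "C \<in> cosets"
  shows "minrep C \<in> G" "clique (ctype C)" "In (minrep C) \<inter> ctype C = {}" "C = cst (minrep C) (ctype C)"
proof -
  obtain w T where w: "w \<in> G" "clique T" "C = cst w T" using assms by (auto simp: cosets_def)
  obtain U where U: "U \<subseteq> T" "In (mulset w U) \<inter> T = {}" using min_rep[OF w(1,2)] .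
  have t: "ctype C = T" using w by simp
  have "mulset w U \<in> C \<and> In (mulset w U) \<inter> ctype C = {}" using t U w by (auto intro: mulset_in_cst)
  then have m: "minrep C \<in> C \<and> In (minrep C) \<inter> ctype C = {}" unfolding minrep_def by (rule someI)
  then show "minrep C \<in> G" "clique (ctype C)" "In (minrep C) \<inter> ctype C = {}" "C = cst (minrep C) (ctype C)"
    using t w cst_G cst_cong[of w T "minrep C"] by auto
qed

lemma cst_cosets [simp]: "w \<in> G \<Longrightarrow> clique T \<Longrightarrow> cst w T \<in> cosets"
  by (auto simp: cosets_def)

lemma minrep_unique:
  assumes "w \<in> G" "clique T" "v \<in> cst w T" "In v \<inter> T = {}" "In w \<inter> T = {}"
  shows "v = w"
proof -
  obtain U where U: "U \<subseteq> T" "v = mulset w U" using assms by (auto simp: cst_eq)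
  have "clique U" "U \<inter> In w = {}" using U assms clique_subset by auto
  then have "U \<subseteq> In v" using mulset_up[of w U] assms U by auto
  then have "U = {}" using U assms by auto
  then show ?thesis using U by simp
qed

lemma minrep_cst:
  assumes "w \<in> G" "clique T" "In w \<inter> T = {}"
  shows "minrep (cst w T) = w"
proof -
  have c: "cst w T \<in> cosets" using assms by simp
  note m = cosetsE[OF c]
  have "minrep (cst w T) \<in> cst w T" using self_in_cst[OF m(1,2)] m(4) by simp
  then show ?thesis using m assms by (intro minrep_unique[of w T]) auto
qed

lemma minrep_in: "C \<in> cosets \<Longrightarrow> minrep C \<in> C"
  using cosetsE self_in_cst by metis

lemma cst_of_mem: "C \<in> cosets \<Longrightarrow> w \<in> C \<Longrightarrow> C = cst w (ctype C)"
  using cosetsE cst_cong by metis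

lemma cosets_memE:
  assumes "C \<in> cosets" "w \<in> C"
  obtains U where "U \<subseteq> ctype C" "w = mulset (minrep C) U"
proof -
  have "w \<in> mulset (minrep C) ` Pow (ctype C)"
    using assms cosetsE[OF assms(1)] cst_eq by metis
  then show ?thesis using that by auto
qed

text \<open>Inclusions translated into letters: the shortest element of the smaller coset lies above
  that of the larger one by a subset U of the larger type. U avoids the smaller type, and both sit
  in one clique, so U commutes with it.\<close>

lemma cosets_le_cases:
  assumes "C \<in> cosets" "D \<in> cosets" "C \<subseteq> D"
  obtains U where "U \<subseteq> ctype D" "minrep C = mulset (minrep D) U" "ctype C \<subseteq> ctype D" "U \<inter> ctype C = {}"
     "In (minrep C) = U \<union> {a \<in> In (minrep D). \<forall>u\<in>U. E a u}"
proof -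
  note c = cosetsE[OF assms(1)] and d = cosetsE[OF assms(2)]
  have m: "minrep C \<in> D" using minrep_in assms by auto
  then obtain U where U: "U \<subseteq> ctype D" "minrep C = mulset (minrep D) U" by (rule cosets_memE[OF assms(2)])
  have "D = cst (minrep C) (ctype D)" using cst_of_mem[OF assms(2) m] .
  then have t: "ctype C \<subseteq> ctype D" using assms c d cst_subset_iff[of "minrep C" "ctype C" "ctype D"] by simp
  have "clique U" "U \<inter> In (minrep D) = {}" using U d clique_subset by auto
  then have i: "In (minrep C) = U \<union> {a \<in> In (minrep D). \<forall>u\<in>U. E a u}" using mulset_up[of "minrep D" U] d U by simp
  show ?thesis using that U t i c(3) by blast
qed

lemma len_mn:
  assumes "C \<in> cosets" "w \<in> C"
  shows "cox_len (minrep C) \<le> cox_len w"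
proof -
  note c = cosetsE[OF assms(1)]
  obtain U where U: "U \<subseteq> ctype C" "w = mulset (minrep C) U" by (rule cosets_memE[OF assms])
  moreover have "U \<inter> In (minrep C) = {}" using U c(3) by blast
  ultimately show ?thesis using mulset_up[of "minrep C" U] c(1) clique_subset[OF c(2) U(1)] by simp
qed

lemma sdeg_eq: "fst \<sigma> \<in> cosets \<Longrightarrow> sdeg \<sigma> = cox_len (minrep (fst \<sigma>))"
  unfolding sdeg_def by (rule Least_equality) (use minrep_in len_mn in blast)+

subsection \<open>Peeling off the last letters\<close>

text \<open>If D lies in some spherical coset through w, this is the type of the smallest such coset
  (\<open>supp_le\<close>). The definition itself mentions no such coset, so monotonicity in D is
  immediate.\<close>

definition supp :: "'a list set \<Rightarrow> 'a list set set \<Rightarrow> 'a set" where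
  "supp w D = \<Union>{U. clique U \<and> mulset w U \<in> D}"

text \<open>The smallest coset that contains the image of C under \<open>peel\<close>.\<close>

definition peel_coset :: "'a list set set \<Rightarrow> 'a list set set" where
  "peel_coset C = cst (peel (minrep C)) (In (minrep C) - {a. \<forall>s\<in>ctype C. E a s})"

definition apex :: "'a list set set \<Rightarrow> 'a list set set" where
  "apex C = cst (minrep C) {}"

text \<open>For D in the carrier of C, the smallest coset containing both D and
  \<open>minrep C\<close>: the top of the zigzag from D down to \<open>apex C\<close>.\<close>

definition hull_apex :: "'a list set set \<Rightarrow> 'a list set set \<Rightarrow> 'a list set set" where
  "hull_apex C D = cst (minrep C) (supp (minrep C) D)"

definition comm_In :: "'a list set \<Rightarrow> 'a set \<Rightarrow> 'a set" where
  "comm_In w U = U \<union> {a \<in> In w. \<forall>u\<in>U. E a u}"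

text \<open>
  The cosets \<open>cst (minrep C) (comm_In (minrep C) U)\<close> all contain \<open>minrep C\<close>, so their union is a cone
  over it. Deleting all last letters from \<open>mulset (minrep C) U\<close> stays inside the one for U.
\<close>

definition car :: "'a list set set \<Rightarrow> 'a list set set set" where
  "car C = {D \<in> cosets. \<exists>U\<subseteq>ctype C. D \<subseteq> cst (minrep C) (comm_In (minrep C) U)}"

lemma clique_comm_In: "w \<in> G \<Longrightarrow> clique U \<Longrightarrow> clique (comm_In w U)"
  using In_clq[of w] E_sym unfolding clique_def comm_In_def by (auto 4 3)

lemma supp_le:
  assumes "w \<in> G" "clique V" "D \<subseteq> cst w V"
  shows "supp w D \<subseteq> V" "D \<subseteq> cst w (supp w D)"
proof -
  show sV: "supp w D \<subseteq> V"
  proof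
    fix s assume "s \<in> supp w D"
    then obtain U where U: "clique U" "mulset w U \<in> D" "s \<in> U" by (auto simp: supp_def)
    then obtain V' where V': "V' \<subseteq> V" "mulset w U = mulset w V'" using assms cst_eq[OF assms(1,2)] by auto
    then have "U = V'" using U assms clique_subset by (intro mulset_inj[OF assms(1)]) auto
    then show "s \<in> V" using U V' by auto
  qed
  show "D \<subseteq> cst w (supp w D)"
  proof
    fix d assume d: "d \<in> D"
    then obtain V' where V': "V' \<subseteq> V" "d = mulset w V'" using assms cst_eq[OF assms(1,2)] by auto
    moreover have "clique V'" using V' assms(2) clique_subset by blast
    ultimately have "V' \<subseteq> supp w D" using d unfolding supp_def by blast
    then show "d \<in> cst w (supp w D)"
      using V' assms sV clique_subset by (auto intro: mulset_in_cst)
  qed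
qed

lemma ctype_PC_clq: "C \<in> cosets \<Longrightarrow> clique (In (minrep C) - {a. \<forall>s\<in>ctype C. E a s})"
  by (rule clique_subset[OF In_clq]) (auto dest: cosetsE)

lemma peel_coset_cosets [simp]: "C \<in> cosets \<Longrightarrow> peel_coset C \<in> cosets"
  using ctype_PC_clq peel(1) cosetsE(1) by (simp add: peel_coset_def)

lemma minrep_PC: "C \<in> cosets \<Longrightarrow> minrep (peel_coset C) = peel (minrep C)"
  unfolding peel_coset_def using ctype_PC_clq peel(1,3)[of "minrep C"] cosetsE(1)
  by (intro minrep_cst) auto

text \<open>Let w be the shortest element of D and A its last letters. That of C is w times U, and
  peeling it removes U together with the part AU of A commuting with U. The result differs from
  \<open>peel w\<close> by \<open>A - AU\<close>. Each letter there fails to commute with a letter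
  of U, hence of \<open>ctype D\<close>, so it belongs to the type of \<open>peel_coset D\<close>;
  the definition of that type is made for this.\<close>

lemma peel_coset_mono:
  assumes "C \<in> cosets" "D \<in> cosets" "C \<subseteq> D"
  shows "peel_coset C \<subseteq> peel_coset D"
proof -
  define w where "w = minrep D"
  define A where "A = In w"
  note c = cosetsE[OF assms(1)] and d = cosetsE[OF assms(2)]
  obtain U where U: "U \<subseteq> ctype D" "minrep C = mulset w U" "ctype C \<subseteq> ctype D" "U \<inter> ctype C = {}"
     "In (minrep C) = U \<union> {a \<in> A. \<forall>u\<in>U. E a u}"
    unfolding w_def A_def by (rule cosets_le_cases[OF assms])
  define AU where "AU = {a \<in> A. \<forall>u\<in>U. E a u}"
  have A: "clique A" "w \<in> G" using In_clq d(1) unfolding A_def w_def by auto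
  have cU: "clique U" using d U clique_subset by blast
  have dis: "U \<inter> AU = {}" using E_irr by (auto simp: AU_def)
  have clUA: "clique (U \<union> AU)" using clique_comm_In[OF A(2) cU] by (simp add: comm_In_def A_def AU_def)
  have pC: "peel (minrep C) = mulset w AU"
  proof -
    have "U - (U \<union> AU) \<union> (U \<union> AU - U) = AU" using dis by auto
    moreover have "U \<union> (U \<union> AU) = U \<union> AU" by auto
    ultimately have "mulset (mulset w U) (U \<union> AU) = mulset w AU" using mulset_mul[of U "U \<union> AU" w] clUA
      by simp
    moreover have "In (minrep C) = U \<union> AU" using U(5) by (simp add: AU_def)
    ultimately show ?thesis using U(2) unfolding peel_def by metis
  qed
  let ?TD = "A - {a. \<forall>s\<in>ctype D. E a s}"
  let ?TC = "In (minrep C) - {a. \<forall>s\<in>ctype C. E a s}"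
  have uT: "E u s" if "u \<in> U" "s \<in> ctype C" for u s
    using d(2) U that unfolding clique_def by (metis disjoint_iff subsetD)
  \<comment> \<open>Letters of U commute with all of \<open>ctype C\<close> and drop out; a letter
    of A obstructed by \<open>ctype C\<close> is also obstructed by the larger
    \<open>ctype D\<close>.\<close>
  have TC: "?TC \<subseteq> ?TD"
    using U(3) by (auto simp: U(5) dest: uT)
  have TD: "clique ?TD" using A(1) clique_subset by blast
  have sub: "A - AU \<subseteq> ?TD" using U(1) by (auto simp: AU_def)
  have "peel (minrep C) = mulset (mulset w A) (A - AU)"
    using mulset_mul_sub[OF A(1), of "A - AU" w] by (simp add: pC double_diff AU_def)
  also have "mulset w A = peel w" by (simp add: peel_def A_def)
  finally have "cst (peel (minrep C)) ?TD = cst (peel w) ?TD"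
    using cst_mul[OF peel(1)[OF A(2)] TD sub] by simp
  moreover have "cst (peel (minrep C)) ?TC \<subseteq> cst (peel (minrep C)) ?TD"
    using cst_mono[OF peel(1)[OF c(1)] TD TC] .
  ultimately show ?thesis unfolding peel_coset_def w_def[symmetric] A_def[symmetric] by simp
qed

text \<open>A coset of the cone for C given by V is the one for D given by the union of U and V. The
  two descriptions of the last letters agree because U commutes with V.\<close>

lemma car_mono:
  assumes "C \<in> cosets" "D \<in> cosets" "C \<subseteq> D"
  shows "car C \<subseteq> car D"
proof
  fix F assume F: "F \<in> car C"
  define w where "w = minrep D"
  note c = cosetsE[OF assms(1)] and d = cosetsE[OF assms(2)]
  obtain U where U: "U \<subseteq> ctype D" "minrep C = mulset w U" "ctype C \<subseteq> ctype D" "U \<inter> ctype C = {}"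
     "In (minrep C) = U \<union> {a \<in> In w. \<forall>u\<in>U. E a u}"
    unfolding w_def by (rule cosets_le_cases[OF assms])
  obtain V where V: "V \<subseteq> ctype C" "F \<subseteq> cst (minrep C) (comm_In (minrep C) V)" and F': "F \<in> cosets"
    using F by (auto simp: car_def)
  have w: "w \<in> G" using d w_def by simp
  have clUV: "clique (U \<union> V)" using d U V by (intro clique_subset[OF d(2)]) auto
  have uV: "E u s" if "u \<in> U" "s \<in> V" for u s
    using d(2) U V that unfolding clique_def by (metis disjoint_iff subsetD)
  have eq: "comm_In (minrep C) V = comm_In w (U \<union> V)"
    using uV by (auto simp: comm_In_def U(5))
  have cl: "clique (comm_In w (U \<union> V))" by (rule clique_comm_In[OF w clUV])
  have "U \<subseteq> comm_In w (U \<union> V)" by (auto simp: comm_In_def)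
  from cst_mul[OF w cl this] have "cst (minrep C) (comm_In (minrep C) V) = cst w (comm_In w (U \<union> V))"
    using eq U(2) by metis
  then show "F \<in> car D" using F' V U(1,3) unfolding car_def w_def[symmetric]
    by (auto intro!: exI[of _ "U \<union> V"])
qed

lemma carE:
  assumes "C \<in> cosets" "D \<in> car C"
  obtains V where "clique V" "D \<subseteq> cst (minrep C) V" "D \<in> cosets" "\<And>F. F \<in> cosets \<Longrightarrow> F \<subseteq> cst (minrep C) V \<Longrightarrow> F \<in> car C"
proof -
  obtain U where U: "U \<subseteq> ctype C" "D \<subseteq> cst (minrep C) (comm_In (minrep C) U)" "D \<in> cosets"
    using assms by (auto simp: car_def)
  have "clique (comm_In (minrep C) U)" using cosetsE[OF assms(1)] U clique_subset by (intro clique_comm_In) auto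
  then show ?thesis using that[of "comm_In (minrep C) U"] U by (auto simp: car_def)
qed

sublocale cr: carried cosets peel_coset apex hull_apex car
proof
  fix C D assume C: "C \<in> cosets" and D: "D \<in> cosets" and le: "C \<le> D"
  show "car C \<subseteq> car D" by (rule car_mono[OF C D le])
  show "peel_coset C \<le> peel_coset D" by (rule peel_coset_mono[OF C D le])
next
  fix C assume C: "C \<in> cosets"
  note c = cosetsE[OF C]
  have "cst (minrep C) (ctype C) \<subseteq> cst (minrep C) (comm_In (minrep C) (ctype C))"
    using c by (intro cst_mono clique_comm_In) (auto simp: comm_In_def)
  then show "C \<in> car C" using C c(4) by (auto simp: car_def)
  \<comment> \<open>The empty subset gives the type \<open>In (minrep C)\<close>, and that coset
    contains the peeled element, which arises by deleting exactly these letters.\<close>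
  have cl: "clique (comm_In (minrep C) {})" using c clique_comm_In by simp
  have "peel_coset C \<subseteq> cst (peel (minrep C)) (In (minrep C))"
    unfolding peel_coset_def using c peel(1) In_clq by (intro cst_mono) auto
  also have "\<dots> = cst (minrep C) (comm_In (minrep C) {})"
    unfolding peel_def using cst_mul[OF c(1) In_clq[OF c(1)]] by (simp add: comm_In_def)
  finally show "peel_coset C \<in> car C" using C by (auto simp: car_def)
  have "apex C \<subseteq> cst (minrep C) (comm_In (minrep C) {})"
    unfolding apex_def using c cl by (intro cst_mono) auto
  moreover have "apex C \<in> cosets" using c by (simp add: apex_def)
  ultimately show "apex C \<in> car C" by (auto simp: car_def)
  fix D assume D: "D \<in> car C"
  obtain V where V: "clique V" "D \<subseteq> cst (minrep C) V" "D \<in> cosets" "\<And>F. F \<in> cosets \<Longrightarrow> F \<subseteq> cst (minrep C) V \<Longrightarrow> F \<in> car C"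
    using carE[OF C D] by blast
  note sp = supp_le[OF c(1) V(1,2)]
  have cs: "clique (supp (minrep C) D)" using sp V clique_subset by blast
  show "hull_apex C D \<in> car C" unfolding hull_apex_def
    using c cs sp V(1) by (intro V(4) cst_cosets cst_mono) auto
  show "D \<le> hull_apex C D" using sp by (simp add: hull_apex_def)
  show "apex C \<le> hull_apex C D" unfolding apex_def hull_apex_def using c cs by (intro cst_mono) auto
  fix D' assume D': "D' \<in> car C" and le: "D \<le> D'"
  obtain V' where V': "clique V'" "D' \<subseteq> cst (minrep C) V'"
    using carE[OF C D'] by metis
  have "clique (supp (minrep C) D')" using supp_le[OF c(1) V'] V' clique_subset by blast
  moreover have "supp (minrep C) D \<subseteq> supp (minrep C) D'" using le by (auto simp: supp_def)
  ultimately show "hull_apex C D \<le> hull_apex C D'" unfolding hull_apex_def using c by (intro cst_mono) auto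
qed

lemma peel_coset_pow_cosets: "C \<in> cosets \<Longrightarrow> (peel_coset ^^ n) C \<in> cosets"
  by (induction n) auto

lemma peel_coset_pow_mono: "C \<in> cosets \<Longrightarrow> D \<in> cosets \<Longrightarrow> C \<subseteq> D \<Longrightarrow> (peel_coset ^^ n) C \<subseteq> (peel_coset ^^ n) D"
proof (induction n)
  case (Suc n)
  then have "peel_coset ((peel_coset ^^ n) C) \<subseteq> peel_coset ((peel_coset ^^ n) D)" by (intro peel_coset_mono peel_coset_pow_cosets)
  then show ?case by simp
qed simp

lemma minrep_PC_pow: "C \<in> cosets \<Longrightarrow> minrep ((peel_coset ^^ n) C) = (peel ^^ n) (minrep C)"
  by (induction n) (auto simp: minrep_PC peel_coset_pow_cosets)

lemma peel_pow_G: "w \<in> G \<Longrightarrow> (peel ^^ n) w \<in> G"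
  by (induction n) (auto intro: peel)

text \<open>At step k the two cosets may still differ while both contain the identity as shortest
  element; one further step sends both to the vertex \<open>cst one {}\<close>. Hence the strict
  \<open>k < n\<close>.\<close>

lemma peel_coset_pow_collapse:
  assumes "C \<in> cosets" "D \<in> cosets" "C \<subseteq> D" "(peel ^^ k) (minrep C) = one" "k < n"
  shows "(peel_coset ^^ n) C = (peel_coset ^^ n) D"
proof -
  have base: "peel_coset F = cst one {}" if "F \<in> cosets" "minrep F = one" for F
    using that by (simp add: peel_coset_def)
  have mD: "minrep ((peel_coset ^^ k) D) = one"
  proof -
    \<comment> \<open>The identity lies in the smaller coset, so by monotonicity in the larger one,
      where nothing can be shorter.\<close>
    have "one \<in> (peel_coset ^^ k) C" using minrep_in[OF peel_coset_pow_cosets[OF assms(1), of k]] assms minrep_PC_pow by metis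
    then have "one \<in> (peel_coset ^^ k) D" using peel_coset_pow_mono[OF assms(1-3), of k] by auto
    then have "cox_len (minrep ((peel_coset ^^ k) D)) = 0" using len_mn[OF peel_coset_pow_cosets[OF assms(2)], of one k] by simp
    then show ?thesis using len_eq_0 cosetsE(1)[OF peel_coset_pow_cosets[OF assms(2)]] by blast
  qed
  have "(peel_coset ^^ Suc k) C = (peel_coset ^^ Suc k) D"
    using base peel_coset_pow_cosets assms mD minrep_PC_pow by simp
  moreover have "(peel_coset ^^ n) F = (peel_coset ^^ (n - Suc k)) ((peel_coset ^^ Suc k) F)" for F
    using assms(5) by (metis Suc_leI comp_apply funpow_add le_add_diff_inverse2)
  ultimately show ?thesis by metis
qed

lemma len_pp_pow:
  assumes "w \<in> G" "\<And>k. k < n \<Longrightarrow> (peel ^^ k) w \<noteq> one"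
  shows "cox_len ((peel ^^ n) w) + n \<le> cox_len w"
  using assms(2)
proof (induction n)
  case (Suc n)
  let ?v = "(peel ^^ n) w"
  have v: "?v \<in> G" "?v \<noteq> one" using Suc peel_pow_G assms by auto
  have "In ?v \<noteq> {}" using In_nonempty v by blast
  then have "0 < card (In ?v)" using clique_finite[OF In_clq[OF v(1)]] by (simp add: card_gt_0_iff)
  then show ?case using peel(4)[OF v(1)] Suc by simp
qed simp

lemma len_mul_le:
  assumes "w \<in> G" "clique U"
  shows "cox_len (mulset w U) \<le> cox_len w + card U"
proof -
  from clique_finite[OF assms(2)] assms(2) show ?thesis
  proof (induction U rule: finite_induct)
    case (insert s U)
    have U: "clique U" using insert.prems by (auto elim: clique_subset)
    have "s \<in> S" using insert.prems by (simp add: clique_def)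
    then have "cox_len (rmul (mulset w U) s) \<le> Suc (cox_len (mulset w U))"
      using len_rm[OF mulset_G[OF assms(1) U], of s] by auto
    then show ?case using insert U by (simp add: mulset_insert)
  qed simp
qed

text \<open>Peeling only deletes final letters, so w is u followed by the deleted ones. Their number
  bounds the length of \<open>\<phi> w\<close> from above, and the assumed triangle inequality
  bounds it from below.\<close>

lemma len_translate_pp_pow:
  assumes "\<phi> ` G \<subseteq> G" "\<phi> u = one" "\<And>w s. w \<in> G \<Longrightarrow> \<phi> (rmul w s) = rmul (\<phi> w) s"
    "\<And>w. w \<in> G \<Longrightarrow> cox_len w \<le> cox_len u + cox_len (\<phi> w)"
    and "w \<in> G" "(peel ^^ n) w = u"
  shows "cox_len w = cox_len u + cox_len (\<phi> w)"
  using assms(5,6)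
proof (induction n arbitrary: w)
  case 0 then show ?case using assms(2) by simp
next
  case (Suc n)
  have mul_phi: "\<phi> (mulset v U) = mulset (\<phi> v) U" if "v \<in> G" "clique U" for v U
    using clique_finite[OF that(2)] that(2)
  proof (induction U rule: finite_induct)
    case (insert s U)
    moreover have "clique U" using insert.prems by (auto elim: clique_subset)
    ultimately show ?case using that by (simp add: mulset_insert assms)
  qed simp
  note p = peel[OF Suc.prems(1)]
  have cl: "clique (In w)" using In_clq Suc by blast
  have "cox_len (peel w) = cox_len u + cox_len (\<phi> (peel w))"
    using Suc.prems p by (intro Suc.IH) (auto simp: funpow_Suc_right simp del: funpow.simps)
  moreover have "cox_len (mulset (\<phi> (peel w)) (In w)) \<le> cox_len (\<phi> (peel w)) + card (In w)"
    using assms(1) p cl by (intro len_mul_le) auto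
  then have "cox_len (\<phi> w) \<le> cox_len (\<phi> (peel w)) + card (In w)"
    using mul_phi[OF p(1) cl] p(2) by simp
  ultimately show ?case using assms(4)[OF Suc.prems(1)] p(4) by simp
qed

subsection \<open>Simplices of the Davis complex\<close>

definition cliques :: "'a set set" where "cliques = {U. clique U}"

lemma finite_cliques: "finite cliques"
  by (rule finite_subset[of _ "Pow S"]) (auto simp: cliques_def clique_def finS)

lemma finite_dchains: "finite (dchains S E i)"
proof (rule finite_subset)
  show "dchains S E i \<subseteq> {c. set c \<subseteq> cliques \<and> length c = Suc i}"
    by (auto simp: dchains_def spherical_iff cliques_def)
  show "finite {c. set c \<subseteq> cliques \<and> length c = Suc i}"
    by (rule finite_lists_length_eq[OF finite_cliques])
qed

definition schains :: "nat \<Rightarrow> 'a list set set list set" where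
  "schains i = {l. length l = Suc i \<and> sorted_wrt (<) l \<and> set l \<subseteq> cosets}"

text \<open>The passage from a coset with a chain of types to the flag of cosets it stands for,
  where the poset homotopies apply. \<open>of_list\<close> is its inverse on simplices.\<close>

definition to_list :: "'a dsimplex \<Rightarrow> 'a list set set list" where
  "to_list \<sigma> = map (cst (minrep (fst \<sigma>))) (snd \<sigma>)"

definition of_list :: "'a list set set list \<Rightarrow> 'a dsimplex" where
  "of_list l = (hd l, map ctype l)"

lemma ssimpE:
  assumes "\<sigma> \<in> ssimp S E i"
  shows "fst \<sigma> \<in> cosets" "snd \<sigma> \<in> dchains S E i" "ctype (fst \<sigma>) = hd (snd \<sigma>)"
    "fst \<sigma> = cst (minrep (fst \<sigma>)) (hd (snd \<sigma>))" "minrep (fst \<sigma>) \<in> G" "\<And>T. T \<in> set (snd \<sigma>) \<Longrightarrow> clique T"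
    "snd \<sigma> \<noteq> []"
proof -
  obtain w c where w: "w \<in> G" "\<sigma> = (cst w (hd c), c)" "c \<in> dchains S E i"
    using assms by (auto simp: ssimp_def)
  have c: "c \<noteq> []" "\<And>T. T \<in> set c \<Longrightarrow> clique T" using w by (auto simp: dchains_def spherical_iff)
  then have "clique (hd c)" by simp
  then show "fst \<sigma> \<in> cosets" "ctype (fst \<sigma>) = hd (snd \<sigma>)" using w by auto
  then show "fst \<sigma> = cst (minrep (fst \<sigma>)) (hd (snd \<sigma>))" "minrep (fst \<sigma>) \<in> G" using cosetsE by metis+
  show "snd \<sigma> \<in> dchains S E i" "\<And>T. T \<in> set (snd \<sigma>) \<Longrightarrow> clique T" "snd \<sigma> \<noteq> []" using w c by auto
qed

lemma to_list_schains:
  assumes "\<sigma> \<in> ssimp S E i"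
  shows "to_list \<sigma> \<in> schains i" "of_list (to_list \<sigma>) = \<sigma>" "hd (to_list \<sigma>) = fst \<sigma>"
proof -
  note s = ssimpE[OF assms]
  let ?w = "minrep (fst \<sigma>)"
  have ss: "sorted_wrt (\<subset>) (snd \<sigma>)" "length (snd \<sigma>) = Suc i" using s(2) by (auto simp: dchains_def)
  have "sorted_wrt (<) (to_list \<sigma>)" unfolding to_list_def sorted_wrt_map
  proof (rule sorted_wrt_mono_rel[OF _ ss(1)])
    fix T T' assume T: "T \<in> set (snd \<sigma>)" "T' \<in> set (snd \<sigma>)" "T \<subset> T'"
    have "cst ?w T \<subseteq> cst ?w T'" "\<not> cst ?w T' \<subseteq> cst ?w T" using T s by (auto simp: cst_subset_iff)
    then show "cst ?w T < cst ?w T'" by auto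
  qed
  then show "to_list \<sigma> \<in> schains i" using ss s by (auto simp: schains_def to_list_def)
  show h: "hd (to_list \<sigma>) = fst \<sigma>" using s by (simp add: to_list_def hd_map)
  have "map ctype (to_list \<sigma>) = snd \<sigma>"
    using s by (auto simp: to_list_def intro!: map_idI)
  then show "of_list (to_list \<sigma>) = \<sigma>" using h by (simp add: of_list_def)
qed

lemma of_list_ssimp:
  assumes "l \<in> schains i"
  shows "of_list l \<in> ssimp S E i" "to_list (of_list l) = l"
proof -
  have l: "length l = Suc i" "sorted_wrt (<) l" "set l \<subseteq> cosets" "l \<noteq> []" using assms by (auto simp: schains_def)
  let ?w = "minrep (hd l)"
  have h: "hd l \<in> cosets" using l by auto
  note m = cosetsE[OF h]
  have le: "hd l \<subseteq> D" if "D \<in> set l" for D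
    using l(2) that by (cases l) auto
  have eq: "D = cst ?w (ctype D)" if "D \<in> set l" for D
    using le[OF that] l(3) that minrep_in[OF h] by (intro cst_of_mem) auto
  show tl: "to_list (of_list l) = l"
    using eq by (auto simp: to_list_def of_list_def intro!: map_idI)
  have "sorted_wrt (\<subset>) (map ctype l)" unfolding sorted_wrt_map
  proof (rule sorted_wrt_mono_rel[OF _ l(2)])
    fix D D' assume D: "D \<in> set l" "D' \<in> set l" "D < D'"
    have c: "clique (ctype D)" "clique (ctype D')" using D l cosetsE(2) by auto
    have "cst ?w (ctype D) \<subset> cst ?w (ctype D')" using D eq by metis
    then show "ctype D \<subset> ctype D'" using cst_subset_iff[OF m(1)] c by (auto simp: psubset_eq)
  qed
  moreover have "clique (ctype D)" if "D \<in> set l" for D using that l(3) cosetsE(2) by blast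
  ultimately have "map ctype l \<in> dchains S E i"
    using l by (auto simp: dchains_def spherical_iff)
  moreover have "hd l = cst ?w (hd (map ctype l))" using m(4) l(4) by (simp add: hd_map)
  ultimately show "of_list l \<in> ssimp S E i" using m(1) by (auto simp: ssimp_def of_list_def)
qed

lemma sface_list:
  assumes "\<sigma> \<in> ssimp S E (Suc i)" "j \<le> Suc i"
  shows "take j (to_list \<sigma>) @ drop (Suc j) (to_list \<sigma>) \<in> schains i"
    "sface S E j \<sigma> = of_list (take j (to_list \<sigma>) @ drop (Suc j) (to_list \<sigma>))"
proof -
  note s = ssimpE[OF assms(1)] and t = to_list_schains[OF assms(1)]
  let ?l = "to_list \<sigma>"
  let ?m = "take j ?l @ drop (Suc j) ?l"
  have l: "length ?l = Suc (Suc i)" "sorted_wrt (<) ?l" "set ?l \<subseteq> cosets" using t by (auto simp: schains_def)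
  have lc: "length (snd \<sigma>) = Suc (Suc i)" using s(2) by (simp add: dchains_def)
  have set: "set ?m \<subseteq> set ?l" using set_take_subset set_drop_subset by fastforce
  have "?l = take j ?l @ [?l ! j] @ drop (Suc j) ?l" using assms(2) l by (simp add: id_take_nth_drop)
  then have "sorted_wrt (<) (take j ?l @ [?l ! j] @ drop (Suc j) ?l)" using l(2) by metis
  then have "sorted_wrt (<) ?m" by (auto simp: sorted_wrt_append)
  moreover have "length ?m = Suc i" using assms(2) l by simp
  ultimately show "?m \<in> schains i" using set l(3) by (auto simp: schains_def)
  have mp: "map ctype ?m = take j (snd \<sigma>) @ drop (Suc j) (snd \<sigma>)"
  proof -
    have "map ctype ?l = snd \<sigma>" using t(2) by (metis of_list_def snd_conv)
    then show ?thesis by (metis drop_map map_append take_map)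
  qed
  show "sface S E j \<sigma> = of_list ?m"
  proof (cases "j = 0")
    case True
    \<comment> \<open>The choice of representative does not matter: any element of the first coset
      lies in the second, which it therefore represents.\<close>
    let ?v = "SOME w. w \<in> fst \<sigma>"
    have v: "?v \<in> fst \<sigma>" using minrep_in[OF s(1)] by (rule someI)
    have sub: "fst \<sigma> \<subseteq> ?l ! 1" using l(1,2) t(3) by (cases ?l) (auto simp: nth_Cons')
    have c1: "?l ! 1 \<in> cosets" using l by auto
    have "ctype (?l ! 1) = snd \<sigma> ! 1" using s lc by (simp add: to_list_def)
    then have "?l ! 1 = cst ?v (snd \<sigma> ! 1)" using cst_of_mem[OF c1, of ?v] v sub by auto
    moreover have "hd ?m = ?l ! 1" using True l(1) by (simp add: hd_drop_conv_nth)
    ultimately show ?thesis using True mp by (simp add: sface_def of_list_def drop_Suc)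
  next
    case False
    then have "hd ?m = hd ?l" using l(1) by (cases ?l; cases j) auto
    then show ?thesis using False mp t(3) by (simp add: sface_def of_list_def)
  qed
qed

lemma sface_ssimp: "\<sigma> \<in> ssimp S E (Suc i) \<Longrightarrow> j \<le> Suc i \<Longrightarrow> sface S E j \<sigma> \<in> ssimp S E i"
  using sface_list of_list_ssimp by metis

lemma to_list_sface:
  "\<sigma> \<in> ssimp S E (Suc i) \<Longrightarrow> j \<le> Suc i \<Longrightarrow> to_list (sface S E j \<sigma>) = take j (to_list \<sigma>) @ drop (Suc j) (to_list \<sigma>)"
  using sface_list of_list_ssimp by metis

lemma sface_ge:
  assumes "\<sigma> \<in> ssimp S E (Suc i)" "j \<le> Suc i"
  shows "fst \<sigma> \<subseteq> fst (sface S E j \<sigma>)"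
proof -
  let ?l = "to_list \<sigma>"
  have l: "sorted_wrt (<) ?l" using to_list_schains(1)[OF assms(1)] by (simp add: schains_def)
  have "set (take j ?l @ drop (Suc j) ?l) \<subseteq> set ?l" using set_take_subset set_drop_subset by fastforce
  moreover have "take j ?l @ drop (Suc j) ?l \<noteq> []" using sface_list(1)[OF assms] by (auto simp: schains_def)
  ultimately have "hd (take j ?l @ drop (Suc j) ?l) \<in> set ?l" by (meson hd_in_set subsetD)
  moreover have "hd ?l \<subseteq> D" if "D \<in> set ?l" for D
    using l that by (cases ?l) auto
  ultimately show ?thesis using sface_list(2)[OF assms] to_list_schains(3)[OF assms(1)] by (simp add: of_list_def)
qed

text \<open>A symmetric relation that covers both the faces of a simplex and the simplices of its carrier.\<close>

definition near :: "'a dsimplex \<Rightarrow> 'a dsimplex \<Rightarrow> bool" where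
  "near \<sigma> \<tau> \<longleftrightarrow> (\<exists>U V. clique U \<and> clique V \<and> minrep (fst \<sigma>) = mulset (mulset (minrep (fst \<tau>)) U) V)"

lemma near_sym: "near \<sigma> \<tau> \<Longrightarrow> near \<tau> \<sigma>"
  unfolding near_def by (metis mulset_mul_self)

lemma near_finite:
  "finite {\<sigma> \<in> ssimp S E i. near \<sigma> \<tau>}"
  "card {\<sigma> \<in> ssimp S E i. near \<sigma> \<tau>} \<le> card (cliques \<times> cliques \<times> dchains S E i)"
proof -
  let ?g = "\<lambda>(U, V, c). (cst (mulset (mulset (minrep (fst \<tau>)) U) V) (hd c), c)"
  have sub: "{\<sigma> \<in> ssimp S E i. near \<sigma> \<tau>} \<subseteq> ?g ` (cliques \<times> cliques \<times> dchains S E i)"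
  proof
    fix \<sigma> assume "\<sigma> \<in> {\<sigma> \<in> ssimp S E i. near \<sigma> \<tau>}"
    then obtain U V where UV: "\<sigma> \<in> ssimp S E i" "clique U" "clique V" "minrep (fst \<sigma>) = mulset (mulset (minrep (fst \<tau>)) U) V"
      by (auto simp: near_def)
    have "\<sigma> = ?g (U, V, snd \<sigma>)" using ssimpE(4)[OF UV(1)] UV(4) by (metis (no_types, lifting) case_prod_conv prod.collapse)
    moreover have "(U, V, snd \<sigma>) \<in> cliques \<times> cliques \<times> dchains S E i"
      using UV ssimpE(2) by (auto simp: cliques_def)
    ultimately show "\<sigma> \<in> ?g ` (cliques \<times> cliques \<times> dchains S E i)" by (rule image_eqI)
  qed
  have fin: "finite (cliques \<times> cliques \<times> dchains S E i)" by (simp add: finite_cliques finite_dchains)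
  show "finite {\<sigma> \<in> ssimp S E i. near \<sigma> \<tau>}" using sub fin finite_subset by blast
  show "card {\<sigma> \<in> ssimp S E i. near \<sigma> \<tau>} \<le> card (cliques \<times> cliques \<times> dchains S E i)"
    by (rule surj_card_le[OF fin sub])
qed

lemma near_len:
  assumes "\<tau> \<in> ssimp S E k" "near \<sigma> \<tau>"
  shows "cox_len (minrep (fst \<sigma>)) \<le> cox_len (minrep (fst \<tau>)) + 2 * card S"
proof -
  obtain U V where UV: "clique U" "clique V" "minrep (fst \<sigma>) = mulset (mulset (minrep (fst \<tau>)) U) V"
    using assms(2) by (auto simp: near_def)
  have g: "minrep (fst \<tau>) \<in> G" using ssimpE[OF assms(1)] by auto
  \<comment> \<open>Each of the two clique moves in \<open>near\<close> changes the length by at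
    most \<open>card S\<close>.\<close>
  have "card U \<le> card S" "card V \<le> card S" using UV finS by (auto intro!: card_mono simp: clique_def)
  then show ?thesis using len_mul_le[OF g UV(1)] len_mul_le[OF mulset_G[OF g UV(1)] UV(2)] UV(3) by simp
qed

lemma sdeg_ssimp: "\<sigma> \<in> ssimp S E i \<Longrightarrow> sdeg \<sigma> = cox_len (minrep (fst \<sigma>))"
  using sdeg_eq ssimpE(1) by blast

lemma near_sum:
  assumes "0 < (t::real)" "\<tau> \<in> ssimp S E k" "finite F" "F \<subseteq> {\<sigma> \<in> ssimp S E i. near \<sigma> \<tau>}"
  shows "(\<Sum>\<sigma>\<in>F. t ^ sdeg \<sigma>) \<le> card (cliques \<times> cliques \<times> dchains S E i) * max t (1 / t) ^ (2 * card S) * t ^ sdeg \<tau>"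
proof -
  let ?r = "max t (1 / t) ^ (2 * card S)"
  have r0: "0 \<le> ?r" using assms by simp
  have "(\<Sum>\<sigma>\<in>F. t ^ sdeg \<sigma>) \<le> (\<Sum>\<sigma>\<in>F. ?r * t ^ sdeg \<tau>)"
  proof (rule sum_mono)
    fix \<sigma> assume "\<sigma> \<in> F"
    then have s: "\<sigma> \<in> ssimp S E i" "near \<sigma> \<tau>" using assms by auto
    show "t ^ sdeg \<sigma> \<le> ?r * t ^ sdeg \<tau>"
      using near_len[OF assms(2) s(2)] near_len[OF s(1) near_sym[OF s(2)]] s assms
      by (intro power_le_power_ratio) (auto simp: sdeg_ssimp)
  qed
  also have "\<dots> = real (card F) * (?r * t ^ sdeg \<tau>)" by simp
  also have "\<dots> \<le> real (card (cliques \<times> cliques \<times> dchains S E i)) * (?r * t ^ sdeg \<tau>)"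
  proof (intro mult_right_mono of_nat_mono)
    show "card F \<le> card (cliques \<times> cliques \<times> dchains S E i)"
      using card_mono[OF near_finite(1) assms(4)] near_finite(2) le_trans by blast
  qed (use assms r0 in auto)
  finally show ?thesis by (simp add: mult_ac)
qed

lemma near_sface:
  assumes "\<sigma> \<in> ssimp S E (Suc i)" "j \<le> Suc i"
  shows "near \<sigma> (sface S E j \<sigma>)"
proof -
  note f = ssimpE[OF sface_ssimp[OF assms]]
  have "minrep (fst \<sigma>) \<in> fst (sface S E j \<sigma>)"
    using sface_ge[OF assms] minrep_in ssimpE(1)[OF assms(1)] by blast
  then obtain U where U: "U \<subseteq> ctype (fst (sface S E j \<sigma>))" "minrep (fst \<sigma>) = mulset (minrep (fst (sface S E j \<sigma>))) U"
    using cosets_memE[OF f(1)] by blast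
  then have "clique U" using cosetsE(2)[OF f(1)] clique_subset by blast
  then show ?thesis using U unfolding near_def by (metis clique_empty mulset_empty)
qed

end

locale racg_growth = racg +
  fixes t :: real
  assumes t_pos: "0 < t" and t_radius: "ereal t < growth_radius S E"
begin

section \<open>Convergence of the growth series\<close>

definition sphere_at :: "nat \<Rightarrow> 'a list set set" where
  "sphere_at n = {w \<in> G. cox_len w = n}"

lemma finite_sphere_at: "finite (sphere_at n)"
proof (rule finite_subset)
  show "sphere_at n \<subseteq> cls ` {ys. set ys \<subseteq> S \<and> length ys = n}"
    by (force simp: sphere_at_def elim: G_reduced_word)
  show "finite (cls ` {ys. set ys \<subseteq> S \<and> length ys = n})"
    by (intro finite_imageI finite_lists_length_eq finS)
qed

text \<open>A finite set of group elements, grouped by length, is dominated by the power series,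
  which converges inside its radius.\<close>

lemma growth_summable: "(\<lambda>w. t ^ cox_len w) summable_on G"
proof -
  let ?f = "\<lambda>n. real (card (sphere_at n)) * t ^ n"
  have s: "summable ?f"
  proof (rule summable_in_conv_radius)
    show "ereal (norm t) < conv_radius (\<lambda>n. real (card (sphere_at n)))"
      using t_pos t_radius by (simp add: growth_radius_def sphere_at_def)
  qed
  have "sum (\<lambda>w. t ^ cox_len w) F \<le> suminf ?f" if F: "finite F" "F \<subseteq> G" for F
  proof -
    have fin: "finite (cox_len ` F)" using F by simp
    have "sum (\<lambda>w. t ^ cox_len w) F = (\<Sum>n\<in>cox_len ` F. \<Sum>w\<in>{w\<in>F. cox_len w = n}. t ^ cox_len w)"
      using F by (intro sum.group[symmetric]) auto
    also have "\<dots> \<le> (\<Sum>n\<in>cox_len ` F. ?f n)"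
    proof (rule sum_mono)
      fix n
      have "(\<Sum>w\<in>{w\<in>F. cox_len w = n}. t ^ cox_len w) = real (card {w\<in>F. cox_len w = n}) * t ^ n"
        by simp
      also have "\<dots> \<le> ?f n"
        using F t_pos finite_sphere_at[of n]
        by (intro mult_right_mono of_nat_mono card_mono) (auto simp: sphere_at_def)
      finally show "(\<Sum>w\<in>{w\<in>F. cox_len w = n}. t ^ cox_len w) \<le> ?f n" .
    qed
    also have "\<dots> \<le> suminf ?f" using t_pos by (intro sum_le_suminf s fin) auto
    finally show ?thesis .
  qed
  then show ?thesis using t_pos
    by (intro nonneg_bdd_above_summable_on bdd_aboveI[of _ "suminf ?f"]) auto
qed

lemma growth_pos: "0 < growth S E t"
proof -
  have "(\<Sum>w\<in>{one}. t ^ cox_len w) \<le> growth S E t"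
    unfolding growth_def using t_pos by (intro finite_sum_le_infsum growth_summable) auto
  then show ?thesis by simp
qed

lemma growth_tail:
  assumes "0 < e"
  obtains n where "\<And>F. finite F \<Longrightarrow> F \<subseteq> {w\<in>G. n \<le> cox_len w} \<Longrightarrow> (\<Sum>w\<in>F. t ^ cox_len w) \<le> e"
proof -
  let ?f = "\<lambda>w. t ^ cox_len w"
  obtain F0 where F0: "finite F0" "F0 \<subseteq> G" "dist (sum ?f F0) (infsum ?f G) \<le> e"
    using infsum_finite_approximation[OF growth_summable assms] by metis
  define n where "n = Suc (Max (cox_len ` F0))"
  have n: "cox_len w < n" if "w \<in> F0" for w
    using that F0 by (simp add: n_def less_Suc_eq_le)
  show ?thesis
  proof (rule that[of n])
    fix F assume F: "finite F" "F \<subseteq> {w\<in>G. n \<le> cox_len w}"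
    have "F \<inter> F0 = {}" using F n by fastforce
    then have "sum ?f F + sum ?f F0 = sum ?f (F \<union> F0)" using F F0 by (simp add: sum.union_disjoint)
    also have "\<dots> \<le> infsum ?f G"
      using F F0 t_pos by (intro finite_sum_le_infsum growth_summable) auto
    finally show "sum ?f F \<le> e" using F0(3) by (simp add: dist_real_def)
  qed
qed

subsection \<open>Pulling cochains back along the peeling map\<close>

declare htpy.simps(2) [simp del]

text \<open>The default 0 extends a cochain to degenerate chains, so it can be evaluated after a map
  that identifies vertices.\<close>

definition lift :: "nat \<Rightarrow> ('a dsimplex \<Rightarrow> complex) \<Rightarrow> 'a list set set list \<Rightarrow> complex" where
  "lift i f l = (if l \<in> schains i then f (of_list l) else 0)"

definition lift_pow :: "nat \<Rightarrow> nat \<Rightarrow> ('a dsimplex \<Rightarrow> complex) \<Rightarrow> 'a list set set list \<Rightarrow> complex" where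
  "lift_pow i n f l = lift i f (map (peel_coset ^^ n) l)"

definition pull :: "nat \<Rightarrow> nat \<Rightarrow> ('a dsimplex \<Rightarrow> complex) \<Rightarrow> 'a dsimplex \<Rightarrow> complex" where
  "pull i n f \<sigma> = (if \<sigma> \<in> ssimp S E i then lift_pow i n f (to_list \<sigma>) else 0)"

text \<open>The homotopy between the n-th and the next iterate: the one between the identity and P,
  applied to the cochain already pulled back n times. \<open>Suc k\<close> is the number of vertices
  of a k-simplex.\<close>

definition htpy_pull :: "nat \<Rightarrow> nat \<Rightarrow> ('a dsimplex \<Rightarrow> complex) \<Rightarrow> 'a dsimplex \<Rightarrow> complex" where
  "htpy_pull k n f \<eta> = (if \<eta> \<in> ssimp S E k
     then htpy peel_coset apex hull_apex (Suc k) (to_list \<eta>) (lift_pow (Suc k) n f) else 0)"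

definition nrm2 :: "nat \<Rightarrow> ('a dsimplex \<Rightarrow> complex) \<Rightarrow> real" where
  "nrm2 i f = (\<Sum>\<^sub>\<infinity>\<sigma>\<in>ssimp S E i. (cmod (f \<sigma>))\<^sup>2 * t ^ sdeg \<sigma>)"

lemma schains_wchains: "l \<in> schains i \<Longrightarrow> l \<in> wchains (Suc i) cosets"
  by (auto simp: schains_def wchains_def elim!: sorted_wrt_mono_rel[rotated])

lemma lift_repetition: "lift i f (a @ [x, x] @ b) = 0"
  by (simp add: lift_def schains_def sorted_wrt_append)

lemma lift_cocycle:
  assumes "\<And>\<sigma>. \<sigma> \<in> ssimp S E (Suc i) \<Longrightarrow> cobd S E i f \<sigma> = 0"
    and "l \<in> wchains (Suc (Suc i)) cosets"
  shows "cobound (lift i f) l = 0"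
proof -
  have "sorted_wrt (\<le>) l" using assms(2) by (simp add: wchains_def)
  then consider "sorted_wrt (<) l" | a x b where "l = a @ [x, x] @ b"
    using sorted_repetition by blast
  then show ?thesis
  proof cases
    case 1
    then have l: "l \<in> schains (Suc i)" using assms(2) by (auto simp: schains_def wchains_def)
    note o = of_list_ssimp[OF l]
    have len: "length l = Suc (Suc i)" using l by (simp add: schains_def)
    have "cobound (lift i f) l = (\<Sum>j<Suc (Suc i). (-1) ^ j * lift i f (take j l @ drop (Suc j) l))"
      by (simp only: cobound_sum len)
    also have "\<dots> = (\<Sum>j\<le>Suc i. (-1) ^ j * f (sface S E j (of_list l)))"
      unfolding lessThan_Suc_atMost
    proof (intro sum.cong refl)
      fix j assume "j \<in> {..Suc i}"
      then have j: "j \<le> Suc i" by simp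
      show "(-1) ^ j * lift i f (take j l @ drop (Suc j) l) = (-1) ^ j * f (sface S E j (of_list l))"
        using sface_list[OF o(1) j] unfolding o(2) by (simp add: lift_def)
    qed
    also have "\<dots> = 0" using assms(1)[OF o(1)] by (simp add: cobd_def)
    finally show ?thesis .
  next
    case 2
    then show ?thesis using cobound_repetition[of "lift i f"] lift_repetition by blast
  qed
qed

lemma peel_coset_pow_wchains: "l \<in> wchains m cosets \<Longrightarrow> map (peel_coset ^^ n) l \<in> wchains m cosets"
proof (induction n)
  case (Suc n)
  have "peel_coset ` cosets \<subseteq> cosets" by auto
  from cr.map_P_wchains[OF Suc.IH[OF Suc.prems] this] show ?case by (simp add: comp_def)
qed simp

lemma htpy_bound_Suc:
  "\<exists>K\<ge>0. \<forall>l F B. l \<in> wchains (Suc n) cosets \<longrightarrow> (\<forall>m\<in>wchains (Suc (Suc n)) (car (last l)). cmod (F m) \<le> B)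
     \<longrightarrow> 0 \<le> B \<longrightarrow> cmod (htpy peel_coset apex hull_apex (Suc n) l F) \<le> K * B"
  using cr.htpy_bound[of "Suc n"] by (simp only: zero_less_Suc simp_thms)

text \<open>\<open>htpy_dl\<close> for a cochain whose coboundary vanishes: the homotopy of the
  coboundary is 0, and the remaining terms are the claim.\<close>

lemma pull_step:
  assumes "\<And>\<sigma>. \<sigma> \<in> ssimp S E (Suc (Suc k)) \<Longrightarrow> cobd S E (Suc k) f \<sigma> = 0"
    and "\<sigma> \<in> ssimp S E (Suc k)"
  shows "pull (Suc k) n f \<sigma> - pull (Suc k) (Suc n) f \<sigma> = cobd S E k (htpy_pull k n f) \<sigma>"
proof -
  let ?F = "lift_pow (Suc k) n f"
  let ?l = "to_list \<sigma>"
  have l: "?l \<in> schains (Suc k)" using to_list_schains assms by blast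
  then have lw: "?l \<in> wchains (Suc (Suc k)) cosets" by (rule schains_wchains)
  have len: "length ?l = Suc (Suc k)" using l by (simp add: schains_def)
  have dF: "cobound ?F m = 0" if m: "m \<in> wchains (Suc (Suc (Suc k))) cosets" for m
  proof -
    have "cobound ?F m = cobound (lift (Suc k) f) (map (peel_coset ^^ n) m)"
      unfolding lift_pow_def[abs_def] by (rule cobound_map)
    also have "\<dots> = 0" using assms(1) by (rule lift_cocycle) (auto intro: peel_coset_pow_wchains m)
    finally show ?thesis .
  qed
  have carX: "car (last ?l) \<subseteq> cosets" by (auto simp: car_def)
  obtain K where K: "\<And>l F B. l \<in> wchains (Suc (Suc k)) cosets \<Longrightarrow>
      (\<forall>m\<in>wchains (Suc (Suc (Suc k))) (car (last l)). cmod (F m) \<le> B)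
     \<Longrightarrow> 0 \<le> B \<Longrightarrow> cmod (htpy peel_coset apex hull_apex (Suc (Suc k)) l F) \<le> K * B"
    using htpy_bound_Suc[of "Suc k"] by blast
  \<comment> \<open>The estimate with bound 0 doubles as a locality statement:
    \<open>cobound ?F\<close> vanishes on chains of cosets only, and the homotopy looks at no
    others.\<close>
  have "cmod (htpy peel_coset apex hull_apex (Suc (Suc k)) ?l (cobound ?F)) \<le> K * 0"
  proof (rule K[OF lw])
    show "\<forall>m\<in>wchains (Suc (Suc (Suc k))) (car (last ?l)). cmod (cobound ?F m) \<le> 0"
    proof
      fix m assume "m \<in> wchains (Suc (Suc (Suc k))) (car (last ?l))"
      then have "m \<in> wchains (Suc (Suc (Suc k))) cosets" using carX by (auto simp: wchains_def)
      then show "cmod (cobound ?F m) \<le> 0" using dF by simp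
    qed
  qed simp
  then have "0 = ?F ?l - ?F (map peel_coset ?l) - cobound (\<lambda>m. htpy peel_coset apex hull_apex (Suc k) m ?F) ?l"
    using htpy_dl[OF len, of peel_coset apex hull_apex ?F] by simp
  moreover have "?F (map peel_coset ?l) = lift_pow (Suc k) (Suc n) f ?l"
    by (simp add: lift_pow_def comp_def funpow_swap1)
  moreover have "cobound (\<lambda>m. htpy peel_coset apex hull_apex (Suc k) m ?F) ?l = cobd S E k (htpy_pull k n f) \<sigma>"
    unfolding cobound_sum len cobd_def lessThan_Suc_atMost
  proof (intro sum.cong refl)
    fix j assume "j \<in> {..Suc k}"
    then have j: "j \<le> Suc k" by simp
    show "(-1) ^ j * htpy peel_coset apex hull_apex (Suc k) (take j ?l @ drop (Suc j) ?l) ?F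
        = (-1) ^ j * htpy_pull k n f (sface S E j \<sigma>)"
      using sface_ssimp[OF assms(2) j] to_list_sface[OF assms(2) j] by (simp add: htpy_pull_def)
  qed
  ultimately show ?thesis using assms(2) by (simp add: pull_def)
qed

lemma pull_0: "f \<in> l2coch S E t i \<Longrightarrow> pull i 0 f = f"
proof
  fix \<sigma> assume "f \<in> l2coch S E t i"
  then show "pull i 0 f \<sigma> = f \<sigma>"
    using to_list_schains[of \<sigma> i] by (cases \<sigma>) (auto simp: pull_def lift_pow_def lift_def l2coch_def)
qed

text \<open>The decisive estimate. The shortest element of each simplex in the fibre is u v with
  additive lengths and v of length at least n. Left translation by the inverse of u is injective, so
  these elements weigh at most \<open>t ^ cox_len u\<close> times the tail.\<close>

lemma pull_fibre_sum:
  assumes \<tau>: "\<tau> \<in> ssimp S E (Suc k)" and F: "finite F"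
    "F \<subseteq> {\<sigma>\<in>ssimp S E (Suc k). to_list \<tau> = map (peel_coset ^^ n) (to_list \<sigma>)}"
    and tail: "\<And>F. finite F \<Longrightarrow> F \<subseteq> {w\<in>G. n \<le> cox_len w} \<Longrightarrow> (\<Sum>w\<in>F. t ^ cox_len w) \<le> e"
  shows "(\<Sum>\<sigma>\<in>F. t ^ sdeg \<sigma>) \<le> real (card (dchains S E (Suc k))) * e * t ^ sdeg \<tau>"
proof -
  define u where "u = minrep (fst \<tau>)"
  have u: "u \<in> G" using ssimpE[OF \<tau>] by (simp add: u_def)
  let ?m = "\<lambda>\<sigma>. minrep (fst \<sigma>)"
  have fib: "(peel ^^ n) (?m \<sigma>) = u \<and> cox_len u + n \<le> cox_len (?m \<sigma>)" if "\<sigma> \<in> F" for \<sigma>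
  proof -
    have s: "\<sigma> \<in> ssimp S E (Suc k)" "to_list \<tau> = map (peel_coset ^^ n) (to_list \<sigma>)" using that F by auto
    note l = to_list_schains[OF s(1)] and l' = to_list_schains[OF \<tau>]
    \<comment> \<open>Positive degree enters here: there are two vertices, and as their images
      differ, peeling cannot have reached the identity before step n.\<close>
    obtain C D r where r: "to_list \<sigma> = C # D # r"
      using l(1) by (auto simp: schains_def length_Suc_conv)
    then have CD: "C \<in> cosets" "D \<in> cosets" "C \<subseteq> D" "C = fst \<sigma>" using l by (auto simp: schains_def)
    have CD': "(peel_coset ^^ n) C \<noteq> (peel_coset ^^ n) D" "fst \<tau> = (peel_coset ^^ n) C" using l' s(2) r by (auto simp: schains_def)
    have p: "(peel ^^ n) (?m \<sigma>) = u" unfolding u_def CD'(2) using minrep_PC_pow CD by simp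
    have "(peel ^^ j) (minrep C) \<noteq> one" if "j < n" for j
      using peel_coset_pow_collapse[OF CD(1-3) _ that] CD'(1) by blast
    then have "cox_len ((peel ^^ n) (minrep C)) + n \<le> cox_len (minrep C)"
      using cosetsE(1)[OF CD(1)] by (intro len_pp_pow) auto
    then show ?thesis using p CD by simp
  qed
  obtain \<phi> where \<phi>: "\<phi> ` G \<subseteq> G" "inj_on \<phi> G" "\<phi> u = one" "\<And>w s. w \<in> G \<Longrightarrow> \<phi> (rmul w s) = rmul (\<phi> w) s"
    "\<And>w. w \<in> G \<Longrightarrow> cox_len w \<le> cox_len u + cox_len (\<phi> w)"
    using translate[OF u] by metis
  let ?W = "?m ` F"
  have W: "?W \<subseteq> G" "finite ?W" using F ssimpE(5) by auto
  have lenW: "cox_len w = cox_len u + cox_len (\<phi> w)" if "w \<in> ?W" for w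
    using that W fib by (auto intro!: len_translate_pp_pow[OF \<phi>(1,3,4,5)])
  have inj: "inj_on (\<lambda>\<sigma>. (?m \<sigma>, snd \<sigma>)) F"
  proof (rule inj_onI)
    fix x y assume xy: "x \<in> F" "y \<in> F" "(?m x, snd x) = (?m y, snd y)"
    then have "x \<in> ssimp S E (Suc k)" "y \<in> ssimp S E (Suc k)" using F by auto
    then have "fst x = fst y" using xy ssimpE(4) by (metis prod.inject)
    then show "x = y" using xy by (simp add: prod_eq_iff)
  qed
  have "(\<Sum>\<sigma>\<in>F. t ^ sdeg \<sigma>) = (\<Sum>\<sigma>\<in>F. t ^ cox_len (?m \<sigma>))"
    using F sdeg_ssimp by (intro sum.cong) (auto intro!: arg_cong[where f = "\<lambda>n. t ^ n"])
  also have "\<dots> = (\<Sum>(w, c)\<in>(\<lambda>\<sigma>. (?m \<sigma>, snd \<sigma>)) ` F. t ^ cox_len w)"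
    by (subst sum.reindex[OF inj]) simp
  \<comment> \<open>Simplices with a common shortest element are told apart by their types, whence
    the factor \<open>card (dchains S E (Suc k))\<close>.\<close>
  also have "\<dots> \<le> (\<Sum>(w, c)\<in>?W \<times> dchains S E (Suc k). t ^ cox_len w)"
    using F W t_pos finite_dchains ssimpE(2) by (intro sum_mono2) auto
  also have "\<dots> = card (dchains S E (Suc k)) * (\<Sum>w\<in>?W. t ^ cox_len w)"
    by (simp add: sum.cartesian_product[symmetric] sum_distrib_left)
  also have "(\<Sum>w\<in>?W. t ^ cox_len w) = (\<Sum>w\<in>?W. t ^ cox_len u * t ^ cox_len (\<phi> w))"
    by (intro sum.cong refl) (simp add: lenW power_add)
  also have "\<dots> = t ^ cox_len u * (\<Sum>w\<in>\<phi> ` ?W. t ^ cox_len w)"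
    using W by (subst sum.reindex) (auto simp: sum_distrib_left intro: inj_on_subset[OF \<phi>(2)])
  also have "(\<Sum>w\<in>\<phi> ` ?W. t ^ cox_len w) \<le> e"
  proof (rule tail)
    have "n \<le> cox_len (\<phi> w)" if "w \<in> ?W" for w
      using lenW[OF that] that fib by fastforce
    then show "\<phi> ` ?W \<subseteq> {w \<in> G. n \<le> cox_len w}" using \<phi>(1) W by blast
  qed (use W in auto)
  finally have "(\<Sum>\<sigma>\<in>F. t ^ sdeg \<sigma>) \<le> card (dchains S E (Suc k)) * (t ^ cox_len u * e)"
    using t_pos by (simp add: mult_left_mono)
  then show ?thesis using sdeg_ssimp[OF \<tau>] by (simp add: u_def mult_ac)
qed

lemma pull_l2:
  assumes f: "f \<in> l2coch S E t (Suc k)"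
    and tail: "\<And>F. finite F \<Longrightarrow> F \<subseteq> {w\<in>G. n \<le> cox_len w} \<Longrightarrow> (\<Sum>w\<in>F. t ^ cox_len w) \<le> e"
  shows "pull (Suc k) n f \<in> l2coch S E t (Suc k)"
    "nrm2 (Suc k) (pull (Suc k) n f) \<le> real (card (dchains S E (Suc k))) * e * nrm2 (Suc k) f"
proof -
  let ?A = "ssimp S E (Suc k)"
  let ?R = "\<lambda>\<sigma> \<tau>. to_list \<tau> = map (peel_coset ^^ n) (to_list \<sigma>)"
  have e: "0 \<le> e" using tail[of "{}"] by simp
  \<comment> \<open>Each simplex has at most one image, so the only sums to bound are those over the
    fibres.\<close>
  have R: "{\<tau>\<in>?A. ?R \<sigma> \<tau>} \<subseteq> {of_list (map (peel_coset ^^ n) (to_list \<sigma>))}" for \<sigma>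
    using to_list_schains(2)[where i = "Suc k"] by force
  have h: "(cmod (pull (Suc k) n f \<sigma>))\<^sup>2 \<le> (\<Sum>\<tau>\<in>{\<tau>\<in>?A. ?R \<sigma> \<tau>}. (cmod (f \<tau>))\<^sup>2)" if "\<sigma> \<in> ?A" for \<sigma>
  proof (cases "map (peel_coset ^^ n) (to_list \<sigma>) \<in> schains (Suc k)")
    case True
    let ?\<tau> = "of_list (map (peel_coset ^^ n) (to_list \<sigma>))"
    have "?\<tau> \<in> {\<tau>\<in>?A. ?R \<sigma> \<tau>}" using of_list_ssimp[OF True] by simp
    then have "{\<tau>\<in>?A. ?R \<sigma> \<tau>} = {?\<tau>}" using R[of \<sigma>] by blast
    then show ?thesis using that True by (simp add: pull_def lift_pow_def lift_def)
  next
    case False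
    then show ?thesis by (simp add: pull_def lift_pow_def lift_def sum_nonneg)
  qed
  have *: "(\<lambda>\<sigma>. (cmod (pull (Suc k) n f \<sigma>))\<^sup>2 * t ^ sdeg \<sigma>) summable_on ?A \<and>
    (\<Sum>\<^sub>\<infinity>\<sigma>\<in>?A. (cmod (pull (Suc k) n f \<sigma>))\<^sup>2 * t ^ sdeg \<sigma>)
     \<le> real (card (dchains S E (Suc k))) * e * (\<Sum>\<^sub>\<infinity>\<tau>\<in>?A. (cmod (f \<tau>))\<^sup>2 * t ^ sdeg \<tau>)"
  proof (rule schur_bound[where R = ?R])
    show "0 \<le> (cmod (pull (Suc k) n f \<sigma>))\<^sup>2 \<and>
        (cmod (pull (Suc k) n f \<sigma>))\<^sup>2 \<le> (\<Sum>\<tau>\<in>{\<tau>\<in>?A. ?R \<sigma> \<tau>}. (cmod (f \<tau>))\<^sup>2)" if "\<sigma> \<in> ?A" for \<sigma>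
      using h[OF that] by simp
    show "finite {\<tau>\<in>?A. ?R \<sigma> \<tau>}" for \<sigma>
      by (rule finite_subset[OF R]) simp
    show "(\<Sum>\<sigma>\<in>F. t ^ sdeg \<sigma>) \<le> real (card (dchains S E (Suc k))) * e * t ^ sdeg \<tau>"
      if "\<tau> \<in> ?A" "finite F" "F \<subseteq> {\<sigma> \<in> ?A. ?R \<sigma> \<tau>}" for \<tau> F
      by (rule pull_fibre_sum[OF that tail])
    show "(\<lambda>\<tau>. (cmod (f \<tau>))\<^sup>2 * t ^ sdeg \<tau>) summable_on ?A" using f by (simp add: l2coch_def)
  qed (use e t_pos in simp_all)
  then show "nrm2 (Suc k) (pull (Suc k) n f) \<le> real (card (dchains S E (Suc k))) * e * nrm2 (Suc k) f"
    by (simp add: nrm2_def)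
  show "pull (Suc k) n f \<in> l2coch S E t (Suc k)" using * by (simp add: l2coch_def pull_def)
qed

text \<open>Boundedness for every n, with the full growth series in place of a tail.\<close>

lemma pull_l2_any: "f \<in> l2coch S E t (Suc k) \<Longrightarrow> pull (Suc k) n f \<in> l2coch S E t (Suc k)"
proof (rule pull_l2(1))
  fix F :: "'a list set set" assume "finite F" "F \<subseteq> {w\<in>G. n \<le> cox_len w}"
  then show "(\<Sum>w\<in>F. t ^ cox_len w) \<le> infsum (\<lambda>w. t ^ cox_len w) G"
    using t_pos by (intro finite_sum_le_infsum growth_summable) auto
qed

text \<open>Both shortest elements are reached from that of the largest vertex C of
  \<open>\<eta>\<close> by one clique each. Going back along one and out along the other explains
  the two cliques in \<open>near\<close>.\<close>

lemma car_near:
  assumes "\<eta> \<in> ssimp S E k" "\<tau> \<in> ssimp S E i" "to_list \<tau> \<in> wchains m (car (last (to_list \<eta>)))"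
  shows "near \<tau> \<eta>"
proof -
  note e = to_list_schains[OF assms(1)] and ta = to_list_schains[OF assms(2)]
  define C where "C = last (to_list \<eta>)"
  have ne: "to_list \<eta> \<noteq> []" "to_list \<tau> \<noteq> []" using e ta by (auto simp: schains_def)
  then have C: "C \<in> cosets" using e by (auto simp: schains_def C_def)
  have "fst \<tau> \<in> set (to_list \<tau>)" using ta(3) ne(2) hd_in_set by metis
  then have "fst \<tau> \<in> car C" using assms(3) by (auto simp: wchains_def C_def)
  then obtain V where V: "clique V" "fst \<tau> \<subseteq> cst (minrep C) V" using carE[OF C] by metis
  then have "minrep (fst \<tau>) \<in> cst (minrep C) V" using minrep_in ssimpE(1)[OF assms(2)] by blast
  then obtain U where U: "U \<subseteq> V" "minrep (fst \<tau>) = mulset (minrep C) U" using cst_eq[OF cosetsE(1)[OF C] V(1)] by auto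
  have "fst \<eta> \<subseteq> C"
  proof -
    have "sorted_wrt (<) (to_list \<eta>)" using e by (simp add: schains_def)
    then have "hd (to_list \<eta>) \<le> last (to_list \<eta>)" using ne(1)
      by (cases "to_list \<eta>") (auto simp: less_imp_le)
    then show ?thesis using e(3) by (simp add: C_def)
  qed
  then have "minrep (fst \<eta>) \<in> C" using minrep_in ssimpE(1)[OF assms(1)] by blast
  then obtain U' where U': "U' \<subseteq> ctype C" "minrep (fst \<eta>) = mulset (minrep C) U'" using cosets_memE[OF C] by blast
  have c: "clique U" "clique U'" using U V U' cosetsE(2)[OF C] clique_subset by blast+
  then have "minrep C = mulset (minrep (fst \<eta>)) U'" using U' by simp
  then show ?thesis using U c unfolding near_def by metis
qed

text \<open>On the carrier of \<open>\<eta>\<close> the supremum is at most the square root of a sum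
  of squares over the finitely many simplices near \<open>\<eta>\<close>; locality of the homotopy
  then leaves a Schur estimate.\<close>

lemma htpy_pull_l2:
  assumes "f \<in> l2coch S E t (Suc k)"
  shows "htpy_pull k n f \<in> l2coch S E t k"
proof -
  let ?A = "ssimp S E k" and ?B = "ssimp S E (Suc k)"
  let ?f = "pull (Suc k) n f"
  have f: "?f \<in> l2coch S E t (Suc k)" by (rule pull_l2_any[OF assms])
  obtain K where K0: "0 \<le> K" and K: "\<And>l F B. l \<in> wchains (Suc k) cosets \<Longrightarrow>
      (\<forall>m\<in>wchains (Suc (Suc k)) (car (last l)). cmod (F m) \<le> B)
     \<Longrightarrow> 0 \<le> B \<Longrightarrow> cmod (htpy peel_coset apex hull_apex (Suc k) l F) \<le> K * B"
    using htpy_bound_Suc[of k] by blast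
  let ?R = "\<lambda>\<eta> \<tau>. near \<tau> \<eta>"
  have h: "(cmod (htpy_pull k n f \<eta>))\<^sup>2 \<le> (\<Sum>\<tau>\<in>{\<tau>\<in>?B. ?R \<eta> \<tau>}. K\<^sup>2 * (cmod (?f \<tau>))\<^sup>2)" if \<eta>: "\<eta> \<in> ?A" for \<eta>
  proof -
    let ?s = "\<Sum>\<tau>\<in>{\<tau>\<in>?B. ?R \<eta> \<tau>}. (cmod (?f \<tau>))\<^sup>2"
    have "cmod (htpy peel_coset apex hull_apex (Suc k) (to_list \<eta>) (lift_pow (Suc k) n f)) \<le> K * sqrt ?s"
    proof (rule K)
      show "to_list \<eta> \<in> wchains (Suc k) cosets" using to_list_schains(1)[OF \<eta>] schains_wchains by blast
      show "0 \<le> sqrt ?s" by (simp add: sum_nonneg)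
      show "\<forall>m\<in>wchains (Suc (Suc k)) (car (last (to_list \<eta>))). cmod (lift_pow (Suc k) n f m) \<le> sqrt ?s"
      proof
        fix m assume m: "m \<in> wchains (Suc (Suc k)) (car (last (to_list \<eta>)))"
        show "cmod (lift_pow (Suc k) n f m) \<le> sqrt ?s"
        proof (cases "sorted_wrt (<) m")
          case True
          have "car (last (to_list \<eta>)) \<subseteq> cosets" by (auto simp: car_def)
          then have ms: "m \<in> schains (Suc k)" using m True by (auto simp: schains_def wchains_def)
          note o = of_list_ssimp[OF ms]
          have "near (of_list m) \<eta>" using car_near[OF \<eta> o(1)] m o(2) by metis
          then have "(cmod (?f (of_list m)))\<^sup>2 \<le> ?s"
            using o(1) near_finite(1) by (intro member_le_sum) auto
          then show ?thesis using o real_le_rsqrt by (auto simp: pull_def)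
        next
          case False
          moreover have "sorted_wrt (\<le>) m" using m by (simp add: wchains_def)
          ultimately obtain a x b where "m = a @ [x, x] @ b" using sorted_repetition[of m] by blast
          then have "lift_pow (Suc k) n f m = 0" using lift_repetition by (simp add: lift_pow_def)
          then show ?thesis by (simp add: sum_nonneg)
        qed
      qed
    qed
    then have "(cmod (htpy_pull k n f \<eta>))\<^sup>2 \<le> (K * sqrt ?s)\<^sup>2" using \<eta> by (intro power_mono) (auto simp: htpy_pull_def)
    also have "\<dots> = K\<^sup>2 * ?s" by (simp add: power_mult_distrib sum_nonneg)
    finally show ?thesis by (simp add: sum_distrib_left)
  qed
  have "(\<lambda>\<eta>. (cmod (htpy_pull k n f \<eta>))\<^sup>2 * t ^ sdeg \<eta>) summable_on ?A"
  proof (rule schur_bound[where R = ?R and \<phi> = "\<lambda>\<tau>. K\<^sup>2 * (cmod (?f \<tau>))\<^sup>2" and B = ?B and b = "\<lambda>\<tau>. t ^ sdeg \<tau>"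
        and K = "card (cliques \<times> cliques \<times> dchains S E k) * max t (1 / t) ^ (2 * card S)", THEN conjunct1])
    show "\<And>\<eta>. finite {\<tau>\<in>?B. near \<tau> \<eta>}" by (rule near_finite)
    show "sum (\<lambda>\<eta>. t ^ sdeg \<eta>) F \<le> card (cliques \<times> cliques \<times> dchains S E k) * max t (1 / t) ^ (2 * card S) * t ^ sdeg \<tau>"
      if "\<tau> \<in> ?B" "finite F" "F \<subseteq> {\<eta>\<in>?A. near \<tau> \<eta>}" for \<tau> F
      using that near_sym by (intro near_sum[OF t_pos that(1,2)]) blast
    show "(\<lambda>\<tau>. K\<^sup>2 * (cmod (?f \<tau>))\<^sup>2 * t ^ sdeg \<tau>) summable_on ?B"
      using f summable_on_cmult_right[of "\<lambda>\<tau>. (cmod (?f \<tau>))\<^sup>2 * t ^ sdeg \<tau>" ?B "K\<^sup>2"]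
      by (simp add: l2coch_def mult_ac)
    show "0 \<le> (cmod (htpy_pull k n f \<eta>))\<^sup>2 \<and>
      (cmod (htpy_pull k n f \<eta>))\<^sup>2 \<le> (\<Sum>\<tau>\<in>{\<tau>\<in>?B. ?R \<eta> \<tau>}. K\<^sup>2 * (cmod (?f \<tau>))\<^sup>2)" if "\<eta> \<in> ?A" for \<eta>
      using h[OF that] by simp
  qed (use t_pos in simp_all)
  then show ?thesis by (simp add: l2coch_def htpy_pull_def)
qed

subsection \<open>Harmonic cochains of positive degree\<close>

text \<open>The pairing of the coboundary of g with f equals that of g with the adjoint of f, which
  is 0. The work is the absolute summability over pairs of a simplex and a face index that justifies
  the exchange of sums.\<close>

lemma adjoint_has_sum:
  assumes f: "f \<in> l2coch S E t (Suc k)" and g: "g \<in> l2coch S E t k"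
    and bd: "\<And>\<eta>. \<eta> \<in> ssimp S E k \<Longrightarrow> bdt S E t k f \<eta> = 0"
  shows "((\<lambda>\<sigma>. cobd S E k g \<sigma> * cnj (f \<sigma>) * complex_of_real (t ^ sdeg \<sigma>)) has_sum 0) (ssimp S E (Suc k))"
proof -
  let ?A = "ssimp S E (Suc k)" and ?B = "ssimp S E k"
  define Q where "Q = ?A \<times> {..Suc k}"
  define fc where "fc = (\<lambda>(\<sigma>, j). sface S E j \<sigma>)"
  define \<psi> where "\<psi> = (\<lambda>(\<sigma>, j). (-1) ^ j * g (sface S E j \<sigma>) * cnj (f \<sigma>) * complex_of_real (t ^ sdeg \<sigma>))"
  let ?K = "card (cliques \<times> cliques \<times> dchains S E (Suc k)) * max t (1 / t) ^ (2 * card S)"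
  have fcB: "fc q \<in> ?B" if "q \<in> Q" for q using that sface_ssimp by (auto simp: Q_def fc_def)
  have fib: "finite F \<Longrightarrow> F \<subseteq> {q\<in>Q. fc q = \<eta>} \<Longrightarrow> F \<subseteq> {\<sigma>\<in>?A. near \<sigma> \<eta>} \<times> {..Suc k}" for F \<eta>
    using near_sface by (auto simp: Q_def fc_def)
  \<comment> \<open>A face has boundedly many simplices near it, and each contributes at most its
    \<open>k + 2\<close> faces.\<close>
  have s1: "(\<lambda>q. (cmod (g (fc q)))\<^sup>2 * t ^ sdeg (fst q)) summable_on Q"
  proof (rule schur_bound[where R = "\<lambda>q \<eta>. fc q = \<eta>" and \<phi> = "\<lambda>\<eta>. (cmod (g \<eta>))\<^sup>2" and B = ?B and b = "\<lambda>\<eta>. t ^ sdeg \<eta>"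
        and K = "?K * real (k + 2)", THEN conjunct1])
    fix q assume q: "q \<in> Q"
    have eq: "{j \<in> ?B. fc q = j} = {fc q}" using fcB[OF q] by auto
    show "finite {j \<in> ?B. fc q = j}" by (simp add: eq)
    show "0 \<le> (cmod (g (fc q)))\<^sup>2 \<and> (cmod (g (fc q)))\<^sup>2 \<le> (\<Sum>\<eta>\<in>{j \<in> ?B. fc q = j}. (cmod (g \<eta>))\<^sup>2)"
      by (simp add: eq)
  next
    fix \<eta> F assume \<eta>: "\<eta> \<in> ?B" and F: "finite F" "F \<subseteq> {q\<in>Q. fc q = \<eta>}"
    have sub: "F \<subseteq> fst ` F \<times> {..Suc k}" "fst ` F \<subseteq> {\<sigma>\<in>?A. near \<sigma> \<eta>}" using fib[OF F] by force+
    have "(\<Sum>q\<in>F. t ^ sdeg (fst q)) \<le> (\<Sum>q\<in>fst ` F \<times> {..Suc k}. t ^ sdeg (fst q))"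
      using F sub t_pos by (intro sum_mono2) auto
    also have "\<dots> = (\<Sum>\<sigma>\<in>fst ` F. \<Sum>j\<in>{..Suc k}. t ^ sdeg \<sigma>)"
      unfolding sum.cartesian_product by (simp add: case_prod_beta)
    also have "\<dots> = (\<Sum>\<sigma>\<in>fst ` F. t ^ sdeg \<sigma>) * real (k + 2)"
      by (simp add: sum_distrib_left mult.commute)
    also have "\<dots> \<le> (?K * t ^ sdeg \<eta>) * real (k + 2)"
      using F by (intro mult_right_mono near_sum[OF t_pos \<eta> _ sub(2)]) auto
    finally show "(\<Sum>q\<in>F. t ^ sdeg (fst q)) \<le> ?K * real (k + 2) * t ^ sdeg \<eta>" by (simp only: mult_ac)
  next
    show "(\<lambda>\<eta>. (cmod (g \<eta>))\<^sup>2 * t ^ sdeg \<eta>) summable_on ?B" using g by (simp add: l2coch_def)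
  qed (use t_pos in simp_all)
  have s2: "(\<lambda>q. (cmod (f (fst q)))\<^sup>2 * t ^ sdeg (fst q)) summable_on Q"
  proof (rule schur_bound[where R = "\<lambda>q \<tau>. fst q = \<tau>" and \<phi> = "\<lambda>\<eta>. (cmod (f \<eta>))\<^sup>2" and B = ?A and b = "\<lambda>\<eta>. t ^ sdeg \<eta>"
        and K = "real (k + 2)", THEN conjunct1])
    fix q assume q: "q \<in> Q"
    have eq: "{j \<in> ?A. fst q = j} = {fst q}" using q by (auto simp: Q_def)
    show "finite {j \<in> ?A. fst q = j}" by (simp add: eq)
    show "0 \<le> (cmod (f (fst q)))\<^sup>2 \<and> (cmod (f (fst q)))\<^sup>2 \<le> (\<Sum>\<eta>\<in>{j \<in> ?A. fst q = j}. (cmod (f \<eta>))\<^sup>2)"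
      by (simp add: eq)
  next
    fix \<tau> F assume \<tau>: "\<tau> \<in> ?A" and F: "finite F" "F \<subseteq> {q\<in>Q. fst q = \<tau>}"
    have sub: "F \<subseteq> {\<tau>} \<times> {..Suc k}" using F by (auto simp: Q_def)
    have "(\<Sum>q\<in>F. t ^ sdeg (fst q)) \<le> (\<Sum>q\<in>{\<tau>} \<times> {..Suc k}. t ^ sdeg (fst q))"
      using F sub t_pos by (intro sum_mono2) auto
    also have "\<dots> = (\<Sum>\<sigma>\<in>{\<tau>}. \<Sum>j\<in>{..Suc k}. t ^ sdeg \<sigma>)"
      unfolding sum.cartesian_product by (simp add: case_prod_beta)
    finally show "(\<Sum>q\<in>F. t ^ sdeg (fst q)) \<le> real (k + 2) * t ^ sdeg \<tau>" by simp
  next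
    show "(\<lambda>\<eta>. (cmod (f \<eta>))\<^sup>2 * t ^ sdeg \<eta>) summable_on ?A" using f by (simp add: l2coch_def)
  qed (use t_pos in simp_all)
  have "(\<lambda>q. norm (\<psi> q)) summable_on Q"
  proof (rule Infinite_Sum.abs_summable_on_comparison_test'[OF summable_on_add[OF s1 s2]])
    fix q assume "q \<in> Q"
    have ab: "a * b \<le> a\<^sup>2 + b\<^sup>2" if "0 \<le> a" "0 \<le> b" for a b :: real
      using sum_squares_bound[of a b] mult_nonneg_nonneg[OF that] by linarith
    have "norm (\<psi> q) = cmod (g (fc q)) * cmod (f (fst q)) * t ^ sdeg (fst q)"
      using t_pos by (simp add: \<psi>_def fc_def case_prod_beta norm_mult norm_power)
    also have "\<dots> \<le> ((cmod (g (fc q)))\<^sup>2 + (cmod (f (fst q)))\<^sup>2) * t ^ sdeg (fst q)"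
      using t_pos by (intro mult_right_mono ab) auto
    finally show "norm (\<psi> q) \<le> (cmod (g (fc q)))\<^sup>2 * t ^ sdeg (fst q) + (cmod (f (fst q)))\<^sup>2 * t ^ sdeg (fst q)"
      by (simp add: distrib_right)
  qed
  then have sQ: "\<psi> summable_on Q" by (rule abs_summable_summable)
  have row: "infsum (\<lambda>j. \<psi> (\<sigma>, j)) {..Suc k} = cobd S E k g \<sigma> * cnj (f \<sigma>) * complex_of_real (t ^ sdeg \<sigma>)" for \<sigma>
    by (simp add: \<psi>_def cobd_def sum_distrib_right del: sum.atMost_Suc)
  have sQ': "(\<lambda>(\<sigma>, j). \<psi> (\<sigma>, j)) summable_on Sigma ?A (\<lambda>_. {..Suc k})" using sQ by (simp add: Q_def)
  have 1: "(\<lambda>\<sigma>. infsum (\<lambda>j. \<psi> (\<sigma>, j)) {..Suc k}) summable_on ?A"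
    by (rule summable_on_Sigma_banach[OF sQ'])
  have 2: "infsum (\<lambda>\<sigma>. infsum (\<lambda>j. \<psi> (\<sigma>, j)) {..Suc k}) ?A = infsum \<psi> Q"
    using infsum_Sigma'_banach[OF sQ'] by (simp add: Q_def)
  \<comment> \<open>The same pairs regrouped by their face instead of by their simplex.\<close>
  let ?Z = "Sigma ?B (\<lambda>\<eta>. {q\<in>Q. fc q = \<eta>})"
  have bij: "bij_betw snd ?Z Q"
    by (rule bij_betwI[where g = "\<lambda>q. (fc q, q)"]) (use fcB in auto)
  have zf: "(\<lambda>(\<eta> :: 'a dsimplex, q). \<psi> q) = (\<lambda>z. \<psi> (snd z))" by (simp add: fun_eq_iff)
  have sZ: "(\<lambda>(\<eta>, q). \<psi> q) summable_on ?Z"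
    unfolding zf using summable_on_reindex_bij_betw[OF bij, of \<psi>] sQ by blast
  have "infsum \<psi> Q = infsum (\<lambda>(\<eta>, q). \<psi> q) ?Z"
    unfolding zf by (rule infsum_reindex_bij_betw[OF bij, of \<psi>, symmetric])
  also have "\<dots> = infsum (\<lambda>\<eta>. infsum \<psi> {q\<in>Q. fc q = \<eta>}) ?B"
    using infsum_Sigma'_banach[OF sZ] by simp
  also have "\<dots> = 0"
  proof (rule infsum_0)
    fix \<eta> assume \<eta>: "\<eta> \<in> ?B"
    have eq: "{q\<in>Q. fc q = \<eta>} = {(\<sigma>, j). \<sigma> \<in> ?A \<and> j \<le> Suc k \<and> sface S E j \<sigma> = \<eta>}" (is "?X = ?Y")
      by (auto simp: Q_def fc_def)
    have "?X \<subseteq> {\<sigma>\<in>?A. near \<sigma> \<eta>} \<times> {..Suc k}"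
      using near_sface by (auto simp: Q_def fc_def)
    moreover have "finite ({\<sigma>\<in>?A. near \<sigma> \<eta>} \<times> {..Suc k})"
      by (intro finite_SigmaI near_finite(1) finite_atMost)
    ultimately have "finite ?X" by (rule finite_subset)
    then have fin: "finite ?Y" by (simp only: eq)
    have "infsum \<psi> ?X = sum \<psi> ?Y" using fin by (simp add: eq)
    also have "\<dots> = (\<Sum>(\<sigma>, j)\<in>?Y. g \<eta> * complex_of_real (t ^ sdeg \<eta>) * cnj ((-1) ^ j * complex_of_real (t ^ sdeg \<sigma> / t ^ sdeg \<eta>) * f \<sigma>))"
      using t_pos by (intro sum.cong refl) (auto simp: \<psi>_def)
    also have "\<dots> = g \<eta> * complex_of_real (t ^ sdeg \<eta>) * cnj (bdt S E t k f \<eta>)"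
      unfolding bdt_def by (simp add: sum_distrib_left case_prod_beta)
    also have "\<dots> = 0" using bd[OF \<eta>] by simp
    finally show "infsum \<psi> {q\<in>Q. fc q = \<eta>} = 0" .
  qed
  finally have "infsum (\<lambda>\<sigma>. infsum (\<lambda>j. \<psi> (\<sigma>, j)) {..Suc k}) ?A = 0" using 2 by simp
  then have "((\<lambda>\<sigma>. infsum (\<lambda>j. \<psi> (\<sigma>, j)) {..Suc k}) has_sum 0) ?A"
    using 1 has_sum_infsum by fastforce
  then show ?thesis by (simp only: row)
qed

text \<open>The inequality between arithmetic and geometric means, in place of
  Cauchy-Schwarz.\<close>

lemma l2_pairing:
  assumes "a \<in> l2coch S E t i" "f \<in> l2coch S E t i"
  shows "(\<lambda>\<sigma>. a \<sigma> * cnj (f \<sigma>) * complex_of_real (t ^ sdeg \<sigma>)) summable_on ssimp S E i"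
    "cmod (\<Sum>\<^sub>\<infinity>\<sigma>\<in>ssimp S E i. a \<sigma> * cnj (f \<sigma>) * complex_of_real (t ^ sdeg \<sigma>)) \<le> (nrm2 i a + nrm2 i f) / 2"
proof -
  let ?A = "ssimp S E i"
  let ?p = "\<lambda>\<sigma>. a \<sigma> * cnj (f \<sigma>) * complex_of_real (t ^ sdeg \<sigma>)"
  let ?q = "\<lambda>\<sigma>. ((cmod (a \<sigma>))\<^sup>2 * t ^ sdeg \<sigma> + (cmod (f \<sigma>))\<^sup>2 * t ^ sdeg \<sigma>) * (1 / 2)"
  have sa: "(\<lambda>\<sigma>. (cmod (a \<sigma>))\<^sup>2 * t ^ sdeg \<sigma>) summable_on ?A" and sf: "(\<lambda>\<sigma>. (cmod (f \<sigma>))\<^sup>2 * t ^ sdeg \<sigma>) summable_on ?A"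
    using assms by (auto simp: l2coch_def)
  have q: "?q summable_on ?A" by (intro summable_on_cmult_left summable_on_add sa sf)
  have le: "norm (?p \<sigma>) \<le> ?q \<sigma>" for \<sigma>
  proof -
    have "norm (?p \<sigma>) = cmod (a \<sigma>) * cmod (f \<sigma>) * t ^ sdeg \<sigma>" using t_pos by (simp add: norm_mult norm_power)
    also have "\<dots> \<le> (((cmod (a \<sigma>))\<^sup>2 + (cmod (f \<sigma>))\<^sup>2) / 2) * t ^ sdeg \<sigma>"
      using sum_squares_bound[of "cmod (a \<sigma>)" "cmod (f \<sigma>)"] t_pos by (intro mult_right_mono) auto
    finally show ?thesis by (simp add: algebra_simps)
  qed
  have ab: "(\<lambda>\<sigma>. norm (?p \<sigma>)) summable_on ?A" by (rule Infinite_Sum.abs_summable_on_comparison_test'[OF q le])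
  then show "?p summable_on ?A" by (rule abs_summable_summable)
  have "cmod (infsum ?p ?A) \<le> infsum (\<lambda>\<sigma>. norm (?p \<sigma>)) ?A" by (rule norm_infsum_bound[OF ab])
  also have "\<dots> \<le> infsum ?q ?A" by (rule infsum_mono[OF ab q le])
  also have "\<dots> = (nrm2 i a + nrm2 i f) * (1 / 2)"
    unfolding nrm2_def by (simp only: infsum_cmult_left' infsum_add[OF sa sf])
  finally show "cmod (infsum ?p ?A) \<le> (nrm2 i a + nrm2 i f) / 2" by simp
qed

lemma harmonic_pos_zero:
  assumes "f \<in> harmonic S E t (Suc k)"
  shows "f = (\<lambda>_. 0)"
proof -
  let ?A = "ssimp S E (Suc k)"
  have f: "f \<in> l2coch S E t (Suc k)" and co: "\<And>\<sigma>. \<sigma> \<in> ssimp S E (Suc (Suc k)) \<Longrightarrow> cobd S E (Suc k) f \<sigma> = 0"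
    and bd: "\<And>\<eta>. \<eta> \<in> ssimp S E k \<Longrightarrow> bdt S E t k f \<eta> = 0"
    using assms by (auto simp: harmonic_def)
  let ?p = "\<lambda>a \<sigma>. a \<sigma> * cnj (f \<sigma>) * complex_of_real (t ^ sdeg \<sigma>)"
  define I where "I = (\<lambda>a. infsum (?p a) ?A)"
  have step: "I (pull (Suc k) n f) = I (pull (Suc k) (Suc n) f)" for n
  proof -
    have sum: "((\<lambda>\<sigma>. ?p (pull (Suc k) (Suc n) f) \<sigma> + ?p (cobd S E k (htpy_pull k n f)) \<sigma>) has_sum
        (I (pull (Suc k) (Suc n) f) + 0)) ?A"
      unfolding I_def
      by (intro has_sum_add has_sum_infsum l2_pairing(1) pull_l2_any f adjoint_has_sum htpy_pull_l2 bd)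
    have eq: "?p (pull (Suc k) (Suc n) f) \<sigma> + ?p (cobd S E k (htpy_pull k n f)) \<sigma> = ?p (pull (Suc k) n f) \<sigma>"
      if "\<sigma> \<in> ?A" for \<sigma>
      using pull_step[OF co that, of n] by (simp add: algebra_simps flip: pull_step[OF co that, of n])
    have "(?p (pull (Suc k) n f) has_sum (I (pull (Suc k) (Suc n) f) + 0)) ?A"
      by (rule has_sum_cong[THEN iffD1, OF _ sum]) (rule eq)
    then show ?thesis unfolding I_def by (simp add: infsumI)
  qed
  have If: "I (pull (Suc k) n f) = I f" for n
    by (induction n) (simp_all add: pull_0[OF f] flip: step)
  define N where "N = nrm2 (Suc k) f"
  have sf: "(\<lambda>\<sigma>. (cmod (f \<sigma>))\<^sup>2 * t ^ sdeg \<sigma>) summable_on ?A" using f by (simp add: l2coch_def)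
  have N0: "0 \<le> N" unfolding N_def nrm2_def using t_pos by (intro infsum_nonneg) auto
  have pf: "?p f = (\<lambda>\<sigma>. complex_of_real ((cmod (f \<sigma>))\<^sup>2 * t ^ sdeg \<sigma>))"
    by (simp add: complex_norm_square[symmetric])
  have IN: "I f = complex_of_real N"
    unfolding I_def N_def nrm2_def pf by (rule infsumI[OF has_sum_of_real[OF has_sum_infsum[OF sf]]])
  define M where "M = real (card (dchains S E (Suc k)))"
  \<comment> \<open>This tail bound makes the squared norm of the pullback at most N / 2; the
    summand 1 keeps the denominator positive if M is 0.\<close>
  obtain n where n: "\<And>F. finite F \<Longrightarrow> F \<subseteq> {w\<in>G. n \<le> cox_len w} \<Longrightarrow> (\<Sum>w\<in>F. t ^ cox_len w) \<le> 1 / (2 * (M + 1))"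
    by (rule growth_tail[of "1 / (2 * (M + 1))"]) (auto simp: M_def)
  have "nrm2 (Suc k) (pull (Suc k) n f) \<le> M * (1 / (2 * (M + 1))) * N"
    unfolding M_def N_def using pull_l2(2)[OF f n] by (simp add: M_def)
  also have "\<dots> \<le> (1 / 2) * N"
    by (intro mult_right_mono N0) (auto simp: M_def field_simps)
  finally have small: "nrm2 (Suc k) (pull (Suc k) n f) \<le> N / 2" by simp
  have "N = cmod (I (pull (Suc k) n f))" using If IN N0 by simp
  also have "\<dots> \<le> (nrm2 (Suc k) (pull (Suc k) n f) + N) / 2"
    unfolding I_def N_def by (rule l2_pairing(2)[OF pull_l2_any[OF f] f])
  \<comment> \<open>The mean of N / 2 and N is 3 N / 4, which cannot dominate a positive N.\<close>
  finally have "N \<le> 0" using small by simp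
  then have "(cmod (f \<sigma>))\<^sup>2 * t ^ sdeg \<sigma> = 0" if "\<sigma> \<in> ?A" for \<sigma>
    using nonneg_infsum_le_0D[OF _ sf _ that] t_pos unfolding N_def nrm2_def by auto
  then have "f \<sigma> = 0" if "\<sigma> \<in> ?A" for \<sigma> using that t_pos by simp
  then show ?thesis using f by (auto simp: l2coch_def fun_eq_iff)
qed

lemma wbetti_pos:
  assumes "0 < i" shows "wbetti S E t i = 0"
proof -
  obtain k where i: "i = Suc k" using assms gr0_implies_Suc by blast
  have zero: "(\<lambda>_. 0) \<in> harmonic S E t i"
    by (auto simp: harmonic_def l2coch_def cobd_def bdt_def case_prod_beta)
  have H: "harmonic S E t i = {\<lambda>_. 0}"
  proof (intro equalityI subsetI)
    fix f assume "f \<in> harmonic S E t i"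
    then have "f = (\<lambda>_. 0)" unfolding i by (rule harmonic_pos_zero)
    then show "f \<in> {\<lambda>_. 0}" by (simp only: singleton_iff)
  next
    fix f :: "'a dsimplex \<Rightarrow> complex" assume "f \<in> {\<lambda>_. 0}"
    then show "f \<in> harmonic S E t i" using zero by (simp only: singleton_iff)
  qed
  have V: "embed S E t i ` harmonic S E t i = {\<lambda>_. 0}"
    unfolding H by (simp add: embed_def fun_eq_iff)
  have "orth_proj S E t i {\<lambda>_. 0} x = (\<lambda>_. 0)" for x
    unfolding orth_proj_def inner_t_def by (rule the_equality) (auto simp: case_prod_beta)
  then show ?thesis unfolding wbetti_def V by simp
qed

subsection \<open>Degree zero\<close>

lemma ssimp_sum_le:
  assumes "w \<in> G" "finite F" "F \<subseteq> {\<sigma>\<in>ssimp S E i. minrep (fst \<sigma>) = w}"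
  shows "(\<Sum>\<sigma>\<in>F. t ^ sdeg \<sigma>) \<le> real (card (dchains S E i)) * t ^ cox_len w"
proof -
  have "inj_on snd F"
  proof (rule inj_onI)
    fix x y assume xy: "x \<in> F" "y \<in> F" "snd x = snd y"
    then have "x \<in> ssimp S E i" "y \<in> ssimp S E i" "minrep (fst x) = w" "minrep (fst y) = w" using assms(3) by auto
    then have "fst x = fst y" using xy ssimpE(4) by metis
    then show "x = y" using xy by (simp add: prod_eq_iff)
  qed
  moreover have "snd ` F \<subseteq> dchains S E i" using assms(3) ssimpE(2) by auto
  ultimately have c: "card F \<le> card (dchains S E i)"
    using card_inj_on_le finite_dchains by blast
  have "(\<Sum>\<sigma>\<in>F. t ^ sdeg \<sigma>) = (\<Sum>\<sigma>\<in>F. t ^ cox_len w)"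
    using assms(3) sdeg_ssimp by (intro sum.cong refl) fastforce
  also have "\<dots> = real (card F) * t ^ cox_len w" by simp
  also have "\<dots> \<le> real (card (dchains S E i)) * t ^ cox_len w"
    using c t_pos by (intro mult_right_mono) auto
  finally show ?thesis .
qed

text \<open>Grouping simplices by their shortest element compares the sum with the growth series;
  here t below the radius makes constants square summable.\<close>

lemma const_l2: "(\<lambda>\<sigma>. if \<sigma> \<in> ssimp S E i then z else 0) \<in> l2coch S E t i"
proof -
  have "(\<lambda>\<sigma>. (cmod z)\<^sup>2 * t ^ sdeg \<sigma>) summable_on ssimp S E i"
  proof (rule schur_bound[where R = "\<lambda>\<sigma> w. minrep (fst \<sigma>) = w" and \<phi> = "\<lambda>_. (cmod z)\<^sup>2" and B = G
        and b = "\<lambda>w. t ^ cox_len w" and K = "real (card (dchains S E i))", THEN conjunct1])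
    fix \<sigma> assume s: "\<sigma> \<in> ssimp S E i"
    have eq: "{w \<in> G. minrep (fst \<sigma>) = w} = {minrep (fst \<sigma>)}" using ssimpE(5)[OF s] by auto
    show "finite {w \<in> G. minrep (fst \<sigma>) = w}" by (simp add: eq)
    show "0 \<le> (cmod z)\<^sup>2 \<and> (cmod z)\<^sup>2 \<le> (\<Sum>w\<in>{w \<in> G. minrep (fst \<sigma>) = w}. (cmod z)\<^sup>2)"
      by (simp add: eq)
  next
    show "(\<lambda>w. (cmod z)\<^sup>2 * t ^ cox_len w) summable_on G"
      by (intro summable_on_cmult_right growth_summable)
    show "(\<Sum>\<sigma>\<in>F. t ^ sdeg \<sigma>) \<le> real (card (dchains S E i)) * t ^ cox_len w"
      if "w \<in> G" "finite F" "F \<subseteq> {\<sigma>\<in>ssimp S E i. minrep (fst \<sigma>) = w}" for w F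
      using that by (rule ssimp_sum_le)
  qed (use t_pos in simp_all)
  also have "(\<lambda>\<sigma>. (cmod z)\<^sup>2 * t ^ sdeg \<sigma>) summable_on ssimp S E i \<longleftrightarrow>
      (\<lambda>\<sigma>. (cmod (if \<sigma> \<in> ssimp S E i then z else 0))\<^sup>2 * t ^ sdeg \<sigma>) summable_on ssimp S E i"
    by (intro summable_on_cong) simp
  finally show ?thesis by (simp add: l2coch_def)
qed

text \<open>A 0-cocycle takes equal values on nested cosets. The vertices w and
  \<open>rmul w s\<close> lie in the common coset of type \<open>{s}\<close>, so moving along a word
  makes the value constant.\<close>

lemma harmonic_0: "harmonic S E t 0 = range (\<lambda>z \<sigma>. if \<sigma> \<in> ssimp S E 0 then z else 0)"
proof (intro equalityI subsetI)
  fix f assume "f \<in> harmonic S E t 0"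
  then have f: "f \<in> l2coch S E t 0" and co: "\<And>\<sigma>. \<sigma> \<in> ssimp S E (Suc 0) \<Longrightarrow> cobd S E 0 f \<sigma> = 0"
    by (auto simp: harmonic_def)
  define v where "v = (\<lambda>C. lift 0 f [C])"
  have v: "v C = v D" if "C \<in> cosets" "D \<in> cosets" "C \<subseteq> D" for C D
  proof -
    have "[C, D] \<in> wchains (Suc (Suc 0)) cosets" using that by (simp add: wchains_def)
    then have "cobound (lift 0 f) [C, D] = 0" by (intro lift_cocycle co)
    then show ?thesis by (simp add: v_def)
  qed
  have vr: "v (cst (rmul w s) {}) = v (cst w {})" if "w \<in> G" "s \<in> S" for w s
  proof -
    have c: "clique {s}" using that by (simp add: clique_def)
    have m: "mulset w {s} = rmul w s" "rmul w s \<in> G" using that by simp_all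
    have "cst (rmul w s) {} \<subseteq> cst (rmul w s) {s}" "cst w {} \<subseteq> cst w {s}"
      using m(2) that(1) c by (intro cst_mono; simp)+
    moreover have "cst (rmul w s) {s} = cst w {s}" using cst_mul[OF that(1) c order_refl] m(1) by simp
    ultimately have le: "cst (rmul w s) {} \<subseteq> cst w {s}" "cst w {} \<subseteq> cst w {s}" by simp_all
    have X: "cst (rmul w s) {} \<in> cosets" "cst w {} \<in> cosets" "cst w {s} \<in> cosets"
      using m(2) that(1) c by simp_all
    show ?thesis using v[OF X(1,3) le(1)] v[OF X(2,3) le(2)] by simp
  qed
  have v1: "v (cst w {}) = v (cst one {})" if w: "w \<in> G" for w
  proof -
    obtain ys where ys: "ys \<in> lists S" "w = foldl rmul one ys" using G_reduced_word[OF w] by metis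
    have "v (cst (foldl rmul u ys) {}) = v (cst u {})" if "u \<in> G" for u
      using ys(1) that by (induction ys arbitrary: u) (auto simp: vr)
    then show ?thesis using ys by simp
  qed
  have "f \<sigma> = v (cst one {})" if s: "\<sigma> \<in> ssimp S E 0" for \<sigma>
  proof -
    note l = to_list_schains[OF s] and e = ssimpE[OF s]
    have "to_list \<sigma> = [fst \<sigma>]" using l(1,3) by (cases "to_list \<sigma>") (auto simp: schains_def)
    then have "f \<sigma> = v (fst \<sigma>)" using l by (simp add: v_def lift_def)
    also have "\<dots> = v (cst (minrep (fst \<sigma>)) {})"
    proof (rule v[symmetric])
      have "cst (minrep (fst \<sigma>)) {} \<subseteq> cst (minrep (fst \<sigma>)) (hd (snd \<sigma>))"
        using e by (intro cst_mono) auto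
      then show "cst (minrep (fst \<sigma>)) {} \<subseteq> fst \<sigma>" using e(4) by simp
    qed (use e(1,5) in simp_all)
    also have "\<dots> = v (cst one {})" by (rule v1[OF e(5)])
    finally show ?thesis .
  qed
  moreover have "f \<sigma> = 0" if "\<sigma> \<notin> ssimp S E 0" for \<sigma> using f that by (cases \<sigma>) (auto simp: l2coch_def)
  ultimately have "f = (\<lambda>\<sigma>. if \<sigma> \<in> ssimp S E 0 then v (cst one {}) else 0)" by (simp add: fun_eq_iff)
  then show "f \<in> range (\<lambda>z \<sigma>. if \<sigma> \<in> ssimp S E 0 then z else 0)" by (rule range_eqI)
next
  fix f :: "'a dsimplex \<Rightarrow> complex" assume "f \<in> range (\<lambda>z \<sigma>. if \<sigma> \<in> ssimp S E 0 then z else 0)"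
  then obtain z where f: "f = (\<lambda>\<sigma>. if \<sigma> \<in> ssimp S E 0 then z else 0)" by auto
  have "cobd S E 0 f \<sigma> = 0" if "\<sigma> \<in> ssimp S E (Suc 0)" for \<sigma>
    using sface_ssimp[OF that] by (simp add: cobd_def f)
  then show "f \<in> harmonic S E t 0" using const_l2[of 0 z] by (simp add: harmonic_def f)
qed

lemma poincare_pos: "clique T \<Longrightarrow> 0 < poincare S E T t"
proof -
  assume "clique T"
  then have "spherical S E T" by (simp add: spherical_iff)
  then have "finite (special S E T)" by (simp add: spherical_def)
  moreover have "special S E T \<noteq> {}" by (auto simp: special_def)
  ultimately show ?thesis unfolding poincare_def using t_pos by (intro sum_pos) auto
qed

text \<open>The embedded harmonic cochains form the line spanned by g, whose squared norm is
  \<open>N * W\<close>. The trace is the sum of \<open>(q c)^2 / (N * W)\<close>; as these squares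
  add up to N, the Poincare polynomials cancel.\<close>

lemma wbetti_0: "wbetti S E t 0 = complex_of_real (1 / growth S E t)"
proof -
  define D where "D = dchains S E 0"
  define q where "q = (\<lambda>c. complex_of_real (1 / sqrt (poincare S E (hd c) t)))"
  define g where "g = (\<lambda>(c, w). if c \<in> D \<and> w \<in> G then q c else 0)"
  define W where "W = complex_of_real (growth S E t)"
  define N where "N = (\<Sum>c\<in>D. (q c)\<^sup>2)"
  define \<delta> where "\<delta> = (\<lambda>(c :: 'a set list) (c', w). if c' = c \<and> w = one then 1 else 0 :: complex)"
  \<comment> \<open>The projection coefficient: the pairing of \<open>\<delta> c\<close> with g,
    divided by the squared norm of g.\<close>
  define z where "z = (\<lambda>c. q c / (N * W))"
  have finD: "finite D" by (simp add: D_def finite_dchains)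
  have cD: "clique (hd c)" if "c \<in> D" for c
    using that by (cases c) (auto simp: D_def dchains_def spherical_iff)
  have q_real: "cnj (q c) = q c" for c by (simp add: q_def)
  have "N = complex_of_real (\<Sum>c\<in>D. (1 / sqrt (poincare S E (hd c) t))\<^sup>2)"
    by (simp add: N_def q_def)
  moreover have "0 < (\<Sum>c\<in>D. (1 / sqrt (poincare S E (hd c) t))\<^sup>2)"
  proof (rule sum_pos[OF finD])
    have "[{}] \<in> D" by (simp add: D_def dchains_def spherical_iff)
    then show "D \<noteq> {}" by blast
    show "0 < (1 / sqrt (poincare S E (hd c) t))\<^sup>2" if "c \<in> D" for c
      using poincare_pos[OF cD[OF that]] by simp
  qed
  ultimately have N0: "N \<noteq> 0" by (metis less_irrefl of_real_eq_0_iff)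
  have W0: "W \<noteq> 0" using growth_pos by (simp add: W_def)
  have V: "embed S E t 0 ` harmonic S E t 0 = range (\<lambda>y p. y * g p)"
  proof -
    have "embed S E t 0 (\<lambda>\<sigma>. if \<sigma> \<in> ssimp S E 0 then y else 0) = (\<lambda>p. y * g p)" for y
      by (auto simp: embed_def g_def q_def D_def ssimp_def fun_eq_iff)
    then show ?thesis by (simp add: harmonic_0 image_image)
  qed
  have growth_sum: "((\<lambda>w. complex_of_real (t ^ cox_len w)) has_sum W) G"
    unfolding W_def growth_def by (intro has_sum_of_real has_sum_infsum growth_summable)
  have gg: "((\<lambda>(c, w). (q c)\<^sup>2 * complex_of_real (t ^ cox_len w)) has_sum (N * W)) (D \<times> G)"
    unfolding N_def by (rule has_sum_finite_times[OF finD growth_sum])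
  have inner: "inner_t S E t 0 (\<delta> c - (\<lambda>p. x * g p)) (\<lambda>p. y * g p) = cnj y * (q c - x * (N * W))"
    if c: "c \<in> D" for c x y
  proof -
    let ?\<delta> = "\<lambda>(c', w). \<delta> c (c', w) * q c' * complex_of_real (t ^ cox_len w)"
    \<comment> \<open>Only the pair \<open>(c, one)\<close> contributes, with weight
      \<open>t ^ 0\<close>.\<close>
    have "(?\<delta> has_sum q c) (D \<times> G)"
      by (rule has_sum_finite_neutralI[where B = "{(c, one)}"]) (use c in \<open>auto simp: \<delta>_def split: if_splits\<close>)
    then have "((\<lambda>p. cnj y * (?\<delta> p + (- x) * (case p of (c, w) \<Rightarrow> (q c)\<^sup>2 * complex_of_real (t ^ cox_len w)))) has_sum
       cnj y * (q c + (- x) * (N * W))) (D \<times> G)"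
      by (intro has_sum_cmult_right has_sum_add gg)
    also have "?this \<longleftrightarrow> ((\<lambda>(c', w). (\<delta> c - (\<lambda>p. x * g p)) (c', w) * cnj (y * g (c', w)) * complex_of_real (t ^ cox_len w)) has_sum
       cnj y * (q c + (- x) * (N * W))) (D \<times> G)"
      by (intro has_sum_cong) (auto simp: g_def q_real algebra_simps power2_eq_square)
    finally show ?thesis unfolding inner_t_def D_def by (simp add: infsumI)
  qed
  have proj: "orth_proj S E t 0 (range (\<lambda>y p. y * g p)) (\<delta> c) = (\<lambda>p. z c * g p)" if c: "c \<in> D" for c
    unfolding orth_proj_def
  proof (rule the_equality)
    show "(\<lambda>p. z c * g p) \<in> range (\<lambda>y p. y * g p) \<and>
        (\<forall>v\<in>range (\<lambda>y p. y * g p). inner_t S E t 0 (\<delta> c - (\<lambda>p. z c * g p)) v = 0)"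
    proof (intro conjI ballI)
      show "(\<lambda>p. z c * g p) \<in> range (\<lambda>y p. y * g p)" by (rule rangeI)
      fix v assume "v \<in> range (\<lambda>y p. y * g p)"
      then obtain y where "v = (\<lambda>p. y * g p)" by auto
      moreover have "q c - z c * (N * W) = 0" using N0 W0 by (simp add: z_def)
      ultimately show "inner_t S E t 0 (\<delta> c - (\<lambda>p. z c * g p)) v = 0"
        by (simp only: inner[OF c] mult_zero_right)
    qed
    fix h assume h: "h \<in> range (\<lambda>y p. y * g p) \<and>
        (\<forall>v\<in>range (\<lambda>y p. y * g p). inner_t S E t 0 (\<delta> c - h) v = 0)"
    then obtain x where x: "h = (\<lambda>p. x * g p)" by auto
    \<comment> \<open>Testing against g itself already fixes the coefficient.\<close>
    have "inner_t S E t 0 (\<delta> c - h) (\<lambda>p. 1 * g p) = 0" using h by blast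
    then have "q c - x * (N * W) = 0" unfolding x inner[OF c] by simp
    then have "x = z c" using N0 W0 by (simp add: z_def field_simps)
    then show "h = (\<lambda>p. z c * g p)" using x by simp
  qed
  have "wbetti S E t 0 = (\<Sum>c\<in>D. orth_proj S E t 0 (range (\<lambda>y p. y * g p)) (\<delta> c) (c, one))"
    unfolding wbetti_def V D_def \<delta>_def ..
  also have "\<dots> = (\<Sum>c\<in>D. z c * q c)"
    by (intro sum.cong refl) (simp add: proj, simp add: g_def)
  also have "\<dots> = N / (N * W)"
    by (simp add: z_def N_def sum_divide_distrib power2_eq_square)
  also have "\<dots> = complex_of_real (1 / growth S E t)" using N0 by (simp add: W_def)
  finally show ?thesis .
qed

end

theorem theorem8p2:
  fixes S :: "'a set" and E :: "'a \<Rightarrow> 'a \<Rightarrow> bool" and t :: real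
  assumes "finite S"
    and "\<forall>s u. E s u \<longrightarrow> s \<in> S \<and> u \<in> S"
    and "\<forall>s u. E s u \<longrightarrow> E u s"
    and "\<forall>s. \<not> E s s"
    and "0 < t" and "ereal t < growth_radius S E"
  shows "wbetti S E t 0 = complex_of_real (1 / growth S E t)
       \<and> wchi S E t = complex_of_real (1 / growth S E t)
       \<and> (\<forall>i>0. wbetti S E t i = 0)"
proof -
  interpret racg_growth S E t
    using assms by unfold_locales auto
  have "wchi S E t = (\<Sum>i\<in>{0}. (-1) ^ i * wbetti S E t i)"
    unfolding wchi_def using wbetti_pos by (intro sum.mono_neutral_right) auto
  then show ?thesis using wbetti_0 wbetti_pos by simp
qed

end
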